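(* Let $0<\beta<1$ and $w_\beta(x)=(1+x^2)^{-\beta/2}$ for $x\in\mathbb{R}$. Then the following two estimates hold. \begin{itemize} \item Let $2\le p<\infty$ be such that $\frac32-\beta\left(1-\frac1p\right)>1$. Then the commutator $\frac{1}{w_\beta}[\Lambda^{1/2},w_\beta]$ is bounded from $L^p(w_\beta\,dx)$ to $L^p(w_\beta\,dx)$. \item Let $2\le p<\infty$. Then the commutator $\frac{1}{\sqrt{w_\beta}}[\Lambda,\sqrt{w_\beta}]$ is bounded from $L^p(w_\beta\,dx)$ to $L^p(w_\beta\,dx)$. \end{itemize}
   Context: For a weight $w$ on $\mathbb{R}$ and $1\le p<\infty$, $\|f\|_{L^p(w\,dx)}=\left(\int_{\mathbb{R}}|f(x)|^p\,w(x)\,dx\right)^{1/p}$. For $0<\alpha<2$, $$\Lambda^\alpha f(x)=(-\Delta)^{\alpha/2}f(x)=C_\alpha\,\mathrm{P.V.}\int_{\mathbb{R}}\frac{f(x)-f(y)}{|x-y|^{1+\alpha}}\,dy,$$ with $C_\alpha>0$ the normalizing constant depending only on $\alpha$ (with $C_1=1/\pi$), and $\Lambda=\Lambda^1$. For a function $g$, identified with the operator of multiplication by $g$, the commutator is $[\Lambda^\alpha,g]f=\Lambda^\alpha(gf)-g\,\Lambda^\alpha f$. Thus $\frac1g[\Lambda^\alpha,g]$ is the operator $f\mapsto \frac{1}{g}\left(\Lambda^\alpha(gf)-g\,\Lambda^\alpha f\right)$. Boundedness means that there is a constant $C$, independent of $f$, with $\left\|\frac1g[\Lambda^\alpha,g]f\right\|_{L^p(w_\beta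 dx)}\le C\|f\|_{L^p(w_\beta dx)}$. *)

theory Defs
  imports "HOL-Analysis.Analysis"
begin

definition weight :: "real \<Rightarrow> real \<Rightarrow> real" where
  "weight \<beta> x = (1 + x\<^sup>2) powr (- \<beta> / 2)"

(* Functions are not identified up to null sets, so Lp_norm is a seminorm. It is
   meaningful only on weighted_Lp, since the Bochner integral of a non-integrable
   function is 0. *)
definition weighted_Lp :: "real \<Rightarrow> (real \<Rightarrow> real) \<Rightarrow> (real \<Rightarrow> real) set" where
  "weighted_Lp p w =
     {f \<in> borel_measurable lebesgue. integrable lebesgue (\<lambda>x. \<bar>f x\<bar> powr p * w x)}"

definition Lp_norm :: "real \<Rightarrow> (real \<Rightarrow> real) \<Rightarrow> (real \<Rightarrow> real) \<Rightarrow> real" where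
  "Lp_norm p w f = (LINT x|lebesgue. \<bar>f x\<bar> powr p * w x) powr (1 / p)"

(* The normalisation for which the operator below has Fourier symbol \<bar>\<xi>\<bar> powr \<alpha>. *)
definition frac_const :: "real \<Rightarrow> real" where
  "frac_const \<alpha> = 2 powr \<alpha> * Gamma ((1 + \<alpha>) / 2) / (sqrt pi * \<bar>Gamma (- \<alpha> / 2)\<bar>)"

definition frac_integrand :: "real \<Rightarrow> (real \<Rightarrow> real) \<Rightarrow> real \<Rightarrow> real \<Rightarrow> real" where
  "frac_integrand \<alpha> f x y = (f x - f y) / \<bar>x - y\<bar> powr (1 + \<alpha>)"

definition frac_trunc :: "real \<Rightarrow> (real \<Rightarrow> real) \<Rightarrow> real \<Rightarrow> real \<Rightarrow> real" where
  "frac_trunc \<alpha> f x \<epsilon> =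
     frac_const \<alpha> * (LINT y:{y. \<epsilon> < \<bar>x - y\<bar>}|lebesgue. frac_integrand \<alpha> f x y)"

definition frac_laplacian_exists :: "real \<Rightarrow> (real \<Rightarrow> real) \<Rightarrow> real \<Rightarrow> bool" where
  "frac_laplacian_exists \<alpha> f x \<longleftrightarrow>
     (\<forall>\<epsilon>>0. set_integrable lebesgue {y. \<epsilon> < \<bar>x - y\<bar>} (frac_integrand \<alpha> f x)) \<and>
     (\<exists>L. (frac_trunc \<alpha> f x \<longlongrightarrow> L) (at_right 0))"

(* The principal value; a junk value where frac_laplacian_exists fails. *)
definition frac_laplacian :: "real \<Rightarrow> (real \<Rightarrow> real) \<Rightarrow> real \<Rightarrow> real" where
  "frac_laplacian \<alpha> f x = Lim (at_right 0) (frac_trunc \<alpha> f x)"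

definition commutator :: "real \<Rightarrow> (real \<Rightarrow> real) \<Rightarrow> (real \<Rightarrow> real) \<Rightarrow> real \<Rightarrow> real" where
  "commutator \<alpha> g f x =
     frac_laplacian \<alpha> (\<lambda>y. g y * f y) x - g x * frac_laplacian \<alpha> f x"

definition commutator_domain :: "real \<Rightarrow> (real \<Rightarrow> real) \<Rightarrow> (real \<Rightarrow> real) set" where
  "commutator_domain \<alpha> g =
     {f. AE x in lebesgue. frac_laplacian_exists \<alpha> (\<lambda>y. g y * f y) x \<and>
                           frac_laplacian_exists \<alpha> f x}"

definition test_functions :: "(real \<Rightarrow> real) set" where
  "test_functions =
     {f. (\<forall>n x. (deriv ^^ n) f differentiable (at x)) \<and> (\<exists>R. \<forall>x. R < \<bar>x\<bar> \<longrightarrow> f x = 0)}"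

(* Principal values do not exist for every element of L^p(w), so the operator T is only
   given on a domain D. The domain has to contain the test functions, which are dense in
   L^p(w) for locally integrable w and finite p; this excludes vacuous estimates and makes
   the bounded extension of T to L^p(w) unique. The estimate is required on all of
   D \<inter> L^p(w), not only for test functions. *)
definition bounded_on_Lp ::
  "(real \<Rightarrow> real) set \<Rightarrow> ((real \<Rightarrow> real) \<Rightarrow> real \<Rightarrow> real) \<Rightarrow> real \<Rightarrow> (real \<Rightarrow> real) \<Rightarrow> bool" where
  "bounded_on_Lp D T p w \<longleftrightarrow>
     test_functions \<subseteq> D \<and>
     (\<exists>C. \<forall>f \<in> D \<inter> weighted_Lp p w.
        T f \<in> weighted_Lp p w \<and> Lp_norm p w (T f) \<le> C * Lp_norm p w f)"

lemma not_nonpos_Int: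
  assumes "-1 < (x::real)" "x < 0"
  shows "x \<notin> \<int>\<^sub>\<le>\<^sub>0"
proof
  assume "x \<in> \<int>\<^sub>\<le>\<^sub>0"
  then obtain n :: int where "x = of_int n"
    by (auto simp: nonpos_Ints_def)
  with assms show False by simp
qed

lemma frac_const_1: "frac_const 1 = 1 / pi"
proof -
  have "Gamma (1/2 :: real) = (-1/2) * Gamma (-1/2)"
    using Gamma_plus1[OF not_nonpos_Int[of "-1/2"]] by simp
  then have "Gamma (-1/2 :: real) = -2 * sqrt pi"
    by (simp add: Gamma_one_half_real)
  then show ?thesis
    by (simp add: frac_const_def)
qed

lemma frac_const_pos:
  assumes "0 < \<alpha>" "\<alpha> < 2"
  shows "0 < frac_const \<alpha>"
proof -
  have "Gamma (- \<alpha> / 2) \<noteq> 0"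
    using assms not_nonpos_Int[of "- \<alpha> / 2"] by (simp add: Gamma_eq_zero_iff)
  moreover have "Gamma ((1 + \<alpha>) / 2) > 0"
    using assms by (intro Gamma_real_pos) auto
  ultimately show ?thesis
    by (simp add: frac_const_def)
qed

end

theory Submission
  imports Defs "HOL-Complex_Analysis.Cauchy_Integral_Formula"
begin

text \<open>In the commutator the terms with \<open>g x f x\<close> cancel: truncated at \<open>\<epsilon>\<close>, the value at \<open>x\<close> of
\<open>(1/g) [\<Lambda>\<^sup>\<alpha>, g] f\<close> is a constant times the integral of
\<open>(g x - g y) f y / (g x \<bar>x - y\<bar>\<^bsup>1 + \<alpha>\<^esup>)\<close> over \<open>\<bar>x - y\<bar> > \<epsilon>\<close>.  By Fatou's lemma it therefore
suffices to bound these truncated operators on \<open>L\<^sup>p(w)\<close> uniformly in \<open>\<epsilon>\<close>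
(\<open>bounded_on_Lp_if_truncations_bounded\<close>).  Positive kernels are handled by Schur's test in \<open>L\<^sup>p(w dx)\<close>
(\<open>schur_test\<close>).

For \<open>\<alpha> = 1/2\<close> and \<open>g = w\<close> the kernel is absolutely integrable at the diagonal, because \<open>w\<close> is Lipschitz, and
\<open>w x\<close> times the absolute kernel is symmetric in \<open>x\<close> and \<open>y\<close>.  So the column condition of Schur's test is the row
condition, and the latter is the estimate \<open>half_kernel_bound\<close>.

For \<open>\<alpha> = 1\<close> and \<open>g = \<surd>w\<close> the kernel behaves like \<open>g'(x) / (g x (x - y))\<close> at the diagonal.  The part
\<open>\<bar>x - y\<bar> > 1\<close> is again covered by Schur's test, since \<open>g y \<le> 2 \<bar>x - y\<bar>\<^bsup>\<beta>/2\<^esup> g x\<close> there.  In the part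
\<open>\<bar>x - y\<bar> \<le> 1\<close> the weight is first moved into the function, \<open>\<phi> = w\<^bsup>1/p\<^esup> f\<close>; up to a bounded kernel, what
remains is the bounded function \<open>g'/g\<close> times the truncated Hilbert transform of \<open>\<phi>\<close>, now on the unweighted space
\<open>L\<^sup>p(dx)\<close> (\<open>sqrt_commutator_minus_hilbert_annulus\<close>).

The truncated Hilbert kernel differs from the conjugate Poisson kernel by at most a Poisson kernel.  So everything
is reduced to M. Riesz' inequality \<open>\<parallel>F\<parallel>\<^sub>p \<le> p \<parallel>Re F\<parallel>\<^sub>p\<close> on horizontal lines, for \<open>F\<close> holomorphic and
decaying in a half plane and for \<open>p \<ge> 2\<close> (\<open>riesz_half_plane\<close>).  Its proof rests on the function
\<open>W(u + iv) = \<bar>u + iv\<bar>\<^bsup>p-2\<^esup> (a v\<^sup>2 - (2 - a) u\<^sup>2)\<close> with \<open>a = 4/p\<^sup>2\<close>: it is superharmonic, so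
\<open>W \<circ> F\<close> is superharmonic as well and its integral over a horizontal line is at most \<open>0\<close>, while
\<open>W = a \<bar>u + iv\<bar>\<^sup>p - 2 \<bar>u + iv\<bar>\<^bsup>p-2\<^esup> u\<^sup>2\<close>.  Hence
\<open>a \<integral>\<bar>F\<bar>\<^sup>p \<le> 2 \<integral>\<bar>F\<bar>\<^bsup>p-2\<^esup> (Re F)\<^sup>2\<close>, and splitting according to the size of
\<open>(Re F)\<^sup>2 / \<bar>F\<bar>\<^sup>2\<close> gives the inequality.

Test functions belong to the domain of the operators because for a bounded \<open>C\<^sup>2\<close> function the linear Taylor term
is odd about \<open>x\<close> and drops out of every truncated integral; what remains is absolutely integrable.\<close>

section \<open>Integrals of superharmonic functions over lines\<close>

lemma nn_integral_le_if_truncations_le: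
  fixes f :: "real \<Rightarrow> ennreal"
  assumes [measurable]: "f \<in> borel_measurable lborel"
    and le: "\<And>n::nat. (\<integral>\<^sup>+x. f x * indicator {- real n..real n} x \<partial>lborel) \<le> c"
  shows "(\<integral>\<^sup>+x. f x \<partial>lborel) \<le> c"
proof -
  have lim: "(\<lambda>n. f x * indicator {- real n..real n} x) \<longlonglongrightarrow> f x" for x
  proof (rule tendsto_eventually)
    obtain N :: nat where "\<bar>x\<bar> \<le> real N"
      using real_arch_simple by blast
    then show "\<forall>\<^sub>F n in sequentially. f x * indicator {- real n..real n} x = f x"
      by (intro eventually_sequentiallyI[of N]) (auto simp: indicator_def abs_le_iff)
  qed
  have "(\<integral>\<^sup>+x. f x \<partial>lborel) = (\<integral>\<^sup>+x. liminf (\<lambda>n. f x * indicator {- real n..real n} x) \<partial>lborel)"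
    using lim by (intro nn_integral_cong lim_imp_Liminf[symmetric]) simp_all
  also have "\<dots> \<le> liminf (\<lambda>n. \<integral>\<^sup>+x. f x * indicator {- real n..real n} x \<partial>lborel)"
    by (rule nn_integral_liminf) simp
  also have "\<dots> \<le> c"
    using le by (intro Liminf_le) auto
  finally show ?thesis .
qed

lemma nn_integral_reflect_shift:
  fixes f :: "real \<Rightarrow> ennreal" and x :: real
  assumes [measurable]: "f \<in> borel_measurable borel"
  shows "(\<integral>\<^sup>+y. f (x - y) \<partial>lborel) = (\<integral>\<^sup>+t. f t \<partial>lborel)" "(\<integral>\<^sup>+y. f (y - x) \<partial>lborel) = (\<integral>\<^sup>+t. f t \<partial>lborel)"
proof -
  show "(\<integral>\<^sup>+y. f (x - y) \<partial>lborel) = (\<integral>\<^sup>+t. f t \<partial>lborel)"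
    using nn_integral_real_affine[of f "-1" x] by simp
  show "(\<integral>\<^sup>+y. f (y - x) \<partial>lborel) = (\<integral>\<^sup>+t. f t \<partial>lborel)"
    using nn_integral_real_affine[of f 1 "- x"] by (simp add: add.commute)
qed

text \<open>The antiderivative is \<open>arctan (x / y)\<close>, which varies by at most \<open>\<pi>\<close>.\<close>

lemma nn_integral_Poisson_le:
  fixes y :: real
  assumes "y > 0"
  shows "(\<integral>\<^sup>+x. ennreal (y / (x\<^sup>2 + y\<^sup>2)) \<partial>lborel) \<le> ennreal pi"
proof (rule nn_integral_le_if_truncations_le)
  fix n :: nat
  have "(\<integral>\<^sup>+x. ennreal (y / (x\<^sup>2 + y\<^sup>2)) * indicator {- real n..real n} x \<partial>lborel) =
      ennreal (arctan (real n / y) - arctan (- real n / y))"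
  proof (rule nn_integral_FTC_Icc)
    fix x :: real
    have "x\<^sup>2 + y\<^sup>2 > 0" using assms by (simp add: add_nonneg_pos)
    then show "((\<lambda>x. arctan (x / y)) has_real_derivative y / (x\<^sup>2 + y\<^sup>2)) (at x)"
      using assms
      by (auto intro!: derivative_eq_intros simp: field_simps power2_eq_square)
  qed (use assms in auto)
  also have "\<dots> \<le> ennreal pi"
    using arctan_ubound[of "real n / y"] arctan_lbound[of "- real n / y"]
    by (intro ennreal_leI) linarith
  finally show "(\<integral>\<^sup>+x. ennreal (y / (x\<^sup>2 + y\<^sup>2)) * indicator {- real n..real n} x \<partial>lborel) \<le> ennreal pi" .
qed simp

lemma Poisson_integrable:
  fixes y :: real
  assumes "y > 0"
  shows "integrable lborel (\<lambda>x. 1 / (x\<^sup>2 + y\<^sup>2))" "(LINT x|lborel. 1 / (x\<^sup>2 + y\<^sup>2)) \<le> pi / y"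
proof -
  have i: "integrable lborel (\<lambda>x. y / (x\<^sup>2 + y\<^sup>2))"
    using nn_integral_Poisson_le[OF assms] assms
    by (intro integrableI_bounded) (auto simp: abs_of_nonneg intro: le_less_trans)
  have "(LINT x|lborel. y / (x\<^sup>2 + y\<^sup>2)) \<le> pi"
    using nn_integral_Poisson_le[OF assms] assms nn_integral_eq_integral[OF i]
    by (auto simp: ennreal_le_iff)
  moreover have e: "1 / (x\<^sup>2 + y\<^sup>2) = (1 / y) * (y / (x\<^sup>2 + y\<^sup>2))" for x
    using assms by simp
  ultimately show "(LINT x|lborel. 1 / (x\<^sup>2 + y\<^sup>2)) \<le> pi / y"
    unfolding e using assms by (subst integral_mult_right_zero) (simp add: field_simps)
  show "integrable lborel (\<lambda>x. 1 / (x\<^sup>2 + y\<^sup>2))"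
    unfolding e by (intro integrable_mult_right i)
qed

text \<open>For a superharmonic \<open>S\<close> the function \<open>M y = \<integral> S y x dx\<close> is concave, since \<open>M'' = \<integral> S\<^sub>y\<^sub>y \<le> - \<integral> S\<^sub>x\<^sub>x = 0\<close>.
A concave function that tends to \<open>0\<close> at infinity is nowhere positive.  To differentiate under the
integral sign, the integral is first truncated to \<open>[-R, R]\<close>; the boundary terms \<open>S\<^sub>x (\<plusminus>R)\<close> then spoil
concavity only by \<open>O(1/R)\<close>.\<close>

lemma superharmonic_integral_nonpos:
  fixes S Sx Sy Sxx Syy :: "real \<Rightarrow> real \<Rightarrow> real"
  assumes ab: "0 < a" "a < b"
    and Sx: "\<And>y x. a < y \<Longrightarrow> (S y has_real_derivative Sx y x) (at x)"
    and Sxx: "\<And>y x. a < y \<Longrightarrow> (Sx y has_real_derivative Sxx y x) (at x)"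
    and Sy: "\<And>y x. a < y \<Longrightarrow> ((\<lambda>y. S y x) has_real_derivative Sy y x) (at y)"
    and Syy: "\<And>y x. a < y \<Longrightarrow> ((\<lambda>y. Sy y x) has_real_derivative Syy y x) (at y)"
    and cSy: "continuous_on ({a<..} \<times> UNIV) (\<lambda>(y, x). Sy y x)"
    and cSyy: "continuous_on ({a<..} \<times> UNIV) (\<lambda>(y, x). Syy y x)"
    and superharmonic: "\<And>y x. a < y \<Longrightarrow> Sxx y x + Syy y x \<le> 0"
    and S_bound: "\<And>y x. a < y \<Longrightarrow> \<bar>S y x\<bar> \<le> C / (x\<^sup>2 + y\<^sup>2)"
    and Sx_bound: "\<And>y x. a < y \<Longrightarrow> \<bar>x\<bar> \<ge> 1 \<Longrightarrow> \<bar>Sx y x\<bar> \<le> C / \<bar>x\<bar>"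
  shows "(LINT x|lborel. S b x) \<le> 0"
proof -
  have contS: "continuous_on A (S y)" if "a < y" for A y
    using Sx[OF that] by (meson DERIV_isCont continuous_at_imp_continuous_on)
  have [measurable]: "S y \<in> borel_measurable lborel" if "a < y" for y
    using contS[OF that, of UNIV] by (simp add: borel_measurable_continuous_onI)
  have C0: "C \<ge> 0"
  proof -
    have "0 \<le> C / (0\<^sup>2 + b\<^sup>2)"
      using S_bound[of b 0] ab by linarith
    then show ?thesis
      using ab by (simp add: zero_le_divide_iff)
  qed
  have intS: "integrable lborel (S y)" if "a < y" for y
  proof (rule Bochner_Integration.integrable_bound)
    show "integrable lborel (\<lambda>x. C * (1 / (x\<^sup>2 + y\<^sup>2)))"
      using Poisson_integrable(1)[of y] that ab by (intro integrable_mult_right) auto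
    show "AE x in lborel. norm (S y x) \<le> norm (C * (1 / (x\<^sup>2 + y\<^sup>2)))"
      using S_bound[OF that] C0 by (auto simp: abs_mult)
  qed (use that in simp)
  have abs_int: "\<bar>LINT x|lborel. S y x\<bar> \<le> C * pi / y" if "a < y" for y
  proof -
    have "\<bar>LINT x|lborel. S y x\<bar> \<le> (LINT x|lborel. \<bar>S y x\<bar>)"
      by (rule integral_abs_bound)
    also have "\<dots> \<le> (LINT x|lborel. C * (1 / (x\<^sup>2 + y\<^sup>2)))"
      using S_bound[OF that] intS[OF that] Poisson_integrable(1)[of y] that ab
      by (intro integral_mono integrable_mult_right) auto
    also have "\<dots> \<le> C * (pi / y)"
      using Poisson_integrable(2)[of y] that ab C0
      by (subst integral_mult_right_zero, intro mult_left_mono) auto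
    finally show ?thesis by simp
  qed
  define M where "M R y = integral {- R..R} (S y)" for R y
  have M_lim: "((\<lambda>R. M R y) \<longlongrightarrow> (LINT x|lborel. S y x)) at_top" if "a < y" for y
  proof -
    have "((\<lambda>R. LINT x|lborel. S y x * indicator {- R..R} x) \<longlongrightarrow> (LINT x|lborel. S y x)) at_top"
    proof (rule integral_dominated_convergence_at_top)
      show "integrable lborel (\<lambda>x. \<bar>S y x\<bar>)" using intS[OF that] by simp
      show "\<forall>\<^sub>F R in at_top. AE x in lborel. norm (S y x * indicator {- R..R} x) \<le> \<bar>S y x\<bar>"
        by (intro always_eventually) (auto simp: indicator_def)
      show "AE x in lborel. ((\<lambda>R. S y x * indicator {- R..R} x) \<longlongrightarrow> S y x) at_top"
      proof (intro AE_I2 tendsto_eventually)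
        fix x :: real
        show "\<forall>\<^sub>F R in at_top. S y x * indicator {- R..R} x = S y x"
          using eventually_ge_at_top[of "\<bar>x\<bar>"] by eventually_elim (auto simp: indicator_def)
      qed
    qed (use that in auto)
    moreover have "M R y = (LINT x|lborel. S y x * indicator {- R..R} x)" for R
    proof -
      have "set_integrable lborel {- R..R} (S y)"
        by (intro borel_integrable_atLeastAtMost' contS that)
      then have "M R y = (LINT x:{- R..R}|lborel. S y x)"
        unfolding M_def by (simp add: set_borel_integral_eq_integral)
      then show ?thesis
        by (simp add: set_lebesgue_integral_def mult.commute)
    qed
    ultimately show ?thesis by simp
  qed
  \<comment> \<open>The second derivative of the truncated integral is a boundary term up to sign.\<close>
  have M_chord: "M R b \<le> 2 * M R y - M R (2 * y - b) + C / R * (y - b)\<^sup>2 * 2"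
    if R: "R \<ge> 1" and y: "b \<le> y" for R y
  proof -
    define \<eta> where "\<eta> = 2 * C / R"
    define M1 where "M1 y = integral {- R..R} (Sy y)" for y
    define M2 where "M2 y = integral {- R..R} (Syy y)" for y
    have D1: "(M R has_real_derivative M1 y) (at y)" if "a < y" for y
    proof -
      have "((\<lambda>y. integral (cbox (- R) R) (S y)) has_real_derivative integral (cbox (- R) R) (Sy y))
              (at y within {a<..})"
      proof (rule leibniz_rule_field_derivative)
        show "((\<lambda>y. S y x) has_field_derivative Sy y x) (at y within {a<..})" if "y \<in> {a<..}" for y x
          using Sy[of y x] that by (simp add: has_field_derivative_at_within)
        show "S y integrable_on cbox (- R) R" if "y \<in> {a<..}" for y
          using that contS[of y] by (simp add: integrable_continuous_real)
        show "continuous_on ({a<..} \<times> cbox (- R) R) (\<lambda>(y, x). Sy y x)"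
          by (rule continuous_on_subset[OF cSy]) auto
      qed (use that in auto)
      then show ?thesis
        using that by (simp add: M_def[abs_def] M1_def at_within_open[of y "{a<..}"])
    qed
    have contSy: "continuous_on A (Sy y)" if "a < y" for A y
      using continuous_on_compose2[OF cSy continuous_on_Pair[OF continuous_on_const continuous_on_id], of y A] that
      by auto
    have contSyy: "continuous_on A (Syy y)" if "a < y" for A y
      using continuous_on_compose2[OF cSyy continuous_on_Pair[OF continuous_on_const continuous_on_id], of y A] that
      by auto
    have D2: "(M1 has_real_derivative M2 y) (at y)" if "a < y" for y
    proof -
      have "((\<lambda>y. integral (cbox (- R) R) (Sy y)) has_real_derivative integral (cbox (- R) R) (Syy y))
              (at y within {a<..})"
      proof (rule leibniz_rule_field_derivative)
        show "((\<lambda>y. Sy y x) has_field_derivative Syy y x) (at y within {a<..})" if "y \<in> {a<..}" for y x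
          using Syy[of y x] that by (simp add: has_field_derivative_at_within)
        show "Sy y integrable_on cbox (- R) R" if "y \<in> {a<..}" for y
          using that contSy[of y] by (simp add: integrable_continuous_real)
        show "continuous_on ({a<..} \<times> cbox (- R) R) (\<lambda>(y, x). Syy y x)"
          by (rule continuous_on_subset[OF cSyy]) auto
      qed (use that in auto)
      then show ?thesis
        using that by (simp add: M2_def M1_def[abs_def] at_within_open[of y "{a<..}"])
    qed
    have M2_le: "M2 y \<le> \<eta>" if "a < y" for y
    proof -
      have FTC: "(Sxx y has_integral (Sx y R - Sx y (- R))) {- R..R}"
        using Sxx[OF that] R
        by (intro fundamental_theorem_of_calculus)
           (auto simp flip: has_real_derivative_iff_has_vector_derivative
             intro: has_field_derivative_at_within)
      have "M2 y \<le> - (Sx y R - Sx y (- R))"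
      proof (rule has_integral_le)
        show "(Syy y has_integral M2 y) {- R..R}"
          unfolding M2_def using contSyy[OF that]
          by (intro integrable_integral integrable_continuous_real)
        show "((\<lambda>x. - Sxx y x) has_integral - (Sx y R - Sx y (- R))) {- R..R}"
          by (rule has_integral_neg[OF FTC])
        show "Syy y x \<le> - Sxx y x" for x using superharmonic[OF that, of x] by linarith
      qed
      also have "\<dots> \<le> \<bar>Sx y R\<bar> + \<bar>Sx y (- R)\<bar>" by linarith
      also have "\<dots> \<le> C / \<bar>R\<bar> + C / \<bar>- R\<bar>"
        using R that by (intro add_mono Sx_bound) auto
      also have "\<dots> = \<eta>" using R by (simp add: \<eta>_def)
      finally show ?thesis .
    qed
    have conc: "concave_on {a<..} (\<lambda>y. M R y - \<eta> / 2 * y\<^sup>2)"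
    proof (rule f''_le0_imp_concave)
      show "((\<lambda>y. M R y - \<eta> / 2 * y\<^sup>2) has_real_derivative M1 y - \<eta> * y) (at y)"
        if "y \<in> {a<..}" for y
        using that D1 by (auto intro!: derivative_eq_intros)
      show "((\<lambda>y. M1 y - \<eta> * y) has_real_derivative M2 y - \<eta>) (at y)"
        if "y \<in> {a<..}" for y
        using that D2 by (auto intro!: derivative_eq_intros)
      show "M2 y - \<eta> \<le> 0" if "y \<in> {a<..}" for y
        using M2_le that by simp
    qed simp
    \<comment> \<open>Concavity at \<open>y\<close>, the midpoint of \<open>b\<close> and \<open>2 y - b\<close>, bounds the value at \<open>b\<close> by values further up.\<close>
    let ?h = "\<lambda>y. M R y - \<eta> / 2 * y\<^sup>2"
    have "(1 - 1/2) * ?h b + 1/2 * ?h (2 * y - b) \<le> ?h ((1 - 1/2) *\<^sub>R b + (1/2) *\<^sub>R (2 * y - b))"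
      using ab y by (intro concave_onD[OF conc]) auto
    also have "(1 - 1/2) *\<^sub>R b + (1/2) *\<^sub>R (2 * y - b) = y" by (simp add: field_simps)
    finally have "M R b \<le> 2 * M R y - M R (2 * y - b) + \<eta> / 2 * (b\<^sup>2 + (2 * y - b)\<^sup>2 - 2 * y\<^sup>2)"
      by (simp add: algebra_simps)
    also have "b\<^sup>2 + (2 * y - b)\<^sup>2 - 2 * y\<^sup>2 = 2 * (y - b)\<^sup>2"
      by (simp add: power2_eq_square algebra_simps)
    finally show ?thesis by (simp add: \<eta>_def mult_ac)
  qed
  have main: "(LINT x|lborel. S b x) \<le> 3 * C * pi / y" if y: "b \<le> y" for y
  proof -
    have "(LINT x|lborel. S b x) \<le> 2 * (LINT x|lborel. S y x) - (LINT x|lborel. S (2 * y - b) x)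
            + 0 * (y - b)\<^sup>2 * 2"
    proof (rule tendsto_le)
      show "((\<lambda>R. 2 * M R y - M R (2 * y - b) + C / R * (y - b)\<^sup>2 * 2) \<longlongrightarrow>
        2 * (LINT x|lborel. S y x) - (LINT x|lborel. S (2 * y - b) x) + 0 * (y - b)\<^sup>2 * 2) at_top"
        using y ab
        by (intro tendsto_intros M_lim tendsto_divide_0[OF tendsto_const] filterlim_at_top_imp_at_infinity
             filterlim_ident) auto
      show "((\<lambda>R. M R b) \<longlongrightarrow> (LINT x|lborel. S b x)) at_top"
        using ab by (intro M_lim)
      show "\<forall>\<^sub>F R in at_top. M R b \<le> 2 * M R y - M R (2 * y - b) + C / R * (y - b)\<^sup>2 * 2"
        using eventually_ge_at_top[of 1] by eventually_elim (use M_chord y in auto)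
    qed simp
    also have "\<dots> \<le> 2 * (C * pi / y) + C * pi / (2 * y - b)"
      using abs_int[of y] abs_int[of "2 * y - b"] y ab by auto
    also have "\<dots> \<le> 2 * (C * pi / y) + C * pi / y"
      using y ab C0 by (intro add_left_mono divide_left_mono mult_nonneg_nonneg mult_pos_pos) auto
    finally show ?thesis by simp
  qed
  show ?thesis
  proof (rule tendsto_lowerbound)
    show "((\<lambda>y. 3 * C * pi / y) \<longlongrightarrow> 0) at_top"
      by (intro tendsto_divide_0[OF tendsto_const] filterlim_at_top_imp_at_infinity filterlim_ident)
    show "\<forall>\<^sub>F y in at_top. (LINT x|lborel. S b x) \<le> 3 * C * pi / y"
      using eventually_ge_at_top[of b] by eventually_elim (rule main)
  qed simp
qed

section \<open>Riesz' inequality in a half plane\<close>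

lemma has_real_derivative_along_axes:
  assumes "(G has_field_derivative g) (at (Complex x y))"
  shows "((\<lambda>x. Re (G (Complex x y))) has_real_derivative Re g) (at x)"
    and "((\<lambda>x. Im (G (Complex x y))) has_real_derivative Im g) (at x)"
    and "((\<lambda>y. Re (G (Complex x y))) has_real_derivative - Im g) (at y)"
    and "((\<lambda>y. Im (G (Complex x y))) has_real_derivative Re g) (at y)"
proof -
  have "((\<lambda>x. Complex x y) has_vector_derivative 1) (at x)"
    unfolding Complex_eq by (auto intro!: derivative_eq_intros)
  from field_vector_diff_chain_at[OF this assms]
  have h: "((\<lambda>x. G (Complex x y)) has_vector_derivative g) (at x)" by (simp add: o_def)
  show "((\<lambda>x. Re (G (Complex x y))) has_real_derivative Re g) (at x)"
    and "((\<lambda>x. Im (G (Complex x y))) has_real_derivative Im g) (at x)"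
    using bounded_linear.has_vector_derivative[OF bounded_linear_Re h]
      bounded_linear.has_vector_derivative[OF bounded_linear_Im h]
    by (simp_all add: has_real_derivative_iff_has_vector_derivative)
  have "((\<lambda>y. Complex x y) has_vector_derivative \<i>) (at y)"
    unfolding Complex_eq by (auto intro!: derivative_eq_intros)
  from field_vector_diff_chain_at[OF this assms]
  have v: "((\<lambda>y. G (Complex x y)) has_vector_derivative \<i> * g) (at y)" by (simp add: o_def)
  show "((\<lambda>y. Re (G (Complex x y))) has_real_derivative - Im g) (at y)"
    and "((\<lambda>y. Im (G (Complex x y))) has_real_derivative Re g) (at y)"
    using bounded_linear.has_vector_derivative[OF bounded_linear_Re v]
      bounded_linear.has_vector_derivative[OF bounded_linear_Im v]
    by (simp_all add: has_real_derivative_iff_has_vector_derivative)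
qed

text \<open>The function \<open>W\<close> above with \<open>p = 2 (q + 1)\<close>, where \<open>\<bar>u + iv\<bar>\<^sup>2\<close> has been replaced by
\<open>\<bar>u + iv\<bar>\<^sup>2 + \<delta>\<close> in the power.  This makes \<open>W\<close> smooth at the zeros of \<open>F\<close>; it stays superharmonic, and the
quadratic second factor still gives the decay needed for integration over a line.\<close>

definition riesz_fun :: "real \<Rightarrow> real \<Rightarrow> real \<Rightarrow> real \<Rightarrow> real" where
  "riesz_fun q \<delta> u v =
     (u\<^sup>2 + v\<^sup>2 + \<delta>) powr q * (v\<^sup>2 / (q + 1)\<^sup>2 - (2 - 1 / (q + 1)\<^sup>2) * u\<^sup>2)"

text \<open>The first and second derivative of \<open>riesz_fun\<close> along a curve in the \<open>(u, v)\<close> plane with velocity \<open>(\<alpha>, \<beta>)\<close>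
and acceleration \<open>(\<gamma>, \<kappa>)\<close>.\<close>

definition riesz_fun_D1 :: "real \<Rightarrow> real \<Rightarrow> real \<Rightarrow> real \<Rightarrow> real \<Rightarrow> real \<Rightarrow> real" where
  "riesz_fun_D1 q \<delta> u v \<alpha> \<beta> =
     (let s = u\<^sup>2 + v\<^sup>2 + \<delta>; A = 1 / (q + 1)\<^sup>2; m = A * v\<^sup>2 - (2 - A) * u\<^sup>2
      in s powr q * (2 * q * m * (u * \<alpha> + v * \<beta>) / s + 2 * (A * v * \<beta> - (2 - A) * u * \<alpha>)))"

definition riesz_fun_D2 ::
  "real \<Rightarrow> real \<Rightarrow> real \<Rightarrow> real \<Rightarrow> real \<Rightarrow> real \<Rightarrow> real \<Rightarrow> real \<Rightarrow> real" where
  "riesz_fun_D2 q \<delta> u v \<alpha> \<beta> \<gamma> \<kappa> =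
     (let s = u\<^sup>2 + v\<^sup>2 + \<delta>; A = 1 / (q + 1)\<^sup>2; m = A * v\<^sup>2 - (2 - A) * u\<^sup>2;
          e = u * \<alpha> + v * \<beta>; e' = \<alpha>\<^sup>2 + \<beta>\<^sup>2 + u * \<gamma> + v * \<kappa>;
          n = 2 * (A * v * \<beta> - (2 - A) * u * \<alpha>);
          n' = 2 * (A * (\<beta>\<^sup>2 + v * \<kappa>) - (2 - A) * (\<alpha>\<^sup>2 + u * \<gamma>))
      in s powr q * (2 * q * e / s * (2 * q * m * e / s + n)
           + (2 * q * (n * e + m * e') / s - 4 * q * m * e\<^sup>2 / s\<^sup>2 + n')))"

lemma DERIV_powr_const:
  assumes "(f has_real_derivative f') (at t)" "f t > 0"
  shows "((\<lambda>t. f t powr q) has_real_derivative f t powr q * (q * f' / f t)) (at t)"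
proof -
  have "((\<lambda>t. f t powr q) has_real_derivative f t powr q * (0 * ln (f t) + f' * q / f t)) (at t)"
    by (rule DERIV_powr[OF assms]) (auto intro!: derivative_eq_intros)
  then show ?thesis by (simp add: mult.commute)
qed

lemma riesz_fun_has_derivative:
  assumes U: "(U has_real_derivative \<alpha>) (at t)" and V: "(V has_real_derivative \<beta>) (at t)"
    and "\<delta> > 0"
  shows "((\<lambda>t. riesz_fun q \<delta> (U t) (V t)) has_real_derivative riesz_fun_D1 q \<delta> (U t) (V t) \<alpha> \<beta>) (at t)"
proof -
  define A where "A = 1 / (q + 1)\<^sup>2"
  have s: "(U t)\<^sup>2 + (V t)\<^sup>2 + \<delta> > 0" using assms by (simp add: add_nonneg_pos)
  have ds: "((\<lambda>t. (U t)\<^sup>2 + (V t)\<^sup>2 + \<delta>) has_real_derivative 2 * (U t * \<alpha> + V t * \<beta>)) (at t)"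
    using U V by (auto intro!: derivative_eq_intros simp: algebra_simps)
  have dm: "((\<lambda>t. A * (V t)\<^sup>2 - (2 - A) * (U t)\<^sup>2) has_real_derivative
      2 * (A * V t * \<beta> - (2 - A) * U t * \<alpha>)) (at t)"
    using U V by (auto intro!: derivative_eq_intros simp: algebra_simps)
  have e: "riesz_fun q \<delta> (U t) (V t) =
      ((U t)\<^sup>2 + (V t)\<^sup>2 + \<delta>) powr q * (A * (V t)\<^sup>2 - (2 - A) * (U t)\<^sup>2)" for t
    by (simp add: riesz_fun_def A_def)
  show ?thesis
    unfolding e riesz_fun_D1_def Let_def A_def[symmetric]
    by (rule DERIV_cong[OF DERIV_mult[OF DERIV_powr_const[OF ds s] dm]]) (simp add: algebra_simps)
qed

lemma riesz_fun_D1_has_derivative: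
  assumes U: "(U has_real_derivative \<alpha> t) (at t)" and V: "(V has_real_derivative \<beta> t) (at t)"
    and a: "(\<alpha> has_real_derivative \<gamma>) (at t)" and b: "(\<beta> has_real_derivative \<kappa>) (at t)"
    and "\<delta> > 0"
  shows "((\<lambda>t. riesz_fun_D1 q \<delta> (U t) (V t) (\<alpha> t) (\<beta> t)) has_real_derivative
           riesz_fun_D2 q \<delta> (U t) (V t) (\<alpha> t) (\<beta> t) \<gamma> \<kappa>) (at t)"
proof -
  define A where "A = 1 / (q + 1)\<^sup>2"
  define s where "s t = (U t)\<^sup>2 + (V t)\<^sup>2 + \<delta>" for t
  define m where "m t = A * (V t)\<^sup>2 - (2 - A) * (U t)\<^sup>2" for t
  define e where "e t = U t * \<alpha> t + V t * \<beta> t" for t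
  define n where "n t = 2 * (A * V t * \<beta> t - (2 - A) * U t * \<alpha> t)" for t
  define e' where "e' = (\<alpha> t)\<^sup>2 + (\<beta> t)\<^sup>2 + U t * \<gamma> + V t * \<kappa>"
  define n' where "n' = 2 * (A * ((\<beta> t)\<^sup>2 + V t * \<kappa>) - (2 - A) * ((\<alpha> t)\<^sup>2 + U t * \<gamma>))"
  have s: "s t > 0" using assms by (simp add: s_def add_nonneg_pos)
  have ds: "(s has_real_derivative 2 * e t) (at t)"
    unfolding s_def[abs_def] e_def using U V
    by (auto intro!: derivative_eq_intros simp: algebra_simps)
  have dm: "(m has_real_derivative n t) (at t)"
    unfolding m_def[abs_def] n_def using U V
    by (auto intro!: derivative_eq_intros simp: algebra_simps)
  have de: "(e has_real_derivative e') (at t)"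
    unfolding e_def[abs_def] e'_def using U V a b
    by (auto intro!: derivative_eq_intros simp: algebra_simps power2_eq_square)
  have dn: "(n has_real_derivative n') (at t)"
    unfolding n_def[abs_def] n'_def using U V a b
    by (auto intro!: derivative_eq_intros simp: algebra_simps power2_eq_square)
  have dq: "((\<lambda>t. 2 * q * m t * e t / s t + n t) has_real_derivative
      (2 * q * (n t * e t + m t * e') / s t - 4 * q * m t * (e t)\<^sup>2 / (s t)\<^sup>2 + n')) (at t)"
    using s dm de dn ds
    by (auto intro!: derivative_eq_intros simp: field_simps power2_eq_square)
  have eq: "riesz_fun_D1 q \<delta> (U t) (V t) (\<alpha> t) (\<beta> t) =
      s t powr q * (2 * q * m t * e t / s t + n t)" for t
    by (simp add: riesz_fun_D1_def Let_def A_def s_def m_def e_def n_def)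
  have eq2: "riesz_fun_D2 q \<delta> (U t) (V t) (\<alpha> t) (\<beta> t) \<gamma> \<kappa> =
      s t powr q * (2 * q * e t / s t * (2 * q * m t * e t / s t + n t)
      + (2 * q * (n t * e t + m t * e') / s t - 4 * q * m t * (e t)\<^sup>2 / (s t)\<^sup>2 + n'))"
    by (simp add: riesz_fun_D2_def Let_def A_def s_def m_def e_def n_def e'_def n'_def)
  show ?thesis
    unfolding eq eq2
    by (rule DERIV_cong[OF DERIV_mult[OF DERIV_powr_const[OF ds s] dq]]) (simp add: algebra_simps)
qed

text \<open>By the Cauchy-Riemann equations, \<open>F\<close> moves along the \<open>y\<close> axis with velocity \<open>(-\<beta>, \<alpha>)\<close> and acceleration
\<open>(-\<gamma>, -\<kappa>)\<close> if it does so along the \<open>x\<close> axis with \<open>(\<alpha>, \<beta>)\<close> and \<open>(\<gamma>, \<kappa>)\<close>.  Hence the left-hand side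
is the Laplacian of \<open>W \<circ> F\<close>.  The choice \<open>a = 1/(q+1)\<^sup>2\<close> is dictated by the worst case \<open>u = 0\<close>,
\<open>\<delta> = 0\<close>, in which \<open>a q (q + 2) = 1 - a\<close> is exactly what is required.\<close>

lemma riesz_fun_superharmonic:
  assumes q: "q \<ge> 0" and \<delta>: "\<delta> > 0"
  shows "riesz_fun_D2 q \<delta> u v \<alpha> \<beta> \<gamma> \<kappa> + riesz_fun_D2 q \<delta> u v (- \<beta>) \<alpha> (- \<gamma>) (- \<kappa>) \<le> 0"
proof -
  define A where "A = 1 / (q + 1)\<^sup>2"
  define s where "s = u\<^sup>2 + v\<^sup>2 + \<delta>"
  define r where "r = u\<^sup>2 + v\<^sup>2"
  define m where "m = A * v\<^sup>2 - (2 - A) * u\<^sup>2"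
  define g where "g = \<alpha>\<^sup>2 + \<beta>\<^sup>2"
  have s: "s > 0" "r \<le> s" "r \<ge> 0"
    using \<delta> by (auto simp: s_def r_def add_nonneg_pos)
  have A: "A > 0" "A \<le> 1" "A * (q + 1)\<^sup>2 = 1"
    using q one_le_power[of "q + 1" 2] by (auto simp: A_def divide_simps)
  have D2: "riesz_fun_D2 q \<delta> u v \<alpha> \<beta> \<gamma> \<kappa> + riesz_fun_D2 q \<delta> u v (- \<beta>) \<alpha> (- \<gamma>) (- \<kappa>)
     = s powr q * (g * ((12 * q * s + 4 * q * (q - 1) * r) * m / s\<^sup>2 - 4 * (1 - A)))"
    unfolding riesz_fun_D2_def Let_def A_def[symmetric] s_def[symmetric]
      distrib_left[symmetric]
  proof (rule arg_cong[where f = "\<lambda>x. s powr q * x"], goal_cases)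
    case 1
    define e1 where "e1 = u * \<alpha> + v * \<beta>"
    define e2 where "e2 = u * (- \<beta>) + v * \<alpha>"
    define n1 where "n1 = 2 * (A * v * \<beta> - (2 - A) * u * \<alpha>)"
    define n2 where "n2 = 2 * (A * v * \<alpha> - (2 - A) * u * (- \<beta>))"
    have ee: "e1\<^sup>2 + e2\<^sup>2 = r * g"
      by (simp add: e1_def e2_def r_def g_def power2_eq_square algebra_simps)
    have ne: "n1 * e1 + n2 * e2 = 2 * m * g"
      by (simp add: e1_def e2_def n1_def n2_def m_def g_def power2_eq_square algebra_simps)
    have "2 * q * e1 / s * (2 * q * m * e1 / s + n1)
       + (2 * q * (n1 * e1 + m * (\<alpha>\<^sup>2 + \<beta>\<^sup>2 + u * \<gamma> + v * \<kappa>)) / s - 4 * q * m * e1\<^sup>2 / s\<^sup>2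
          + 2 * (A * (\<beta>\<^sup>2 + v * \<kappa>) - (2 - A) * (\<alpha>\<^sup>2 + u * \<gamma>)))
       + (2 * q * e2 / s * (2 * q * m * e2 / s + n2)
       + (2 * q * (n2 * e2 + m * ((- \<beta>)\<^sup>2 + \<alpha>\<^sup>2 + u * (- \<gamma>) + v * (- \<kappa>))) / s
          - 4 * q * m * e2\<^sup>2 / s\<^sup>2
          + 2 * (A * (\<alpha>\<^sup>2 + v * (- \<kappa>)) - (2 - A) * ((- \<beta>)\<^sup>2 + u * (- \<gamma>)))))
       = 4 * q\<^sup>2 * m * (e1\<^sup>2 + e2\<^sup>2) / s\<^sup>2 + 4 * q * (n1 * e1 + n2 * e2) / s
         + 4 * q * m * g / s - 4 * q * m * (e1\<^sup>2 + e2\<^sup>2) / s\<^sup>2 - 4 * (1 - A) * g"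
      using s by (simp add: g_def field_simps power2_eq_square)
    also have "\<dots> = g * ((12 * q * s + 4 * q * (q - 1) * r) * m / s\<^sup>2 - 4 * (1 - A))"
      unfolding ee ne using s by (simp add: field_simps power2_eq_square)
    finally show ?case unfolding e1_def e2_def n1_def n2_def m_def .
  qed
  have m_le: "m \<le> A * r"
    using A by (simp add: m_def r_def algebra_simps)
  define E where "E = 12 * q * s + 4 * q * (q - 1) * r"
  have "E = 4 * q * (3 * s - r) + 4 * q\<^sup>2 * r"
    by (simp add: E_def algebra_simps power2_eq_square)
  then have E0: "E \<ge> 0" using s q by simp
  have "r * E \<le> 4 * q * (q + 2) * s\<^sup>2"
  proof -
    \<comment> \<open>The difference vanishes at \<open>r = s\<close>, that is for \<open>\<delta> = 0\<close>.\<close>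
    have "4 * q * (q + 2) * s\<^sup>2 - r * E = 4 * q * (s - r) * ((q - 1) * (s + r) + 3 * s)"
      by (simp add: E_def algebra_simps power2_eq_square)
    also have "(q - 1) * (s + r) + 3 * s = q * (s + r) + (s - r) + s"
      by (simp add: algebra_simps)
    also have "4 * q * (s - r) * (q * (s + r) + (s - r) + s) \<ge> 0"
      using q s by (intro mult_nonneg_nonneg add_nonneg_nonneg) auto
    finally show ?thesis by simp
  qed
  then have "A * (r * E) \<le> A * (4 * q * (q + 2) * s\<^sup>2)"
    using A by (intro mult_left_mono) auto
  also have "\<dots> = 4 * (A * (q + 1)\<^sup>2 - A) * s\<^sup>2"
    by (simp add: algebra_simps power2_eq_square)
  finally have "A * (r * E) \<le> 4 * (1 - A) * s\<^sup>2" using A by simp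
  moreover have "E * m \<le> E * (A * r)"
    using m_le E0 by (rule mult_left_mono)
  ultimately have "E * m \<le> 4 * (1 - A) * s\<^sup>2" by (simp add: algebra_simps)
  then have "E * m / s\<^sup>2 - 4 * (1 - A) \<le> 0"
    using s by (simp add: divide_simps)
  then show ?thesis
    unfolding D2 E_def[symmetric] using s
    by (intro mult_nonneg_nonpos) (auto simp: g_def)
qed

lemma continuous_on_riesz_fun_D1:
  fixes u v \<alpha> \<beta> :: "'a :: topological_space \<Rightarrow> real"
  assumes [continuous_intros]: "continuous_on S u" "continuous_on S v" "continuous_on S \<alpha>" "continuous_on S \<beta>"
    and "\<delta> > 0"
  shows "continuous_on S (\<lambda>w. riesz_fun_D1 q \<delta> (u w) (v w) (\<alpha> w) (\<beta> w))"
proof -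
  have "(u w)\<^sup>2 + (v w)\<^sup>2 + \<delta> > 0" for w using assms(5) by (simp add: add_nonneg_pos)
  then have ne: "\<forall>w\<in>S. (u w)\<^sup>2 + (v w)\<^sup>2 + \<delta> \<noteq> 0" by (metis less_irrefl)
  show ?thesis
    unfolding riesz_fun_D1_def Let_def by (intro continuous_intros) (use ne in simp_all)
qed

lemma continuous_on_riesz_fun_D2:
  fixes u v \<alpha> \<beta> :: "'a :: topological_space \<Rightarrow> real"
  assumes [continuous_intros]: "continuous_on S u" "continuous_on S v" "continuous_on S \<alpha>" "continuous_on S \<beta>"
      "continuous_on S \<gamma>" "continuous_on S \<kappa>"
    and "\<delta> > 0"
  shows "continuous_on S (\<lambda>w. riesz_fun_D2 q \<delta> (u w) (v w) (\<alpha> w) (\<beta> w) (\<gamma> w) (\<kappa> w))"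
proof -
  have "(u w)\<^sup>2 + (v w)\<^sup>2 + \<delta> > 0" for w using assms(7) by (simp add: add_nonneg_pos)
  then have ne: "\<forall>w\<in>S. (u w)\<^sup>2 + (v w)\<^sup>2 + \<delta> \<noteq> 0" by (metis less_irrefl)
  show ?thesis
    unfolding riesz_fun_D2_def Let_def by (intro continuous_intros) (use ne in simp_all)
qed

lemma riesz_fun_bound:
  assumes "q \<ge> 0" "\<delta> > 0" "u\<^sup>2 + v\<^sup>2 \<le> r\<^sup>2" "u\<^sup>2 + v\<^sup>2 + \<delta> \<le> s0"
  shows "\<bar>riesz_fun q \<delta> u v\<bar> \<le> s0 powr q * (2 * r\<^sup>2)"
proof -
  define A where "A = 1 / (q + 1)\<^sup>2"
  have A: "A > 0" "A \<le> 1"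
    using assms(1) one_le_power[of "q + 1" 2] by (auto simp: A_def divide_simps)
  have "A * v\<^sup>2 \<le> 1 * v\<^sup>2" "(2 - A) * u\<^sup>2 \<le> 2 * u\<^sup>2" "A * v\<^sup>2 \<ge> 0" "(2 - A) * u\<^sup>2 \<ge> 0"
    using A by (intro mult_right_mono mult_nonneg_nonneg; simp)+
  then have m: "\<bar>A * v\<^sup>2 - (2 - A) * u\<^sup>2\<bar> \<le> 2 * r\<^sup>2"
    using assms(3) zero_le_power2[of u] zero_le_power2[of v] by linarith
  have "(u\<^sup>2 + v\<^sup>2 + \<delta>) powr q \<le> s0 powr q"
    using assms by (intro powr_mono2) auto
  then show ?thesis
    using m by (simp add: riesz_fun_def A_def abs_mult mult_mono)
qed

lemma riesz_fun_D1_bound: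
  assumes "q \<ge> 0" "\<delta> > 0" "u\<^sup>2 + v\<^sup>2 \<le> r\<^sup>2" "u\<^sup>2 + v\<^sup>2 + \<delta> \<le> s0"
    and D: "\<bar>\<alpha>\<bar> \<le> D" "\<bar>\<beta>\<bar> \<le> D" and "r \<ge> 0"
  shows "\<bar>riesz_fun_D1 q \<delta> u v \<alpha> \<beta>\<bar> \<le> s0 powr q * ((8 * q + 8) * D * r)"
proof -
  define A where "A = 1 / (q + 1)\<^sup>2"
  define s where "s = u\<^sup>2 + v\<^sup>2 + \<delta>"
  define m where "m = A * v\<^sup>2 - (2 - A) * u\<^sup>2"
  have A: "A > 0" "A \<le> 1"
    using assms(1) one_le_power[of "q + 1" 2] by (auto simp: A_def divide_simps)
  have s: "s > 0" using assms by (simp add: s_def add_nonneg_pos)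
  have "A * v\<^sup>2 \<le> 1 * v\<^sup>2" "(2 - A) * u\<^sup>2 \<le> 2 * u\<^sup>2" "A * v\<^sup>2 \<ge> 0" "(2 - A) * u\<^sup>2 \<ge> 0"
    using A by (intro mult_right_mono mult_nonneg_nonneg; simp)+
  then have "\<bar>A * v\<^sup>2 - (2 - A) * u\<^sup>2\<bar> \<le> 2 * u\<^sup>2 + v\<^sup>2" by linarith
  also have "\<dots> \<le> 2 * s" using assms(2) by (simp add: s_def)
  finally have m: "\<bar>m\<bar> \<le> 2 * s" unfolding m_def .
  have ur: "\<bar>u\<bar> \<le> r"
  proof -
    have "u\<^sup>2 \<le> r\<^sup>2" using assms(3) zero_le_power2[of v] by linarith
    then show ?thesis using power2_le_imp_le[of "\<bar>u\<bar>" r] \<open>r \<ge> 0\<close> by simp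
  qed
  have vr: "\<bar>v\<bar> \<le> r"
  proof -
    have "v\<^sup>2 \<le> r\<^sup>2" using assms(3) zero_le_power2[of u] by linarith
    then show ?thesis using power2_le_imp_le[of "\<bar>v\<bar>" r] \<open>r \<ge> 0\<close> by simp
  qed
  have pr: "\<bar>u * \<alpha>\<bar> \<le> r * D" "\<bar>v * \<beta>\<bar> \<le> r * D"
    using ur vr D \<open>r \<ge> 0\<close> by (auto simp: abs_mult intro!: mult_mono)
  have e: "\<bar>u * \<alpha> + v * \<beta>\<bar> \<le> 2 * r * D" using pr by linarith
  have rD: "r * D \<ge> 0" using \<open>r \<ge> 0\<close> D by auto
  have t1: "\<bar>2 * q * m * (u * \<alpha> + v * \<beta>) / s\<bar> \<le> 8 * q * (r * D)"
  proof -
    have "\<bar>m * (u * \<alpha> + v * \<beta>)\<bar> \<le> (2 * s) * (2 * r * D)"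
      unfolding abs_mult using m e s by (intro mult_mono) auto
    then have "\<bar>m * (u * \<alpha> + v * \<beta>)\<bar> / s \<le> 4 * (r * D)"
      using s by (simp add: divide_simps mult_ac)
    then have "2 * q * (\<bar>m * (u * \<alpha> + v * \<beta>)\<bar> / s) \<le> 2 * q * (4 * (r * D))"
      using assms(1) by (intro mult_left_mono) auto
    moreover have "\<bar>2 * q * m * e / s\<bar> = 2 * q * (\<bar>m * e\<bar> / s)" for e
      using s assms(1) by (simp add: abs_mult)
    moreover have "2 * q * (4 * (r * D)) = 8 * q * (r * D)" by simp
    ultimately show ?thesis by (simp only:)
  qed
  have t2: "\<bar>2 * (A * v * \<beta> - (2 - A) * u * \<alpha>)\<bar> \<le> 8 * (r * D)"
  proof -
    have "\<bar>A * (v * \<beta>)\<bar> \<le> 1 * (r * D)"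
      unfolding abs_mult[of A] using A pr by (intro mult_mono) auto
    moreover have "\<bar>(2 - A) * (u * \<alpha>)\<bar> \<le> 2 * (r * D)"
      unfolding abs_mult[of "2 - A"] using A pr by (intro mult_mono) auto
    moreover have "\<bar>2 * (P - Q)\<bar> \<le> 8 * k" if "\<bar>P\<bar> \<le> 1 * k" "\<bar>Q\<bar> \<le> 2 * k" "0 \<le> k" for P Q k :: real
      using that by (auto simp: abs_le_iff)
    ultimately have "\<bar>2 * (A * (v * \<beta>) - (2 - A) * (u * \<alpha>))\<bar> \<le> 8 * (r * D)"
      using rD by blast
    then show ?thesis by (simp only: mult.assoc)
  qed
  have "\<bar>2 * q * m * (u * \<alpha> + v * \<beta>) / s + 2 * (A * v * \<beta> - (2 - A) * u * \<alpha>)\<bar>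
      \<le> 8 * q * (r * D) + 8 * (r * D)"
    using t1 t2 by linarith
  also have "\<dots> = (8 * q + 8) * D * r" by (simp add: algebra_simps)
  finally have main: "\<bar>2 * q * m * (u * \<alpha> + v * \<beta>) / s + 2 * (A * v * \<beta> - (2 - A) * u * \<alpha>)\<bar>
      \<le> (8 * q + 8) * D * r" .
  have "s powr q \<le> s0 powr q"
    using assms s by (intro powr_mono2) (auto simp: s_def)
  then show ?thesis
    unfolding riesz_fun_D1_def Let_def A_def[symmetric] m_def[symmetric] s_def[symmetric] abs_mult[of "s powr q"]
    using main s by (intro mult_mono) auto
qed

text \<open>This turns the negativity of the integral of \<open>W \<circ> F\<close> into a norm inequality.  With \<open>s = \<bar>u + iv\<bar>\<^sup>2 + \<delta>\<close> one has
\<open>W = A s\<^sup>q \<bar>u + iv\<bar>\<^sup>2 - 2 s\<^sup>q u\<^sup>2\<close>.  If \<open>u\<^sup>2\<close> is small compared with \<open>\<bar>u + iv\<bar>\<^sup>2\<close>, half of the first term absorbs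
the second; otherwise \<open>s\<close> is bounded by a multiple of \<open>u\<^sup>2\<close> plus \<open>\<delta>\<close>.\<close>

lemma riesz_fun_lower_bound:
  assumes "q \<ge> 0" "\<delta> > 0"
  defines "A \<equiv> 1 / (q + 1)\<^sup>2"
  shows "A / 2 * (u\<^sup>2 + v\<^sup>2) powr (q + 1)
      \<le> riesz_fun q \<delta> u v + 2 * (4 / A * u\<^sup>2 + \<delta>) powr q * u\<^sup>2"
proof -
  define s where "s = u\<^sup>2 + v\<^sup>2 + \<delta>"
  define r where "r = u\<^sup>2 + v\<^sup>2"
  have r: "0 \<le> r" "r \<le> s" using assms by (auto simp: r_def s_def)
  have A: "A > 0" "A \<le> 1"
    using assms(1) one_le_power[of "q + 1" 2] by (auto simp: A_def divide_simps)
  have W: "riesz_fun q \<delta> u v = s powr q * (A * r) - 2 * (s powr q * u\<^sup>2)"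
    by (simp add: riesz_fun_def A_def s_def r_def algebra_simps)
  have key: "2 * (s powr q * u\<^sup>2) \<le> A / 2 * (s powr q * r) + 2 * (4 / A * u\<^sup>2 + \<delta>) powr q * u\<^sup>2"
  proof (cases "u\<^sup>2 \<le> A / 4 * r")
    case True
    then have "2 * (s powr q * u\<^sup>2) \<le> 2 * (s powr q * (A / 4 * r))"
      by (intro mult_left_mono) auto
    also have "\<dots> = A / 2 * (s powr q * r)" by simp
    also have "\<dots> \<le> A / 2 * (s powr q * r) + 2 * (4 / A * u\<^sup>2 + \<delta>) powr q * u\<^sup>2" by simp
    finally show ?thesis .
  next
    case False
    then have "s \<le> 4 / A * u\<^sup>2 + \<delta>" using A by (simp add: s_def r_def field_simps)
    then have "s powr q \<le> (4 / A * u\<^sup>2 + \<delta>) powr q"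
      using assms r by (intro powr_mono2) auto
    then have "2 * (s powr q * u\<^sup>2) \<le> 2 * ((4 / A * u\<^sup>2 + \<delta>) powr q * u\<^sup>2)"
      by (intro mult_left_mono mult_right_mono) auto
    also have "\<dots> \<le> A / 2 * (s powr q * r) + 2 * (4 / A * u\<^sup>2 + \<delta>) powr q * u\<^sup>2"
      using A r by simp
    finally show ?thesis .
  qed
  have "r powr (q + 1) = r powr q * r"
    using r assms(1) by (cases "r = 0") (auto simp: powr_add)
  also have "\<dots> \<le> s powr q * r"
    using r assms(1) by (intro mult_right_mono powr_mono2) auto
  finally have "A / 2 * r powr (q + 1) \<le> A / 2 * (s powr q * r)"
    using A by (intro mult_left_mono) auto
  then show ?thesis
    using key unfolding W r_def[symmetric] by (simp add: algebra_simps)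
qed

lemma power2_powr_half: "x \<ge> 0 \<Longrightarrow> (x\<^sup>2) powr (p / 2) = x powr p" for x :: real
proof -
  assume "x \<ge> 0"
  moreover have "x powr p = (x powr 2) powr (p / 2)" unfolding powr_powr by simp
  ultimately show ?thesis by simp
qed

text \<open>M. Riesz' inequality.  Integrating \<open>riesz_fun_lower_bound\<close> over a line removes \<open>W \<circ> F\<close> by superharmonicity,
and \<open>\<delta> \<rightarrow> 0\<close> leaves \<open>A/2 \<integral>\<bar>F\<bar>\<^sup>p \<le> 2 (4/A)\<^sup>q \<integral>\<bar>Re F\<bar>\<^sup>p\<close>, where \<open>4/A = p\<^sup>2\<close> and \<open>q + 1 = p/2\<close>.\<close>

theorem riesz_half_plane:
  fixes F :: "complex \<Rightarrow> complex"
  assumes p: "p \<ge> 2" and ab: "0 < a" "a < b"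
    and hol: "F holomorphic_on {z. a < Im z}"
    and F_bound: "\<And>z. a < Im z \<Longrightarrow> norm (F z) \<le> C / norm z"
    and F'_bound: "\<And>z. a < Im z \<Longrightarrow> norm (deriv F z) \<le> D"
  shows "integrable lborel (\<lambda>x. norm (F (Complex x b)) powr p)"
    and "integrable lborel (\<lambda>x. \<bar>Re (F (Complex x b))\<bar> powr p)"
    and "(LINT x|lborel. norm (F (Complex x b)) powr p)
           \<le> p powr p * (LINT x|lborel. \<bar>Re (F (Complex x b))\<bar> powr p)"
proof -
  define q where "q = (p - 2) / 2"
  have q: "q \<ge> 0" "q + 1 = p / 2" using p by (auto simp: q_def field_simps)
  define A where "A = 1 / (q + 1)\<^sup>2"
  have A: "A > 0" "4 / A = p\<^sup>2"
    using p by (auto simp: A_def q power2_eq_square)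
  define H where "H = {z. a < Im z}"
  have oH: "open H" by (simp add: H_def open_halfspace_Im_gt)
  define F1 where "F1 = deriv F"
  define F2 where "F2 = deriv F1"
  have hol1: "F1 holomorphic_on H"
    unfolding F1_def using hol oH by (auto intro: holomorphic_deriv simp: H_def)
  have hol2: "F2 holomorphic_on H"
    unfolding F2_def using hol1 oH by (rule holomorphic_deriv)
  have dF: "(F has_field_derivative F1 z) (at z)" if "z \<in> H" for z
    unfolding F1_def using hol oH that by (auto intro!: holomorphic_derivI[of F H] simp: H_def)
  have dF1: "(F1 has_field_derivative F2 z) (at z)" if "z \<in> H" for z
    unfolding F2_def using hol1 oH that by (auto intro!: holomorphic_derivI[of F1 H])
  have in_H: "Complex x y \<in> H" if "a < y" for x y using that by (simp add: H_def)
  have C0: "C \<ge> 0"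
  proof -
    have "0 \<le> C / norm (Complex 0 b)" 
      using ab by (intro order_trans[OF norm_ge_zero F_bound]) auto
    then show ?thesis using ab by (auto simp: zero_le_divide_iff norm_complex_def)
  qed
  have D0: "D \<ge> 0" 
    using ab by (intro order_trans[OF norm_ge_zero F'_bound[of "Complex 0 b"]]) auto
  define u where "u y x = Re (F (Complex x y))" for y x
  define v where "v y x = Im (F (Complex x y))" for y x
  have r_eq: "(u y x)\<^sup>2 + (v y x)\<^sup>2 = (norm (F (Complex x y)))\<^sup>2" for y x
    by (simp add: u_def v_def cmod_power2)
  have r_bound: "(u y x)\<^sup>2 + (v y x)\<^sup>2 \<le> C\<^sup>2 / (x\<^sup>2 + y\<^sup>2)" if "a < y" for y x
  proof -
    have "(norm (F (Complex x y)))\<^sup>2 \<le> (C / norm (Complex x y))\<^sup>2"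
      using that by (intro power_mono F_bound) auto
    then show ?thesis by (simp add: r_eq power_divide norm_complex_def)
  qed
  have r_bound': "(u y x)\<^sup>2 + (v y x)\<^sup>2 \<le> (C / a)\<^sup>2" if "a < y" for y x
  proof -
    have "a\<^sup>2 \<le> y\<^sup>2" using that ab by (intro power_mono) auto
    then have "a\<^sup>2 \<le> x\<^sup>2 + y\<^sup>2" using zero_le_power2[of x] by linarith
    then have "C\<^sup>2 / (x\<^sup>2 + y\<^sup>2) \<le> C\<^sup>2 / a\<^sup>2"
      using ab that by (intro divide_left_mono mult_pos_pos) (auto simp: add_nonneg_pos)
    with r_bound[OF that, of x] show ?thesis by (simp add: power_divide)
  qed
  have contF: "continuous_on UNIV (\<lambda>x. F (Complex x b))"
    unfolding Complex_eq
    using ab by (intro continuous_on_compose2[OF holomorphic_on_imp_continuous_on[OF hol]])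
      (auto intro!: continuous_intros)
  have [measurable]: "(\<lambda>x. F (Complex x b)) \<in> borel_measurable lborel"
    using borel_measurable_continuous_onI[OF contF] by simp
  have [measurable]: "u b \<in> borel_measurable lborel" "v b \<in> borel_measurable lborel"
    unfolding u_def[abs_def] v_def[abs_def] by measurable
  have int_bound: "integrable lborel f"
    if [measurable]: "f \<in> borel_measurable lborel" and le: "\<And>x. \<bar>f x\<bar> \<le> K / (x\<^sup>2 + b\<^sup>2)" for f :: "real \<Rightarrow> real" and K
  proof (rule Bochner_Integration.integrable_bound)
    show "integrable lborel (\<lambda>x. K * (1 / (x\<^sup>2 + b\<^sup>2)))"
      using Poisson_integrable(1)[of b] ab by (intro integrable_mult_right) auto
    have "\<bar>f x\<bar> \<le> \<bar>K * (1 / (x\<^sup>2 + b\<^sup>2))\<bar>" for x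
      using order_trans[OF le[of x] abs_ge_self] by simp
    then show "AE x in lborel. norm (f x) \<le> norm (K * (1 / (x\<^sup>2 + b\<^sup>2)))" by simp
  qed simp
  \<comment> \<open>\<open>R \<delta>\<close> is the error term of \<open>riesz_fun_lower_bound\<close>; it converges to a multiple of \<open>\<bar>Re F\<bar>\<^sup>p\<close>.\<close>
  define R where "R \<delta> x = 2 * (4 / A * (u b x)\<^sup>2 + \<delta>) powr q * (u b x)\<^sup>2" for \<delta> x
  have R_bound: "\<bar>R \<delta> x\<bar> \<le> 2 * (4 / A * (C / a)\<^sup>2 + 1) powr q * C\<^sup>2 / (x\<^sup>2 + b\<^sup>2)"
    if "0 \<le> \<delta>" "\<delta> \<le> 1" for \<delta> x
  proof -
    have u: "(u b x)\<^sup>2 \<le> C\<^sup>2 / (x\<^sup>2 + b\<^sup>2)" "(u b x)\<^sup>2 \<le> (C / a)\<^sup>2"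
      using r_bound[of b x] r_bound'[of b x] ab zero_le_power2[of "v b x"] by linarith+
    have "(4 / A * (u b x)\<^sup>2 + \<delta>) powr q \<le> (4 / A * (C / a)\<^sup>2 + 1) powr q"
      using u that A(1) q(1) by (intro powr_mono2 add_mono mult_left_mono) auto
    then have "(4 / A * (u b x)\<^sup>2 + \<delta>) powr q * (u b x)\<^sup>2
        \<le> (4 / A * (C / a)\<^sup>2 + 1) powr q * (C\<^sup>2 / (x\<^sup>2 + b\<^sup>2))"
      using u by (intro mult_mono) auto
    then show ?thesis by (simp add: R_def abs_mult)
  qed
  have R_int: "integrable lborel (R \<delta>)" if "0 \<le> \<delta>" "\<delta> \<le> 1" for \<delta>
    by (rule int_bound[OF _ R_bound[OF that]]) (simp add: R_def[abs_def])
  define N where "N x = ((u b x)\<^sup>2 + (v b x)\<^sup>2) powr (q + 1)" for x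
  have N_eq: "N x = norm (F (Complex x b)) powr p" for x
    unfolding N_def r_eq q(2) by (rule power2_powr_half) simp
  have N_int: "integrable lborel N"
  proof (rule int_bound)
    fix x
    have "N x = ((u b x)\<^sup>2 + (v b x)\<^sup>2) powr q * ((u b x)\<^sup>2 + (v b x)\<^sup>2)"
      using q(1) unfolding N_def by (cases "(u b x)\<^sup>2 + (v b x)\<^sup>2 = 0") (simp_all add: powr_add)
    also have "\<dots> \<le> (C / a)\<^sup>2 powr q * (C\<^sup>2 / (x\<^sup>2 + b\<^sup>2))"
      using r_bound[of b x] r_bound'[of b x] ab q(1) by (intro mult_mono powr_mono2) auto
    finally show "\<bar>N x\<bar> \<le> (C / a)\<^sup>2 powr q * C\<^sup>2 / (x\<^sup>2 + b\<^sup>2)"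
      by (simp add: N_def)
  qed (simp add: N_def[abs_def])
  have reg: "A / 2 * (LINT x|lborel. N x) \<le> (LINT x|lborel. R \<delta> x)" if \<delta>: "0 < \<delta>" "\<delta> \<le> 1" for \<delta>
  proof -
    define S where "S y x = riesz_fun q \<delta> (u y x) (v y x)" for y x
    define s0 where "s0 = (C / a)\<^sup>2 + \<delta>"
    define K where "K = s0 powr q * (2 * C\<^sup>2 + (8 * q + 8) * D * C)"
    have s0: "(u y x)\<^sup>2 + (v y x)\<^sup>2 + \<delta> \<le> s0" if "a < y" for y x
      using r_bound'[OF that, of x] by (simp add: s0_def)
    have cont: "continuous_on ({a<..} \<times> UNIV) (\<lambda>w. G (Complex (snd w) (fst w)))"
      if "G holomorphic_on H" for G
      unfolding Complex_eq using that
      by (intro continuous_on_compose2[OF holomorphic_on_imp_continuous_on[OF that]])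
         (auto intro!: continuous_intros simp: H_def)
    note cF = cont[OF hol[folded H_def]] and cF1 = cont[OF hol1] and cF2 = cont[OF hol2]
    have S_bound: "\<bar>S y x\<bar> \<le> K / (x\<^sup>2 + y\<^sup>2)" if "a < y" for y x
    proof -
      have xy: "x\<^sup>2 + y\<^sup>2 > 0" using that ab by (simp add: add_nonneg_pos)
      have "\<bar>S y x\<bar> \<le> s0 powr q * (2 * (C / sqrt (x\<^sup>2 + y\<^sup>2))\<^sup>2)"
        unfolding S_def using r_bound[OF that, of x] s0[OF that, of x] q \<delta> xy
        by (intro riesz_fun_bound) (auto simp: power_divide)
      also have "\<dots> = s0 powr q * (2 * C\<^sup>2) / (x\<^sup>2 + y\<^sup>2)"
        using xy by (simp add: power_divide)
      also have "\<dots> \<le> K / (x\<^sup>2 + y\<^sup>2)"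
        unfolding K_def using C0 D0 q xy by (intro divide_right_mono mult_left_mono) auto
      finally show ?thesis .
    qed
    have "(LINT x|lborel. S b x) \<le> 0"
    proof (rule superharmonic_integral_nonpos[OF ab])
      fix y x :: real assume y: "a < y"
      note d = has_real_derivative_along_axes[OF dF[OF in_H[OF y]]]
      note d1 = has_real_derivative_along_axes[OF dF1[OF in_H[OF y]]]
      show "(S y has_real_derivative riesz_fun_D1 q \<delta> (u y x) (v y x)
          (Re (F1 (Complex x y))) (Im (F1 (Complex x y)))) (at x)"
        unfolding S_def[abs_def] u_def v_def
        by (rule riesz_fun_has_derivative) (fact d \<delta>)+
      show "((\<lambda>x. riesz_fun_D1 q \<delta> (u y x) (v y x) (Re (F1 (Complex x y))) (Im (F1 (Complex x y))))
          has_real_derivative riesz_fun_D2 q \<delta> (u y x) (v y x)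
          (Re (F1 (Complex x y))) (Im (F1 (Complex x y))) (Re (F2 (Complex x y))) (Im (F2 (Complex x y)))) (at x)"
        unfolding u_def v_def
        by (rule riesz_fun_D1_has_derivative) (fact d d1 \<delta>)+
      show "((\<lambda>y. S y x) has_real_derivative riesz_fun_D1 q \<delta> (u y x) (v y x)
          (- Im (F1 (Complex x y))) (Re (F1 (Complex x y)))) (at y)"
        unfolding S_def[abs_def] u_def v_def
        by (rule riesz_fun_has_derivative) (fact d \<delta>)+
      show "((\<lambda>y. riesz_fun_D1 q \<delta> (u y x) (v y x) (- Im (F1 (Complex x y))) (Re (F1 (Complex x y))))
          has_real_derivative riesz_fun_D2 q \<delta> (u y x) (v y x)
          (- Im (F1 (Complex x y))) (Re (F1 (Complex x y))) (- Re (F2 (Complex x y))) (- Im (F2 (Complex x y)))) (at y)"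
        unfolding u_def v_def
        by (rule riesz_fun_D1_has_derivative) (fact d d1 DERIV_minus[OF d1(4)] \<delta>)+
      show "riesz_fun_D2 q \<delta> (u y x) (v y x)
          (Re (F1 (Complex x y))) (Im (F1 (Complex x y))) (Re (F2 (Complex x y))) (Im (F2 (Complex x y))) +
        riesz_fun_D2 q \<delta> (u y x) (v y x)
          (- Im (F1 (Complex x y))) (Re (F1 (Complex x y))) (- Re (F2 (Complex x y))) (- Im (F2 (Complex x y))) \<le> 0"
        using riesz_fun_superharmonic[OF q(1) \<delta>(1)] by blast
      show "\<bar>S y x\<bar> \<le> K / (x\<^sup>2 + y\<^sup>2)" by (rule S_bound[OF y])
      show "\<bar>riesz_fun_D1 q \<delta> (u y x) (v y x) (Re (F1 (Complex x y))) (Im (F1 (Complex x y)))\<bar> \<le> K / \<bar>x\<bar>"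
        if x: "\<bar>x\<bar> \<ge> 1"
      proof -
        have xy: "x\<^sup>2 + y\<^sup>2 > 0" using y ab by (simp add: add_nonneg_pos)
        have D: "norm (F1 (Complex x y)) \<le> D" using F'_bound[of "Complex x y"] y by (simp add: F1_def)
        have "C\<^sup>2 / (x\<^sup>2 + y\<^sup>2) \<le> C\<^sup>2 / x\<^sup>2"
          using xy x by (intro divide_left_mono mult_pos_pos) auto
        then have "(u y x)\<^sup>2 + (v y x)\<^sup>2 \<le> (C / \<bar>x\<bar>)\<^sup>2"
          using r_bound[OF y, of x] by (simp add: power_divide)
        then have "\<bar>riesz_fun_D1 q \<delta> (u y x) (v y x) (Re (F1 (Complex x y))) (Im (F1 (Complex x y)))\<bar>
            \<le> s0 powr q * ((8 * q + 8) * D * (C / \<bar>x\<bar>))"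
          by (intro riesz_fun_D1_bound[OF q(1) \<delta>(1) _ s0[OF y, of x]]
                order_trans[OF abs_Re_le_cmod D] order_trans[OF abs_Im_le_cmod D] divide_nonneg_nonneg C0 abs_ge_zero)
        also have "\<dots> = s0 powr q * ((8 * q + 8) * D * C) / \<bar>x\<bar>" by simp
        also have "\<dots> \<le> K / \<bar>x\<bar>"
          unfolding K_def by (intro divide_right_mono mult_left_mono) auto
        finally show ?thesis .
      qed
    next
      show "continuous_on ({a<..} \<times> UNIV) (\<lambda>(y, x). riesz_fun_D1 q \<delta> (u y x) (v y x)
          (- Im (F1 (Complex x y))) (Re (F1 (Complex x y))))"
        unfolding u_def v_def split_beta
        by (intro continuous_on_riesz_fun_D1 continuous_intros cF cF1 \<delta>)
      show "continuous_on ({a<..} \<times> UNIV) (\<lambda>(y, x). riesz_fun_D2 q \<delta> (u y x) (v y x)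
          (- Im (F1 (Complex x y))) (Re (F1 (Complex x y))) (- Re (F2 (Complex x y))) (- Im (F2 (Complex x y))))"
        unfolding u_def v_def split_beta
        by (intro continuous_on_riesz_fun_D2 continuous_intros cF cF1 cF2 \<delta>)
    qed
    moreover have "A / 2 * (LINT x|lborel. N x) \<le> (LINT x|lborel. S b x) + (LINT x|lborel. R \<delta> x)"
    proof -
      have Si: "integrable lborel (S b)"
        by (rule int_bound[OF _ S_bound]) (use ab in \<open>auto simp: S_def[abs_def] riesz_fun_def\<close>)
      have "A / 2 * (LINT x|lborel. N x) = (LINT x|lborel. A / 2 * N x)" by simp
      also have "\<dots> \<le> (LINT x|lborel. S b x + R \<delta> x)"
      proof (rule integral_mono)
        show "A / 2 * N x \<le> S b x + R \<delta> x" for x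
          using riesz_fun_lower_bound[OF q(1) \<delta>(1), of "u b x" "v b x"]
          by (simp add: N_def S_def R_def A_def)
      qed (use N_int Si R_int \<delta> in auto)
      also have "\<dots> = (LINT x|lborel. S b x) + (LINT x|lborel. R \<delta> x)"
        using Si R_int \<delta> by (intro Bochner_Integration.integral_add) auto
      finally show ?thesis .
    qed
    ultimately show ?thesis by linarith
  qed
  have R0: "R 0 x = 2 * (4 / A) powr q * \<bar>u b x\<bar> powr p" for x
  proof -
    have "\<bar>u b x\<bar> powr p = ((u b x)\<^sup>2) powr (q + 1)"
      unfolding q(2) using power2_powr_half[of "\<bar>u b x\<bar>" p] by simp
    also have "(u b x)\<^sup>2 powr (q + 1) = (u b x)\<^sup>2 powr q * (u b x)\<^sup>2"
      using q(1) by (cases "u b x = 0") (simp_all add: powr_add)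
    finally show ?thesis using A(1) by (simp add: R_def powr_mult powr_divide)
  qed
  have lim: "A / 2 * (LINT x|lborel. N x) \<le> (LINT x|lborel. R 0 x)"
  proof (rule tendsto_lowerbound)
    show "(\<lambda>n. LINT x|lborel. R (1 / real (Suc n)) x) \<longlonglongrightarrow> (LINT x|lborel. R 0 x)"
    proof (rule integral_dominated_convergence)
      show "integrable lborel (\<lambda>x. 2 * (4 / A * (C / a)\<^sup>2 + 1) powr q * C\<^sup>2 * (1 / (x\<^sup>2 + b\<^sup>2)))"
        using Poisson_integrable(1)[of b] ab by (intro integrable_mult_right) auto
      show "AE x in lborel. norm (R (1 / real (Suc n)) x) \<le> 2 * (4 / A * (C / a)\<^sup>2 + 1) powr q * C\<^sup>2 * (1 / (x\<^sup>2 + b\<^sup>2))" for n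
      proof (rule AE_I2)
        show "norm (R (1 / real (Suc n)) x) \<le> 2 * (4 / A * (C / a)\<^sup>2 + 1) powr q * C\<^sup>2 * (1 / (x\<^sup>2 + b\<^sup>2))" for x
        proof -
          have "0 \<le> 1 / real (Suc n)" "1 / real (Suc n) \<le> 1" by (simp_all del: of_nat_Suc)
          from R_bound[OF this, of x] show ?thesis
            by (simp only: real_norm_def times_divide_eq_right mult_1_right)
        qed
      qed
      show "AE x in lborel. (\<lambda>n. R (1 / real (Suc n)) x) \<longlonglongrightarrow> R 0 x"
      proof (rule AE_I2)
        fix x
        show "(\<lambda>n. R (1 / real (Suc n)) x) \<longlonglongrightarrow> R 0 x"
        proof (cases "u b x = 0")
          case False
          then have "4 / A * (u b x)\<^sup>2 + 0 \<noteq> 0" using A(1) by simp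
          moreover have "(\<lambda>n. 4 / A * (u b x)\<^sup>2 + 1 / real (Suc n)) \<longlonglongrightarrow> 4 / A * (u b x)\<^sup>2 + 0"
            by (intro tendsto_add tendsto_const LIMSEQ_Suc[OF lim_1_over_n])
          ultimately have "(\<lambda>n. (4 / A * (u b x)\<^sup>2 + 1 / real (Suc n)) powr q) \<longlonglongrightarrow> (4 / A * (u b x)\<^sup>2 + 0) powr q"
            by (intro tendsto_powr tendsto_const)
          then show ?thesis
            unfolding R_def by (intro tendsto_mult tendsto_const)
        qed (simp add: R_def)
      qed
    qed (simp_all add: R_def[abs_def])
    show "\<forall>\<^sub>F n in sequentially. A / 2 * (LINT x|lborel. N x) \<le> (LINT x|lborel. R (1 / real (Suc n)) x)"
      by (intro always_eventually allI reg) (simp_all del: of_nat_Suc)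
  qed simp
  show "integrable lborel (\<lambda>x. norm (F (Complex x b)) powr p)"
    using N_int unfolding N_eq[abs_def] .
  have "4 / A > 0" using A(1) by simp
  then have "2 * (4 / A) powr q \<noteq> 0" by auto
  then have "\<bar>u b x\<bar> powr p = R 0 x / (2 * (4 / A) powr q)" for x
    unfolding R0 by (rule nonzero_mult_div_cancel_left[symmetric])
  then show "integrable lborel (\<lambda>x. \<bar>Re (F (Complex x b))\<bar> powr p)"
    using R_int[of 0] unfolding u_def[symmetric] by simp
  have "(LINT x|lborel. N x) \<le> 2 / A * (LINT x|lborel. R 0 x)"
    using lim A(1) by (simp add: field_simps)
  also have "\<dots> = (4 / A) * (4 / A) powr q * (LINT x|lborel. \<bar>u b x\<bar> powr p)"
    unfolding R0[abs_def] by simp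
  also have "(4 / A) * (4 / A) powr q = (p\<^sup>2) powr (q + 1)"
    unfolding A(2) powr_add using p by simp
  also have "\<dots> = p powr p"
    unfolding q(2) using p by (intro power2_powr_half) simp
  finally show "(LINT x|lborel. norm (F (Complex x b)) powr p)
           \<le> p powr p * (LINT x|lborel. \<bar>Re (F (Complex x b))\<bar> powr p)"
    unfolding N_eq u_def .
qed

section \<open>Schur's test\<close>

text \<open>The graph of \<open>t \<mapsto> t powr p\<close> lies above its tangent at \<open>m\<close>.\<close>

lemma powr_tangent_le:
  fixes m t p :: real
  assumes "p > 1" "m \<ge> 0" "t \<ge> 0"
  shows "p * m powr (p - 1) * t \<le> t powr p + (p - 1) * m powr p"
proof -
  define q where "q = p / (p - 1)"
  have q: "q > 1" "1 / p + 1 / q = 1" "(p - 1) * q = p" "p / q = p - 1"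
    using assms by (auto simp: q_def field_simps)
  have "t * m powr (p - 1) \<le> t powr p / p + (m powr (p - 1)) powr q / q"
    using assms q by (intro Youngs_inequality) auto
  then have "p * (t * m powr (p - 1)) \<le> p * (t powr p / p + m powr p / q)"
    using assms(1) unfolding powr_powr q(3) by (intro mult_left_mono) auto
  also have "\<dots> = t powr p + (p / q) * m powr p"
    using assms(1) by (simp add: distrib_left)
  finally show ?thesis by (simp add: q(4) mult_ac)
qed

text \<open>Jensen's inequality for the measure \<open>k dy\<close> of mass at most \<open>A\<close>: integrate the tangent inequality at
\<open>m = a / A\<close> against \<open>k\<close>.  Working with a number \<open>a\<close> below the integral instead of the integral itself avoids
any discussion of integrability.\<close>

lemma schur_pointwise:
  fixes k f :: "real \<Rightarrow> real"
  assumes [measurable]: "k \<in> borel_measurable lborel" "f \<in> borel_measurable lborel"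
    and p: "p > 1" and A: "A > 0" and k: "\<And>y. k y \<ge> 0"
    and row: "(\<integral>\<^sup>+y. ennreal (k y) \<partial>lborel) \<le> ennreal A"
    and a: "a \<ge> 0" "ennreal a \<le> (\<integral>\<^sup>+y. ennreal (k y * \<bar>f y\<bar>) \<partial>lborel)"
  shows "ennreal (a powr p) \<le> ennreal (A powr (p - 1)) * (\<integral>\<^sup>+y. ennreal (k y * \<bar>f y\<bar> powr p) \<partial>lborel)"
proof -
  define m where "m = a / A"
  define X where "X = (\<integral>\<^sup>+y. ennreal (k y * \<bar>f y\<bar> powr p) \<partial>lborel)"
  have m: "m \<ge> 0" "a = m * A" using A a by (auto simp: m_def)
  define c where "c = p * m powr (p - 1)"
  have c: "c \<ge> 0" using p by (simp add: c_def)
  have "ennreal (c * a) = ennreal c * ennreal a"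
    using c a by (simp add: ennreal_mult)
  also have "\<dots> \<le> ennreal c * (\<integral>\<^sup>+y. ennreal (k y * \<bar>f y\<bar>) \<partial>lborel)"
    by (rule mult_left_mono[OF a(2)]) simp
  also have "\<dots> = (\<integral>\<^sup>+y. ennreal c * ennreal (k y * \<bar>f y\<bar>) \<partial>lborel)"
    by (rule nn_integral_cmult[symmetric]) simp
  also have "\<dots> \<le> (\<integral>\<^sup>+y. ennreal (k y * \<bar>f y\<bar> powr p) + ennreal ((p - 1) * m powr p) * ennreal (k y) \<partial>lborel)"
  proof (rule nn_integral_mono)
    fix y
    have "k y * (c * \<bar>f y\<bar>) \<le> k y * (\<bar>f y\<bar> powr p + (p - 1) * m powr p)"
      unfolding c_def using powr_tangent_le[OF p m(1), of "\<bar>f y\<bar>"] k by (intro mult_left_mono) auto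
    then have "ennreal (c * (k y * \<bar>f y\<bar>)) \<le> ennreal (k y * \<bar>f y\<bar> powr p + (p - 1) * m powr p * k y)"
      by (intro ennreal_leI) (simp add: algebra_simps)
    then show "ennreal c * ennreal (k y * \<bar>f y\<bar>) \<le> ennreal (k y * \<bar>f y\<bar> powr p) + ennreal ((p - 1) * m powr p) * ennreal (k y)"
      using c k p by (simp add: ennreal_mult)
  qed
  also have "\<dots> = X + ennreal ((p - 1) * m powr p) * (\<integral>\<^sup>+y. ennreal (k y) \<partial>lborel)"
    unfolding X_def by (subst nn_integral_add) (auto simp: nn_integral_cmult)
  also have "\<dots> \<le> X + ennreal ((p - 1) * m powr p) * ennreal A"
    by (intro add_left_mono mult_left_mono row) simp
  finally have *: "ennreal (c * a) \<le> X + ennreal ((p - 1) * m powr p * A)"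
    using p A by (simp add: ennreal_mult)
  have ca: "c * a = m powr p * A + (p - 1) * m powr p * A"
  proof -
    have "m powr (p - 1) * m = m powr p"
      using m(1) p by (cases "m = 0") (auto simp: powr_diff)
    then have "c * a = p * (m powr p) * A" by (simp add: c_def m(2) mult_ac)
    then show ?thesis by (simp add: algebra_simps)
  qed
  have le: "ennreal (m powr p * A) \<le> X"
  proof (cases X)
    case (real r)
    then have "ennreal (c * a) \<le> ennreal (r + (p - 1) * m powr p * A)"
      using * p A by simp
    then have "c * a \<le> r + (p - 1) * m powr p * A"
      using real p A by (subst (asm) ennreal_le_iff) auto
    then show ?thesis using real ca by (simp add: ennreal_leI)
  qed simp
  have "a powr p = A powr (p - 1) * (m powr p * A)"
    using A p m by (simp add: powr_mult powr_diff)
  then have "ennreal (a powr p) = ennreal (A powr (p - 1)) * ennreal (m powr p * A)"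
    using A by (simp add: ennreal_mult)
  also have "\<dots> \<le> ennreal (A powr (p - 1)) * X"
    by (rule mult_left_mono[OF le]) simp
  finally show ?thesis by (simp add: X_def)
qed

text \<open>Schur's test with constant test functions for a positive kernel on \<open>L\<^sup>p(w dx)\<close>.  The row condition allows
Jensen's inequality in \<open>y\<close>; after Tonelli, the column condition performs the integration in \<open>x\<close>.\<close>

theorem schur_test:
  fixes K :: "real \<Rightarrow> real \<Rightarrow> real" and w f a :: "real \<Rightarrow> real"
  assumes [measurable]: "(\<lambda>(x, y). K x y) \<in> borel_measurable (lborel \<Otimes>\<^sub>M lborel)"
      "w \<in> borel_measurable lborel" "f \<in> borel_measurable lborel"
    and p: "p > 1" and A: "A > 0" and B: "B \<ge> 0"
    and K: "\<And>x y. K x y \<ge> 0" and w: "\<And>x. w x \<ge> 0"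
    and row: "\<And>x. (\<integral>\<^sup>+y. ennreal (K x y) \<partial>lborel) \<le> ennreal A"
    and col: "\<And>y. (\<integral>\<^sup>+x. ennreal (K x y * w x) \<partial>lborel) \<le> ennreal (B * w y)"
    and a: "AE x in lborel. 0 \<le> a x \<and> ennreal (a x) \<le> (\<integral>\<^sup>+y. ennreal (K x y * \<bar>f y\<bar>) \<partial>lborel)"
  shows "(\<integral>\<^sup>+x. ennreal (a x powr p * w x) \<partial>lborel)
      \<le> ennreal (A powr (p - 1) * B) * (\<integral>\<^sup>+y. ennreal (\<bar>f y\<bar> powr p * w y) \<partial>lborel)"
proof -
  have "(\<integral>\<^sup>+x. ennreal (a x powr p * w x) \<partial>lborel)
      \<le> (\<integral>\<^sup>+x. (\<integral>\<^sup>+y. ennreal (A powr (p - 1)) * (ennreal (\<bar>f y\<bar> powr p) * ennreal (K x y * w x)) \<partial>lborel) \<partial>lborel)"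
  proof (rule nn_integral_mono_AE, use a in eventually_elim)
    case (elim x)
    have "ennreal (a x powr p * w x) = ennreal (a x powr p) * ennreal (w x)"
      using w by (simp add: ennreal_mult)
    also have "\<dots> \<le> ennreal (A powr (p - 1)) * (\<integral>\<^sup>+y. ennreal (K x y * \<bar>f y\<bar> powr p) \<partial>lborel) * ennreal (w x)"
      using elim p A K row by (intro mult_right_mono schur_pointwise) auto
    also have "\<dots> = (\<integral>\<^sup>+y. ennreal (A powr (p - 1)) * ennreal (K x y * \<bar>f y\<bar> powr p) * ennreal (w x) \<partial>lborel)"
      by (simp add: nn_integral_cmult nn_integral_multc)
    also have "\<dots> = (\<integral>\<^sup>+y. ennreal (A powr (p - 1)) * (ennreal (\<bar>f y\<bar> powr p) * ennreal (K x y * w x)) \<partial>lborel)"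
      using K w by (intro nn_integral_cong) (simp add: ennreal_mult mult_ac)
    finally show ?case .
  qed
  also have "\<dots> = (\<integral>\<^sup>+y. (\<integral>\<^sup>+x. ennreal (A powr (p - 1)) * (ennreal (\<bar>f y\<bar> powr p) * ennreal (K x y * w x)) \<partial>lborel) \<partial>lborel)"
    by (rule lborel_pair.Fubini'[symmetric]) simp
  also have "\<dots> = (\<integral>\<^sup>+y. ennreal (A powr (p - 1)) * (ennreal (\<bar>f y\<bar> powr p) * (\<integral>\<^sup>+x. ennreal (K x y * w x) \<partial>lborel)) \<partial>lborel)"
    by (simp add: nn_integral_cmult)
  also have "\<dots> \<le> (\<integral>\<^sup>+y. ennreal (A powr (p - 1)) * (ennreal (\<bar>f y\<bar> powr p) * ennreal (B * w y)) \<partial>lborel)"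
    by (intro nn_integral_mono mult_left_mono col) auto
  also have "\<dots> = (\<integral>\<^sup>+y. ennreal (A powr (p - 1) * B) * ennreal (\<bar>f y\<bar> powr p * w y) \<partial>lborel)"
    using B w by (intro nn_integral_cong) (simp add: ennreal_mult mult_ac)
  also have "\<dots> = ennreal (A powr (p - 1) * B) * (\<integral>\<^sup>+y. ennreal (\<bar>f y\<bar> powr p * w y) \<partial>lborel)"
    by (rule nn_integral_cmult) simp
  finally show ?thesis .
qed

section \<open>The Cauchy transform and conjugate Poisson integrals\<close>

lemma integrable_mult_bounded:
  fixes f :: "real \<Rightarrow> real" and g :: "real \<Rightarrow> 'a :: {banach, second_countable_topology, real_normed_algebra_1}"
  assumes f: "integrable lborel f" and [measurable]: "g \<in> borel_measurable lborel"
    and g: "\<And>x. norm (g x) \<le> B"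
  shows "integrable lborel (\<lambda>x. g x * of_real (f x))"
proof (rule Bochner_Integration.integrable_bound)
  have [measurable]: "f \<in> borel_measurable lborel" using f by (rule borel_measurable_integrable)
  show "(\<lambda>x. g x * of_real (f x)) \<in> borel_measurable lborel" by simp
  show "integrable lborel (\<lambda>x. B * \<bar>f x\<bar>)" using f by simp
  have "B \<ge> 0" using g[of 0] norm_ge_zero[of "g 0"] by linarith
  show "AE x in lborel. norm (g x * of_real (f x)) \<le> norm (B * \<bar>f x\<bar>)"
  proof (rule AE_I2)
    fix x
    have "norm (g x * of_real (f x)) \<le> norm (g x) * \<bar>f x\<bar>"
      using norm_mult_ineq[of "g x" "of_real (f x)"] by simp
    also have "\<dots> \<le> B * \<bar>f x\<bar>" by (rule mult_right_mono[OF g]) simp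
    finally show "norm (g x * of_real (f x)) \<le> norm (B * \<bar>f x\<bar>)"
      using \<open>B \<ge> 0\<close> by (simp add: abs_mult)
  qed
qed

text \<open>The holomorphic function in the upper half plane whose real and imaginary part are the convolutions of \<open>\<phi>\<close> with
the Poisson kernel and the conjugate Poisson kernel, both without the factor \<open>1/\<pi>\<close>.\<close>

definition cauchy_transform :: "(real \<Rightarrow> real) \<Rightarrow> complex \<Rightarrow> complex" where
  "cauchy_transform \<phi> z = (LINT t|lborel. \<i> / (z - of_real t) * of_real (\<phi> t))"

lemma norm_diff_real_ge_Im: "\<bar>Im z\<bar> \<le> norm (z - of_real t)"
  using abs_Im_le_cmod[of "z - of_real t"] by simp

lemma inverse_power_integrable:
  assumes "integrable lborel \<phi>" "Im z > 0"
  shows "integrable lborel (\<lambda>t. c / (z - of_real t) ^ n * of_real (\<phi> t))"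
proof (rule integrable_mult_bounded[OF assms(1)])
  fix t
  have "(Im z) ^ n \<le> norm (z - of_real t) ^ n"
    using norm_diff_real_ge_Im[of z t] assms(2) by (intro power_mono) auto
  then show "norm (c / (z - of_real t) ^ n) \<le> norm c / (Im z) ^ n"
    using assms(2) norm_diff_real_ge_Im[of z t]
    by (auto simp: norm_divide norm_power intro!: divide_left_mono mult_pos_pos zero_less_power)
qed simp

text \<open>The error of the difference quotient has the explicit kernel \<open>\<i> h / ((z - t)\<^sup>2 (z + h - t))\<close>, which is
\<open>O(\<bar>h\<bar>)\<close> uniformly in \<open>t\<close> because all denominators stay away from the real axis.\<close>

lemma cauchy_transform_has_derivative:
  assumes \<phi>: "integrable lborel \<phi>" and z: "Im z > 0"
  shows "(cauchy_transform \<phi> has_field_derivative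
           (LINT t|lborel. - \<i> / (z - of_real t) ^ 2 * of_real (\<phi> t))) (at z)"
proof -
  define y where "y = Im z"
  define D where "D = (LINT t|lborel. - \<i> / (z - of_real t) ^ 2 * of_real (\<phi> t))"
  define M where "M = (LINT t|lborel. \<bar>\<phi> t\<bar>)"
  have y: "y > 0" using z by (simp add: y_def)
  have bound: "norm ((cauchy_transform \<phi> (z + h) - cauchy_transform \<phi> z) / h - D) \<le> norm h * (2 / y ^ 3 * M)"
    if h: "h \<noteq> 0" "norm h < y / 2" for h
  proof -
    have Imh: "Im (z + h) > y / 2"
      using abs_Im_le_cmod[of h] h by (simp add: y_def)
    have z1: "z - of_real t \<noteq> 0" "z + h - of_real t \<noteq> 0" for t
      using norm_diff_real_ge_Im[of z t] norm_diff_real_ge_Im[of "z + h" t] Imh y by (auto simp: y_def)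
    have int: "integrable lborel (\<lambda>t. \<i> / (z - of_real t) * of_real (\<phi> t))"
      "integrable lborel (\<lambda>t. \<i> / (z + h - of_real t) * of_real (\<phi> t))"
      "integrable lborel (\<lambda>t. - \<i> / (z - of_real t)\<^sup>2 * of_real (\<phi> t))"
      using inverse_power_integrable[OF \<phi>, of z _ 1] inverse_power_integrable[OF \<phi>, of "z + h" _ 1]
        inverse_power_integrable[OF \<phi>, of z "- \<i>" 2] Imh y z by auto
    have "(cauchy_transform \<phi> (z + h) - cauchy_transform \<phi> z) / h - D =
       (LINT t|lborel. (\<i> / (z + h - of_real t) * of_real (\<phi> t) - \<i> / (z - of_real t) * of_real (\<phi> t)) / h
          - (- \<i> / (z - of_real t)\<^sup>2 * of_real (\<phi> t)))"
      unfolding cauchy_transform_def D_def using int by simp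
    also have "\<dots> = (LINT t|lborel. \<i> * h / ((z - of_real t)\<^sup>2 * (z + h - of_real t)) * of_real (\<phi> t))"
    proof (rule Bochner_Integration.integral_cong[OF refl])
      fix t
      have "(\<i> / b * c - \<i> / a * c) / h - (- \<i> / a\<^sup>2 * c) = \<i> * h / (a\<^sup>2 * b) * c"
        if "a \<noteq> 0" "b \<noteq> 0" "b = a + h" for a b c :: complex
      proof -
        have h': "h = b - a" using that(3) by simp
        have "\<i> / b * c - \<i> / a * c = - (\<i> * c / (a * b)) * h"
          unfolding h' using that(1,2) by (simp add: field_simps)
        then have E: "(\<i> / b * c - \<i> / a * c) / h = - (\<i> * c / (a * b))" using h(1) by simp
        show ?thesis
          unfolding E unfolding h' using that(1,2) by (simp add: field_simps power2_eq_square)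
      qed
      from this[OF z1[of t]]
      show "(\<i> / (z + h - of_real t) * of_real (\<phi> t) - \<i> / (z - of_real t) * of_real (\<phi> t)) / h
          - (- \<i> / (z - of_real t)\<^sup>2 * of_real (\<phi> t))
          = \<i> * h / ((z - of_real t)\<^sup>2 * (z + h - of_real t)) * of_real (\<phi> t)" by simp
    qed
    also have "norm \<dots> \<le> (LINT t|lborel. norm h * (2 / y ^ 3) * \<bar>\<phi> t\<bar>)"
    proof (rule order_trans[OF integral_norm_bound integral_mono_AE'])
      show "integrable lborel (\<lambda>t. norm h * (2 / y ^ 3) * \<bar>\<phi> t\<bar>)" using \<phi> by simp
      show "AE t in lborel. norm (\<i> * h / ((z - of_real t)\<^sup>2 * (z + h - of_real t)) * of_real (\<phi> t))
            \<le> norm h * (2 / y ^ 3) * \<bar>\<phi> t\<bar>"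
      proof (rule AE_I2)
        fix t
        have "y\<^sup>2 * (y / 2) \<le> norm (z - of_real t) ^ 2 * norm (z + h - of_real t)"
          using norm_diff_real_ge_Im[of z t] norm_diff_real_ge_Im[of "z + h" t] Imh y
          by (intro mult_mono power_mono) (auto simp: y_def)
        then have "norm h / (norm (z - of_real t) ^ 2 * norm (z + h - of_real t)) \<le> norm h / (y\<^sup>2 * (y / 2))"
          using y z1[of t] by (intro divide_left_mono mult_pos_pos) auto
        also have "\<dots> = norm h * (2 / y ^ 3)" by (simp add: power2_eq_square power3_eq_cube)
        finally have "norm h / (norm (z - of_real t) ^ 2 * norm (z + h - of_real t)) * \<bar>\<phi> t\<bar> \<le> norm h * (2 / y ^ 3) * \<bar>\<phi> t\<bar>"
          by (rule mult_right_mono) simp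
        then show "norm (\<i> * h / ((z - of_real t)\<^sup>2 * (z + h - of_real t)) * of_real (\<phi> t))
            \<le> norm h * (2 / y ^ 3) * \<bar>\<phi> t\<bar>"
          by (simp add: norm_mult norm_divide norm_power)
      qed
      show "AE t in lborel. 0 \<le> norm h * (2 / y ^ 3) * \<bar>\<phi> t\<bar>"
        using y by (intro AE_I2) simp
    qed
    also have "\<dots> = norm h * (2 / y ^ 3 * M)" by (simp add: M_def)
    finally show ?thesis .
  qed
  have "(\<lambda>h. (cauchy_transform \<phi> (z + h) - cauchy_transform \<phi> z) / h - D) \<midarrow>0\<rightarrow> 0"
  proof (rule Lim_null_comparison)
    show "\<forall>\<^sub>F h in at 0. norm ((cauchy_transform \<phi> (z + h) - cauchy_transform \<phi> z) / h - D) \<le> norm h * (2 / y ^ 3 * M)"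
      unfolding eventually_at using bound y by (intro exI[of _ "y / 2"]) auto
    have "((\<lambda>h :: complex. norm h * (2 / y ^ 3 * M)) \<longlongrightarrow> norm (0 :: complex) * (2 / y ^ 3 * M)) (at 0)"
      by (intro tendsto_intros)
    then show "((\<lambda>h :: complex. norm h * (2 / y ^ 3 * M)) \<longlongrightarrow> 0) (at 0)" by simp
  qed
  then show ?thesis unfolding DERIV_def D_def[symmetric] by (simp add: LIM_zero_iff)
qed

lemma norm_LINT_mult_le:
  fixes g :: "real \<Rightarrow> complex"
  assumes \<phi>: "integrable lborel \<phi>" and g: "\<And>t. \<phi> t \<noteq> 0 \<Longrightarrow> norm (g t) \<le> B"
  shows "norm (LINT t|lborel. g t * of_real (\<phi> t)) \<le> B * (LINT t|lborel. \<bar>\<phi> t\<bar>)"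
proof -
  have "norm (LINT t|lborel. g t * of_real (\<phi> t)) \<le> (LINT t|lborel. norm (g t * of_real (\<phi> t)))"
    by (rule integral_norm_bound)
  also have "\<dots> \<le> (LINT t|lborel. B * \<bar>\<phi> t\<bar>)"
  proof (rule integral_mono_AE')
    show "AE t in lborel. norm (g t * of_real (\<phi> t)) \<le> B * \<bar>\<phi> t\<bar>"
    proof (rule AE_I2)
      show "norm (g t * of_real (\<phi> t)) \<le> B * \<bar>\<phi> t\<bar>" for t
        using g[of t] by (cases "\<phi> t = 0") (auto simp: norm_mult intro: mult_right_mono)
    qed
    show "AE t in lborel. 0 \<le> B * \<bar>\<phi> t\<bar>"
    proof (rule AE_I2)
      show "0 \<le> B * \<bar>\<phi> t\<bar>" for t
        using order_trans[OF norm_ge_zero g[of t]] by (cases "\<phi> t = 0") auto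
    qed
  qed (use \<phi> in auto)
  finally show ?thesis by simp
qed

lemma cauchy_transform_kernel_bounds:
  fixes a R :: real
  assumes "a < Im z" "a > 0" "\<bar>t\<bar> \<le> R"
  shows "norm (\<i> / (z - of_real t)) \<le> (1 + R / a) / norm z" "norm (- \<i> / (z - of_real t) ^ 2) \<le> 1 / a\<^sup>2"
proof -
  have n: "a \<le> norm (z - of_real t)" using norm_diff_real_ge_Im[of z t] assms by linarith
  have z: "norm z > 0" using assms by auto
  have "norm z \<le> norm (z - of_real t) + \<bar>t\<bar>"
    using norm_triangle_ineq[of "z - of_real t" "of_real t"] by simp
  also have "\<dots> \<le> norm (z - of_real t) + R" using assms by simp
  also have "R \<le> R / a * norm (z - of_real t)"
    using n assms by (simp add: field_simps mult_left_mono)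
  finally have "norm z \<le> (1 + R / a) * norm (z - of_real t)" by (simp add: algebra_simps)
  moreover have inv: "1 / n \<le> X / m" if "m \<le> X * n" "n > 0" "m > 0" for X m n :: real
    using that by (simp add: divide_simps mult.commute)
  ultimately have "1 / norm (z - of_real t) \<le> (1 + R / a) / norm z"
    using n assms(2) z by (intro inv) auto
  then show "norm (\<i> / (z - of_real t)) \<le> (1 + R / a) / norm z"
    by (simp add: norm_divide)
  have "a\<^sup>2 \<le> norm (z - of_real t) ^ 2" using n assms by (intro power_mono) auto
  then show "norm (- \<i> / (z - of_real t) ^ 2) \<le> 1 / a\<^sup>2"
    using n assms by (auto simp: norm_divide norm_power intro!: divide_left_mono mult_pos_pos)
qed

lemma cauchy_transform_Re_Im:
  assumes \<phi>: "integrable lborel \<phi>" and y: "y > 0"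
  shows "Re (cauchy_transform \<phi> (Complex x y)) = (LINT t|lborel. y / ((x - t)\<^sup>2 + y\<^sup>2) * \<phi> t)"
    and "Im (cauchy_transform \<phi> (Complex x y)) = (LINT t|lborel. (x - t) / ((x - t)\<^sup>2 + y\<^sup>2) * \<phi> t)"
proof -
  have int: "integrable lborel (\<lambda>t. \<i> / (Complex x y - of_real t) * of_real (\<phi> t))"
    using inverse_power_integrable[OF \<phi>, of "Complex x y" \<i> 1] y by simp
  have r: "Re (\<i> / (Complex x y - of_real t) * of_real (\<phi> t)) = y / ((x - t)\<^sup>2 + y\<^sup>2) * \<phi> t"
    and i: "Im (\<i> / (Complex x y - of_real t) * of_real (\<phi> t)) = (x - t) / ((x - t)\<^sup>2 + y\<^sup>2) * \<phi> t" for t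
    by (simp_all add: Re_divide Im_divide power2_eq_square)
  show "Re (cauchy_transform \<phi> (Complex x y)) = (LINT t|lborel. y / ((x - t)\<^sup>2 + y\<^sup>2) * \<phi> t)"
    unfolding cauchy_transform_def integral_Re[OF int, symmetric] r ..
  show "Im (cauchy_transform \<phi> (Complex x y)) = (LINT t|lborel. (x - t) / ((x - t)\<^sup>2 + y\<^sup>2) * \<phi> t)"
    unfolding cauchy_transform_def integral_Im[OF int, symmetric] i ..
qed

lemma nn_integral_Poisson_shift_le:
  fixes x y :: real
  assumes "y > 0"
  shows "(\<integral>\<^sup>+t. ennreal (y / ((x - t)\<^sup>2 + y\<^sup>2)) \<partial>lborel) \<le> ennreal pi"
    and "(\<integral>\<^sup>+x. ennreal (y / ((x - t)\<^sup>2 + y\<^sup>2)) \<partial>lborel) \<le> ennreal pi"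
  using nn_integral_Poisson_le[OF assms] nn_integral_reflect_shift[of "\<lambda>t. ennreal (y / (t\<^sup>2 + y\<^sup>2))"] by simp_all

lemma Poisson_convolution_Lp:
  fixes \<phi> a :: "real \<Rightarrow> real"
  assumes [measurable]: "\<phi> \<in> borel_measurable lborel" and p: "p > 1" and y: "y > 0"
    and a: "\<And>x. a x \<ge> 0" "\<And>x. ennreal (a x) \<le> (\<integral>\<^sup>+t. ennreal (y / ((x - t)\<^sup>2 + y\<^sup>2) * \<bar>\<phi> t\<bar>) \<partial>lborel)"
  shows "(\<integral>\<^sup>+x. ennreal (a x powr p) \<partial>lborel) \<le> ennreal (pi powr p) * (\<integral>\<^sup>+t. ennreal (\<bar>\<phi> t\<bar> powr p) \<partial>lborel)"
proof -
  have "(\<integral>\<^sup>+x. ennreal (a x powr p * 1) \<partial>lborel)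
      \<le> ennreal (pi powr (p - 1) * pi) * (\<integral>\<^sup>+t. ennreal (\<bar>\<phi> t\<bar> powr p * 1) \<partial>lborel)"
    using p y a nn_integral_Poisson_shift_le[OF y]
    by (intro schur_test[where K = "\<lambda>x t. y / ((x - t)\<^sup>2 + y\<^sup>2)" and w = "\<lambda>_. 1"]) auto
  moreover have "pi powr (p - 1) * pi = pi powr p"
    by (simp add: powr_diff)
  ultimately show ?thesis by simp
qed

text \<open>The conjugate Poisson integral is the imaginary part of the Cauchy transform; Riesz' inequality bounds it by the real
part, a Poisson integral, and that one is bounded by Schur's test.  The bounded support of \<open>\<phi>\<close> yields the decay
of the Cauchy transform.\<close>

theorem conjugate_Poisson_Lp:
  fixes \<phi> :: "real \<Rightarrow> real"
  assumes p: "p \<ge> 2" and y: "y > 0" and \<phi>: "integrable lborel \<phi>"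
    and supp: "\<And>t. R < \<bar>t\<bar> \<Longrightarrow> \<phi> t = 0"
  shows "(\<integral>\<^sup>+x. ennreal (\<bar>LINT t|lborel. (x - t) / ((x - t)\<^sup>2 + y\<^sup>2) * \<phi> t\<bar> powr p) \<partial>lborel)
     \<le> ennreal ((p * pi) powr p) * (\<integral>\<^sup>+t. ennreal (\<bar>\<phi> t\<bar> powr p) \<partial>lborel)"
proof -
  have [measurable]: "\<phi> \<in> borel_measurable lborel" using \<phi> by (rule borel_measurable_integrable)
  define F where "F = cauchy_transform \<phi>"
  define M where "M = (LINT t|lborel. \<bar>\<phi> t\<bar>)"
  \<comment> \<open>Any line strictly between the real axis and height \<open>y\<close> would do.\<close>
  define a where "a = y / 2"
  have a: "0 < a" "a < y" using y by (auto simp: a_def)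
  have dF: "(F has_field_derivative (LINT t|lborel. - \<i> / (z - of_real t) ^ 2 * of_real (\<phi> t))) (at z)"
    if "Im z > 0" for z
    unfolding F_def by (rule cauchy_transform_has_derivative[OF \<phi> that])
  have hol: "F holomorphic_on {z. a < Im z}"
  proof (rule holomorphic_onI)
    fix z assume "z \<in> {z. a < Im z}"
    then have "Im z > 0" using a by simp
    from dF[OF this] show "F field_differentiable at z within {z. a < Im z}"
      by (meson field_differentiable_at_within field_differentiable_def)
  qed
  have sup: "\<bar>t\<bar> \<le> R" if "\<phi> t \<noteq> 0" for t using supp[of t] that by force
  have F_bound: "norm (F z) \<le> (1 + R / a) * M / norm z" if "a < Im z" for z
    unfolding F_def cauchy_transform_def M_def
    using norm_LINT_mult_le[OF \<phi> cauchy_transform_kernel_bounds(1)[OF that a(1) sup]] by simp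
  have F'_bound: "norm (deriv F z) \<le> 1 / a\<^sup>2 * M" if "a < Im z" for z
    using dF[of z] that a
      norm_LINT_mult_le[OF \<phi> cauchy_transform_kernel_bounds(2)[OF that a(1) sup]]
    by (simp add: DERIV_imp_deriv M_def)
  note R = riesz_half_plane[OF p a hol F_bound F'_bound]
  have "(\<integral>\<^sup>+x. ennreal (\<bar>Re (F (Complex x y))\<bar> powr p) \<partial>lborel)
      \<le> ennreal (pi powr p) * (\<integral>\<^sup>+t. ennreal (\<bar>\<phi> t\<bar> powr p) \<partial>lborel)"
  proof (rule Poisson_convolution_Lp)
    fix x
    have i: "integrable lborel (\<lambda>t. y / ((x - t)\<^sup>2 + y\<^sup>2) * \<phi> t)"
    proof -
      have "norm (y / ((x - t)\<^sup>2 + y\<^sup>2)) \<le> 1 / y" for t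
      proof -
        have "y / ((x - t)\<^sup>2 + y\<^sup>2) \<le> y / y\<^sup>2"
          using y by (intro divide_left_mono mult_pos_pos) (auto simp: add_nonneg_pos)
        then show ?thesis using y by (simp add: power2_eq_square)
      qed
      from integrable_mult_bounded[OF \<phi> _ this] show ?thesis by simp
    qed
    have "ennreal \<bar>Re (F (Complex x y))\<bar> = ennreal (norm (LINT t|lborel. y / ((x - t)\<^sup>2 + y\<^sup>2) * \<phi> t))"
      unfolding F_def cauchy_transform_Re_Im(1)[OF \<phi> y] by simp
    also have "\<dots> \<le> (\<integral>\<^sup>+t. ennreal (norm (y / ((x - t)\<^sup>2 + y\<^sup>2) * \<phi> t)) \<partial>lborel)"
      by (rule integral_norm_bound_ennreal[OF i])
    also have "\<dots> = (\<integral>\<^sup>+t. ennreal (y / ((x - t)\<^sup>2 + y\<^sup>2) * \<bar>\<phi> t\<bar>) \<partial>lborel)"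
      using y by (simp add: abs_mult)
    finally show "ennreal \<bar>Re (F (Complex x y))\<bar> \<le> (\<integral>\<^sup>+t. ennreal (y / ((x - t)\<^sup>2 + y\<^sup>2) * \<bar>\<phi> t\<bar>) \<partial>lborel)" .
  qed (use p y in auto)
  then have Re_le: "ennreal (p powr p) * (\<integral>\<^sup>+x. ennreal (\<bar>Re (F (Complex x y))\<bar> powr p) \<partial>lborel)
      \<le> ennreal (p powr p) * (ennreal (pi powr p) * (\<integral>\<^sup>+t. ennreal (\<bar>\<phi> t\<bar> powr p) \<partial>lborel))"
    by (rule mult_left_mono) simp
  have "(\<integral>\<^sup>+x. ennreal (\<bar>LINT t|lborel. (x - t) / ((x - t)\<^sup>2 + y\<^sup>2) * \<phi> t\<bar> powr p) \<partial>lborel)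
      \<le> (\<integral>\<^sup>+x. ennreal (norm (F (Complex x y)) powr p) \<partial>lborel)"
    unfolding F_def cauchy_transform_Re_Im(2)[OF \<phi> y, symmetric]
    using p by (intro nn_integral_mono ennreal_leI powr_mono2 abs_Im_le_cmod) auto
  also have "\<dots> = ennreal (LINT x|lborel. norm (F (Complex x y)) powr p)"
    by (rule nn_integral_eq_integral[OF R(1)]) auto
  also have "\<dots> \<le> ennreal (p powr p * (LINT x|lborel. \<bar>Re (F (Complex x y))\<bar> powr p))"
    by (rule ennreal_leI[OF R(3)])
  also have "\<dots> = ennreal (p powr p) * ennreal (LINT x|lborel. \<bar>Re (F (Complex x y))\<bar> powr p)"
    by (rule ennreal_mult) auto
  also have "ennreal (LINT x|lborel. \<bar>Re (F (Complex x y))\<bar> powr p) =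
      (\<integral>\<^sup>+x. ennreal (\<bar>Re (F (Complex x y))\<bar> powr p) \<partial>lborel)"
    by (rule nn_integral_eq_integral[OF R(2), symmetric]) auto
  also note Re_le
  also have "ennreal (p powr p) * (ennreal (pi powr p) * (\<integral>\<^sup>+t. ennreal (\<bar>\<phi> t\<bar> powr p) \<partial>lborel)) =
      ennreal ((p * pi) powr p) * (\<integral>\<^sup>+t. ennreal (\<bar>\<phi> t\<bar> powr p) \<partial>lborel)"
    using p by (simp add: powr_mult ennreal_mult mult.assoc)
  finally show ?thesis .
qed

section \<open>The truncated Hilbert transform\<close>

lemma truncated_kernel_near_conjugate_Poisson:
  fixes s \<epsilon> :: real
  assumes "\<epsilon> > 0"
  shows "\<bar>(if \<epsilon> < \<bar>s\<bar> then 1 / s else 0) - s / (s\<^sup>2 + \<epsilon>\<^sup>2)\<bar> \<le> \<epsilon> / (s\<^sup>2 + \<epsilon>\<^sup>2)"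
proof (cases "\<epsilon> < \<bar>s\<bar>")
  case True
  then have s: "s \<noteq> 0" "s\<^sup>2 + \<epsilon>\<^sup>2 > 0" using assms by (auto simp: add_pos_nonneg)
  have "1 / s - s / (s\<^sup>2 + \<epsilon>\<^sup>2) = (\<epsilon> / s) * (\<epsilon> / (s\<^sup>2 + \<epsilon>\<^sup>2))"
    using s by (simp add: divide_simps) (simp add: power2_eq_square algebra_simps)
  moreover have "\<bar>\<epsilon> / s\<bar> \<le> 1" using True s assms by (simp add: divide_simps)
  moreover have "\<epsilon> / (s\<^sup>2 + \<epsilon>\<^sup>2) \<ge> 0" using assms s by simp
  ultimately show ?thesis
    using True assms mult_right_mono[of "\<bar>\<epsilon> / s\<bar>" 1 "\<epsilon> / (s\<^sup>2 + \<epsilon>\<^sup>2)"] by (simp add: abs_mult)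
next
  case False
  then show ?thesis using assms by (simp add: abs_divide divide_right_mono)
qed

text \<open>The Hilbert transform, up to the factor \<open>\<pi>\<close>, with its kernel cut off to \<open>\<epsilon> < \<bar>x - y\<bar> \<le> 1\<close>.  The outer cut-off makes
it local, so it is defined for every locally integrable \<open>\<phi>\<close>.\<close>

definition hilbert_annulus :: "real \<Rightarrow> (real \<Rightarrow> real) \<Rightarrow> real \<Rightarrow> real" where
  "hilbert_annulus \<epsilon> \<phi> x = (LINT y|lborel. (if \<epsilon> < \<bar>x - y\<bar> \<and> \<bar>x - y\<bar> \<le> 1 then 1 / (x - y) else 0) * \<phi> y)"

text \<open>The kernel of \<open>hilbert_annulus\<close> is the difference of the kernels \<open>1/s\<close> cut off at \<open>\<bar>s\<bar> > \<epsilon>\<close> and at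
\<open>\<bar>s\<bar> > 1\<close>; each is a conjugate Poisson kernel up to a Poisson kernel.\<close>

lemma hilbert_annulus_pointwise:
  fixes \<phi> :: "real \<Rightarrow> real"
  assumes \<phi>: "integrable lborel \<phi>" and \<epsilon>: "0 < \<epsilon>" "\<epsilon> \<le> 1"
  shows "\<bar>hilbert_annulus \<epsilon> \<phi> x\<bar>
     \<le> (\<bar>LINT t|lborel. (x - t) / ((x - t)\<^sup>2 + \<epsilon>\<^sup>2) * \<phi> t\<bar> + \<bar>LINT t|lborel. (x - t) / ((x - t)\<^sup>2 + 1\<^sup>2) * \<phi> t\<bar>)
      + ((LINT t|lborel. \<epsilon> / ((x - t)\<^sup>2 + \<epsilon>\<^sup>2) * \<bar>\<phi> t\<bar>) + (LINT t|lborel. 1 / ((x - t)\<^sup>2 + 1\<^sup>2) * \<bar>\<phi> t\<bar>))"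
proof -
  define k where "k \<delta> t = (if \<delta> < \<bar>x - t\<bar> then 1 / (x - t) else 0)" for \<delta> t :: real
  define q where "q \<delta> t = (x - t) / ((x - t)\<^sup>2 + \<delta>\<^sup>2)" for \<delta> t
  define P where "P \<delta> t = \<delta> / ((x - t)\<^sup>2 + \<delta>\<^sup>2)" for \<delta> t
  have kq: "\<bar>k \<delta> t - q \<delta> t\<bar> \<le> P \<delta> t" if "\<delta> > 0" for \<delta> t
    using truncated_kernel_near_conjugate_Poisson[OF that, of "x - t"] by (simp add: k_def q_def P_def)
  have P0: "P \<delta> t \<ge> 0" "P \<delta> t \<le> 1 / \<delta>" if "\<delta> > 0" for \<delta> t
  proof -
    show "P \<delta> t \<ge> 0" using that by (simp add: P_def)
    have "\<delta> / ((x - t)\<^sup>2 + \<delta>\<^sup>2) \<le> \<delta> / \<delta>\<^sup>2"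
      using that by (intro divide_left_mono mult_pos_pos) (auto simp: add_nonneg_pos)
    then show "P \<delta> t \<le> 1 / \<delta>" using that by (simp add: P_def power2_eq_square)
  qed
  have k_bd: "\<bar>k \<delta> t\<bar> \<le> 1 / \<delta>" if "\<delta> > 0" for \<delta> t
    using that by (cases "\<delta> < \<bar>x - t\<bar>") (auto simp: k_def abs_divide intro!: divide_left_mono mult_pos_pos)
  have intk: "integrable lborel (\<lambda>t. k \<delta> t * \<phi> t)" if "\<delta> > 0" for \<delta>
    using integrable_mult_bounded[OF \<phi>, of "k \<delta>" "1 / \<delta>"] k_bd[OF that] by (simp add: k_def[abs_def])
  have intq: "integrable lborel (\<lambda>t. q \<delta> t * \<phi> t)" if "\<delta> > 0" for \<delta>
  proof -
    have "\<bar>q \<delta> t\<bar> \<le> 2 / \<delta>" for t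
      using kq[OF that, of t] k_bd[OF that, of t] P0[OF that, of t] by linarith
    then show ?thesis
      using integrable_mult_bounded[OF \<phi>, of "q \<delta>" "2 / \<delta>"] by (simp add: q_def[abs_def])
  qed
  have intP: "integrable lborel (\<lambda>t. P \<delta> t * \<bar>\<phi> t\<bar>)" if "\<delta> > 0" for \<delta>
    using integrable_mult_bounded[OF integrable_abs[OF \<phi>], of "P \<delta>" "1 / \<delta>"] P0[OF that] that
    by (simp add: P_def[abs_def])
  have diff: "\<bar>(LINT t|lborel. k \<delta> t * \<phi> t) - (LINT t|lborel. q \<delta> t * \<phi> t)\<bar> \<le> (LINT t|lborel. P \<delta> t * \<bar>\<phi> t\<bar>)"
    if "\<delta> > 0" for \<delta>
  proof -
    have "\<bar>(LINT t|lborel. k \<delta> t * \<phi> t) - (LINT t|lborel. q \<delta> t * \<phi> t)\<bar> =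
        \<bar>LINT t|lborel. k \<delta> t * \<phi> t - q \<delta> t * \<phi> t\<bar>"
      using intk[OF that] intq[OF that] by simp
    also have "\<dots> \<le> (LINT t|lborel. \<bar>k \<delta> t * \<phi> t - q \<delta> t * \<phi> t\<bar>)" by (rule integral_abs_bound)
    also have "\<dots> \<le> (LINT t|lborel. P \<delta> t * \<bar>\<phi> t\<bar>)"
    proof (rule integral_mono)
      show "\<bar>k \<delta> t * \<phi> t - q \<delta> t * \<phi> t\<bar> \<le> P \<delta> t * \<bar>\<phi> t\<bar>" for t
        unfolding left_diff_distrib[symmetric] abs_mult by (rule mult_right_mono[OF kq[OF that]]) simp
    qed (use intk[OF that] intq[OF that] intP[OF that] in auto)
    finally show ?thesis .
  qed
  have "hilbert_annulus \<epsilon> \<phi> x = (LINT t|lborel. k \<epsilon> t * \<phi> t - k 1 t * \<phi> t)"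
    unfolding hilbert_annulus_def using \<epsilon>
    by (intro Bochner_Integration.integral_cong) (auto simp: k_def)
  also have "\<dots> = (LINT t|lborel. k \<epsilon> t * \<phi> t) - (LINT t|lborel. k 1 t * \<phi> t)"
    using intk \<epsilon> by simp
  finally show ?thesis
    using diff[OF \<epsilon>(1)] diff[of 1] by (simp add: q_def P_def)
qed

lemma powr_sum4_le:
  fixes a b c d p :: real
  assumes "a \<ge> 0" "b \<ge> 0" "c \<ge> 0" "d \<ge> 0" "p > 0"
  shows "((a + b) + (c + d)) powr p \<le> 4 powr p * (a powr p + b powr p + (c powr p + d powr p))"
proof -
  define m where "m = max (max a b) (max c d)"
  have "((a + b) + (c + d)) powr p \<le> (4 * m) powr p"
    using assms by (intro powr_mono2) (auto simp: m_def)
  also have "\<dots> = 4 powr p * m powr p" by (rule powr_mult)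
  also have "m powr p \<le> a powr p + b powr p + (c powr p + d powr p)"
  proof -
    have "m = a \<or> m = b \<or> m = c \<or> m = d" unfolding m_def by linarith
    then show ?thesis using powr_ge_zero[of a p] powr_ge_zero[of b p] powr_ge_zero[of c p] powr_ge_zero[of d p] by force
  qed
  finally show ?thesis by simp
qed

lemma hilbert_annulus_Lp_compact:
  fixes \<phi> :: "real \<Rightarrow> real"
  assumes p: "p \<ge> 2" and \<phi>: "integrable lborel \<phi>" and \<epsilon>: "0 < \<epsilon>" "\<epsilon> \<le> 1"
    and supp: "\<And>t. R < \<bar>t\<bar> \<Longrightarrow> \<phi> t = 0"
  shows "(\<integral>\<^sup>+x. ennreal (\<bar>hilbert_annulus \<epsilon> \<phi> x\<bar> powr p) \<partial>lborel)
     \<le> ennreal (4 powr p * (2 * (p * pi) powr p + 2 * pi powr p)) * (\<integral>\<^sup>+t. ennreal (\<bar>\<phi> t\<bar> powr p) \<partial>lborel)"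
proof -
  have [measurable]: "\<phi> \<in> borel_measurable lborel" using \<phi> by (rule borel_measurable_integrable)
  define X where "X = (\<integral>\<^sup>+t. ennreal (\<bar>\<phi> t\<bar> powr p) \<partial>lborel)"
  define Q where "Q \<delta> x = \<bar>LINT t|lborel. (x - t) / ((x - t)\<^sup>2 + \<delta>\<^sup>2) * \<phi> t\<bar>" for \<delta> x
  define P where "P \<delta> x = (LINT t|lborel. \<delta> / ((x - t)\<^sup>2 + \<delta>\<^sup>2) * \<bar>\<phi> t\<bar>)" for \<delta> x
  have [measurable]: "Q \<delta> \<in> borel_measurable lborel" "P \<delta> \<in> borel_measurable lborel" for \<delta>
    unfolding Q_def[abs_def] P_def[abs_def] by measurable
  have P0: "P \<delta> x \<ge> 0" if "\<delta> > 0" for \<delta> x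
    unfolding P_def using that by (intro Bochner_Integration.integral_nonneg) auto
  have P_Lp: "(\<integral>\<^sup>+x. ennreal (P \<delta> x powr p) \<partial>lborel) \<le> ennreal (pi powr p) * X" if "\<delta> > 0" for \<delta>
    unfolding X_def
  proof (rule Poisson_convolution_Lp)
    fix x
    show "ennreal (P \<delta> x) \<le> (\<integral>\<^sup>+t. ennreal (\<delta> / ((x - t)\<^sup>2 + \<delta>\<^sup>2) * \<bar>\<phi> t\<bar>) \<partial>lborel)"
      unfolding P_def using that
      by (cases "integrable lborel (\<lambda>t. \<delta> / ((x - t)\<^sup>2 + \<delta>\<^sup>2) * \<bar>\<phi> t\<bar>)")
         (auto simp: nn_integral_eq_integral not_integrable_integral_eq)
  qed (use p that P0 in auto)
  have Q_Lp: "(\<integral>\<^sup>+x. ennreal (Q \<delta> x powr p) \<partial>lborel) \<le> ennreal ((p * pi) powr p) * X" if "\<delta> > 0" for \<delta>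
    unfolding X_def Q_def by (rule conjugate_Poisson_Lp[OF p that \<phi> supp])
  have "(\<integral>\<^sup>+x. ennreal (\<bar>hilbert_annulus \<epsilon> \<phi> x\<bar> powr p) \<partial>lborel)
      \<le> (\<integral>\<^sup>+x. ennreal (4 powr p) * (ennreal (Q \<epsilon> x powr p) + ennreal (Q 1 x powr p)
            + (ennreal (P \<epsilon> x powr p) + ennreal (P 1 x powr p))) \<partial>lborel)"
  proof (rule nn_integral_mono)
    fix x
    have "\<bar>hilbert_annulus \<epsilon> \<phi> x\<bar> powr p \<le> (Q \<epsilon> x + Q 1 x + (P \<epsilon> x + P 1 x)) powr p"
      using hilbert_annulus_pointwise[OF \<phi> \<epsilon>, of x] p
      by (intro powr_mono2) (auto simp: Q_def P_def)
    also have "\<dots> \<le> 4 powr p * (Q \<epsilon> x powr p + Q 1 x powr p + (P \<epsilon> x powr p + P 1 x powr p))"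
      using p \<epsilon> P0 by (intro powr_sum4_le) (auto simp: Q_def)
    finally have "ennreal (\<bar>hilbert_annulus \<epsilon> \<phi> x\<bar> powr p)
        \<le> ennreal (4 powr p * (Q \<epsilon> x powr p + Q 1 x powr p + (P \<epsilon> x powr p + P 1 x powr p)))"
      by (rule ennreal_leI)
    then show "ennreal (\<bar>hilbert_annulus \<epsilon> \<phi> x\<bar> powr p)
        \<le> ennreal (4 powr p) * (ennreal (Q \<epsilon> x powr p) + ennreal (Q 1 x powr p)
            + (ennreal (P \<epsilon> x powr p) + ennreal (P 1 x powr p)))"
      by (simp add: ennreal_mult)
  qed
  also have "\<dots> = ennreal (4 powr p) * ((\<integral>\<^sup>+x. ennreal (Q \<epsilon> x powr p) \<partial>lborel) + (\<integral>\<^sup>+x. ennreal (Q 1 x powr p) \<partial>lborel)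
            + ((\<integral>\<^sup>+x. ennreal (P \<epsilon> x powr p) \<partial>lborel) + (\<integral>\<^sup>+x. ennreal (P 1 x powr p) \<partial>lborel)))"
    by (simp add: nn_integral_cmult nn_integral_add)
  also have "\<dots> \<le> ennreal (4 powr p) * (ennreal ((p * pi) powr p) * X + ennreal ((p * pi) powr p) * X
            + (ennreal (pi powr p) * X + ennreal (pi powr p) * X))"
    using \<epsilon> by (intro mult_left_mono add_mono Q_Lp P_Lp) auto
  also have "\<dots> = ennreal (4 powr p) * (ennreal (2 * (p * pi) powr p + 2 * pi powr p) * X)"
  proof -
    have "ennreal ((p * pi) powr p) * X + ennreal ((p * pi) powr p) * X + (ennreal (pi powr p) * X + ennreal (pi powr p) * X)
        = (ennreal ((p * pi) powr p) + ennreal ((p * pi) powr p) + (ennreal (pi powr p) + ennreal (pi powr p))) * X"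
      by (simp only: distrib_right)
    also have "ennreal ((p * pi) powr p) + ennreal ((p * pi) powr p) + (ennreal (pi powr p) + ennreal (pi powr p))
        = ennreal (2 * (p * pi) powr p + 2 * pi powr p)"
      by (simp only: mult_2 ennreal_plus powr_ge_zero add_nonneg_nonneg)
    finally show ?thesis by simp
  qed
  also have "\<dots> = ennreal (4 powr p * (2 * (p * pi) powr p + 2 * pi powr p)) * X"
    by (simp add: ennreal_mult mult.assoc)
  finally show ?thesis by (simp add: X_def)
qed

lemma Lp_imp_integrable_on_interval:
  fixes \<phi> :: "real \<Rightarrow> real"
  assumes [measurable]: "\<phi> \<in> borel_measurable lborel" and p: "p \<ge> 1"
    and fin: "(\<integral>\<^sup>+t. ennreal (\<bar>\<phi> t\<bar> powr p) \<partial>lborel) < \<infinity>"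
  shows "integrable lborel (\<lambda>t. \<phi> t * indicator {a..b} t)"
proof (rule Bochner_Integration.integrable_bound)
  have "integrable lborel (\<lambda>t. \<bar>\<phi> t\<bar> powr p)"
    using fin by (intro integrableI_bounded) auto
  moreover have "integrable lborel (indicator {a..b} :: real \<Rightarrow> real)"
    by (intro integrable_real_indicator) (auto simp: emeasure_lborel_Icc_eq)
  ultimately show "integrable lborel (\<lambda>t. indicator {a..b} t + \<bar>\<phi> t\<bar> powr p)"
    by (intro Bochner_Integration.integrable_add)
  show "AE t in lborel. norm (\<phi> t * indicator {a..b} t) \<le> norm (indicator {a..b} t + \<bar>\<phi> t\<bar> powr p)"
  proof (rule AE_I2)
    fix t
    have "\<bar>\<phi> t\<bar> \<le> 1 + \<bar>\<phi> t\<bar> powr p"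
    proof (cases "\<bar>\<phi> t\<bar> \<le> 1")
      case False
      then have "\<bar>\<phi> t\<bar> powr 1 \<le> \<bar>\<phi> t\<bar> powr p" using p by (intro powr_mono) auto
      then show ?thesis using False by simp
    qed (simp add: add_increasing2)
    then show "norm (\<phi> t * indicator {a..b} t) \<le> norm (indicator {a..b} t + \<bar>\<phi> t\<bar> powr p)"
      by (auto simp: indicator_def)
  qed
qed simp

text \<open>Locality removes the assumption of bounded support: on \<open>[-n, n]\<close> the operator sees only the restriction of \<open>\<phi>\<close> to
\<open>[-n-1, n+1]\<close>, and the bound does not depend on \<open>n\<close>.\<close>

theorem hilbert_annulus_Lp:
  fixes \<phi> :: "real \<Rightarrow> real"
  assumes p: "p \<ge> 2" and [measurable]: "\<phi> \<in> borel_measurable lborel" and \<epsilon>: "0 < \<epsilon>" "\<epsilon> \<le> 1"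
  shows "(\<integral>\<^sup>+x. ennreal (\<bar>hilbert_annulus \<epsilon> \<phi> x\<bar> powr p) \<partial>lborel)
     \<le> ennreal (4 powr p * (2 * (p * pi) powr p + 2 * pi powr p)) * (\<integral>\<^sup>+t. ennreal (\<bar>\<phi> t\<bar> powr p) \<partial>lborel)"
proof (cases "(\<integral>\<^sup>+t. ennreal (\<bar>\<phi> t\<bar> powr p) \<partial>lborel) < \<infinity>")
  case False
  then have top: "(\<integral>\<^sup>+t. ennreal (\<bar>\<phi> t\<bar> powr p) \<partial>lborel) = \<infinity>" by (simp add: less_top[symmetric])
  have "ennreal c * \<infinity> = \<infinity>" if "c > 0" for c
    using that by (simp add: ennreal_mult_top)
  moreover have "4 powr p * (2 * (p * pi) powr p + 2 * pi powr p) > 0"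
    using p by (intro mult_pos_pos add_pos_pos) auto
  ultimately show ?thesis unfolding top by (metis top_greatest infinity_ennreal_def)
next
  case fin: True
  have [measurable]: "hilbert_annulus \<epsilon> \<phi> \<in> borel_measurable lborel"
    unfolding hilbert_annulus_def[abs_def] by measurable
  show ?thesis
  proof (rule nn_integral_le_if_truncations_le)
    fix n :: nat
    define \<psi> where "\<psi> t = \<phi> t * indicator {- (real n + 1)..real n + 1} t" for t
    have "(\<integral>\<^sup>+x. ennreal (\<bar>hilbert_annulus \<epsilon> \<phi> x\<bar> powr p) * indicator {- real n..real n} x \<partial>lborel)
        \<le> (\<integral>\<^sup>+x. ennreal (\<bar>hilbert_annulus \<epsilon> \<psi> x\<bar> powr p) \<partial>lborel)"
    proof (rule nn_integral_mono)
      fix x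
      have "hilbert_annulus \<epsilon> \<phi> x = hilbert_annulus \<epsilon> \<psi> x" if "x \<in> {- real n..real n}"
        unfolding hilbert_annulus_def
        using that by (intro Bochner_Integration.integral_cong) (auto simp: \<psi>_def indicator_def)
      then show "ennreal (\<bar>hilbert_annulus \<epsilon> \<phi> x\<bar> powr p) * indicator {- real n..real n} x
          \<le> ennreal (\<bar>hilbert_annulus \<epsilon> \<psi> x\<bar> powr p)"
        by (auto simp: indicator_def)
    qed
    also have "\<dots> \<le> ennreal (4 powr p * (2 * (p * pi) powr p + 2 * pi powr p)) * (\<integral>\<^sup>+t. ennreal (\<bar>\<psi> t\<bar> powr p) \<partial>lborel)"
    proof (rule hilbert_annulus_Lp_compact[OF p _ \<epsilon>])
      show "integrable lborel \<psi>"
        unfolding \<psi>_def[abs_def] by (rule Lp_imp_integrable_on_interval[OF _ _ fin]) (use p in auto)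
      show "\<psi> t = 0" if "real n + 1 < \<bar>t\<bar>" for t using that by (auto simp: \<psi>_def indicator_def)
    qed
    also have "\<dots> \<le> ennreal (4 powr p * (2 * (p * pi) powr p + 2 * pi powr p)) * (\<integral>\<^sup>+t. ennreal (\<bar>\<phi> t\<bar> powr p) \<partial>lborel)"
      by (intro mult_left_mono nn_integral_mono) (auto simp: \<psi>_def indicator_def)
    finally show "(\<integral>\<^sup>+x. ennreal (\<bar>hilbert_annulus \<epsilon> \<phi> x\<bar> powr p) * indicator {- real n..real n} x \<partial>lborel)
      \<le> ennreal (4 powr p * (2 * (p * pi) powr p + 2 * pi powr p)) * (\<integral>\<^sup>+t. ennreal (\<bar>\<phi> t\<bar> powr p) \<partial>lborel)" .
  qed simp
qed

section \<open>The weights\<close>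

lemma weight_pos: "weight \<gamma> x > 0"
  unfolding weight_def powr_gt_zero using zero_le_power2[of x] by linarith

lemma weight_nonneg [simp]: "weight \<gamma> x \<ge> 0" and weight_neq_0 [simp]: "weight \<gamma> x \<noteq> 0"
  using weight_pos[of \<gamma> x] by auto

lemma weight_measurable [measurable]: "weight \<gamma> \<in> borel_measurable borel"
  unfolding weight_def[abs_def] by measurable

lemma sqrt_weight: "sqrt (weight \<beta> x) = weight (\<beta> / 2) x"
  by (simp add: weight_def powr_powr flip: powr_half_sqrt)

lemma weight_powr: "weight \<gamma> x powr p = weight (\<gamma> * p) x"
  by (simp add: weight_def powr_powr)

text \<open>Peetre's inequality \<open>1 + x\<^sup>2 \<le> 2 (1 + y\<^sup>2) (1 + (x - y)\<^sup>2)\<close>, raised to the power \<open>\<gamma>/2\<close>.\<close>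

lemma weight_shift:
  assumes "0 \<le> \<gamma>"
  shows "weight \<gamma> y \<le> (2 * (1 + (x - y)\<^sup>2)) powr (\<gamma> / 2) * weight \<gamma> x"
proof -
  have pos: "1 + x\<^sup>2 > 0" "1 + y\<^sup>2 > 0" "2 * (1 + (x - y)\<^sup>2) > 0" by (simp_all add: add_pos_nonneg)
  have "2 * (1 + y\<^sup>2) * (1 + (x - y)\<^sup>2) - (1 + x\<^sup>2) = 1 + (x - 2 * y)\<^sup>2 + 2 * y\<^sup>2 * (x - y)\<^sup>2"
    by (simp add: power2_eq_square algebra_simps)
  also have "\<dots> \<ge> 0" by simp
  finally have "(1 + x\<^sup>2) / (2 * (1 + (x - y)\<^sup>2)) \<le> 1 + y\<^sup>2"
    using pos by (simp add: divide_simps) (simp add: algebra_simps)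
  then have "(1 + y\<^sup>2) powr (- \<gamma> / 2) \<le> ((1 + x\<^sup>2) / (2 * (1 + (x - y)\<^sup>2))) powr (- \<gamma> / 2)"
    using pos assms by (intro powr_mono2') auto
  also have "\<dots> = (2 * (1 + (x - y)\<^sup>2)) powr (\<gamma> / 2) * (1 + x\<^sup>2) powr (- \<gamma> / 2)"
    using pos by (simp add: powr_divide powr_minus divide_simps)
  finally show ?thesis by (simp add: weight_def)
qed

lemma weight_le_near:
  assumes "0 \<le> \<gamma>" "\<gamma> \<le> 1" "\<bar>x - y\<bar> \<le> 1"
  shows "weight \<gamma> y \<le> 2 * weight \<gamma> x"
proof -
  have "(x - y)\<^sup>2 \<le> 1" using assms(3) by (simp add: abs_square_le_1)
  then have "(2 * (1 + (x - y)\<^sup>2)) powr (\<gamma> / 2) \<le> (2\<^sup>2) powr (\<gamma> / 2)"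
    using assms by (intro powr_mono2) auto
  also have "\<dots> = 2 powr \<gamma>" by (rule power2_powr_half) simp
  also have "\<dots> \<le> 2 powr 1" using assms by (intro powr_mono) auto
  also have "2 powr 1 = (2 :: real)" by simp
  finally have "(2 * (1 + (x - y)\<^sup>2)) powr (\<gamma> / 2) * weight \<gamma> x \<le> 2 * weight \<gamma> x"
    by (rule mult_right_mono) simp
  with weight_shift[OF assms(1), of y x] show ?thesis by linarith
qed

lemma weight_le_far:
  assumes "0 \<le> \<gamma>" "\<gamma> \<le> 1" "\<bar>x - y\<bar> \<ge> 1"
  shows "weight \<gamma> y \<le> 2 * \<bar>x - y\<bar> powr \<gamma> * weight \<gamma> x"
proof -
  have "1 \<le> \<bar>x - y\<bar>\<^sup>2" using assms(3) by (rule one_le_power)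
  then have "(2 * (1 + (x - y)\<^sup>2)) powr (\<gamma> / 2) \<le> ((2 * \<bar>x - y\<bar>)\<^sup>2) powr (\<gamma> / 2)"
    using assms by (intro powr_mono2) (auto simp: power_mult_distrib)
  also have "\<dots> = 2 powr \<gamma> * \<bar>x - y\<bar> powr \<gamma>"
    by (subst power2_powr_half) (auto simp: powr_mult)
  also have "\<dots> \<le> 2 powr 1 * \<bar>x - y\<bar> powr \<gamma>"
    using assms by (intro mult_right_mono powr_mono) auto
  finally have "(2 * (1 + (x - y)\<^sup>2)) powr (\<gamma> / 2) * weight \<gamma> x \<le> 2 powr 1 * \<bar>x - y\<bar> powr \<gamma> * weight \<gamma> x"
    by (rule mult_right_mono) simp
  with weight_shift[OF assms(1), of y x] show ?thesis by simp
qed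

definition weight_D1 :: "real \<Rightarrow> real \<Rightarrow> real" where
  "weight_D1 \<gamma> x = - \<gamma> * x / (1 + x\<^sup>2) * weight \<gamma> x"

definition weight_D2 :: "real \<Rightarrow> real \<Rightarrow> real" where
  "weight_D2 \<gamma> x = (\<gamma> * (x\<^sup>2 - 1) + \<gamma>\<^sup>2 * x\<^sup>2) / (1 + x\<^sup>2)\<^sup>2 * weight \<gamma> x"

lemma weight_has_derivative: "(weight \<gamma> has_real_derivative weight_D1 \<gamma> x) (at x)"
proof -
  have "1 + x\<^sup>2 > 0" by (simp add: add_pos_nonneg)
  moreover have "((\<lambda>x. 1 + x\<^sup>2) has_real_derivative 2 * x) (at x)"
    by (auto intro!: derivative_eq_intros)
  moreover have eq: "- \<gamma> / 2 * (2 * x) / (1 + x\<^sup>2) = - \<gamma> * x / (1 + x\<^sup>2)" by simp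
  ultimately show ?thesis
    unfolding weight_def[abs_def]
    using DERIV_powr_const[of "\<lambda>x. 1 + x\<^sup>2" "2 * x" x "- \<gamma> / 2"] eq
    by (simp only: weight_D1_def weight_def mult.commute)
qed

lemma weight_D1_has_derivative: "(weight_D1 \<gamma> has_real_derivative weight_D2 \<gamma> x) (at x)"
proof -
  have x: "1 + x\<^sup>2 > 0" by (simp add: add_pos_nonneg)
  have "((\<lambda>x. - \<gamma> * x / (1 + x\<^sup>2)) has_real_derivative \<gamma> * (x\<^sup>2 - 1) / (1 + x\<^sup>2)\<^sup>2) (at x)"
  proof (rule DERIV_cong)
    show "((\<lambda>x. - \<gamma> * x / (1 + x\<^sup>2)) has_real_derivative
        ((- \<gamma>) * (1 + x\<^sup>2) - (- \<gamma> * x) * (2 * x)) / ((1 + x\<^sup>2) * (1 + x\<^sup>2))) (at x)"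
      using x by (intro DERIV_divide) (auto intro!: derivative_eq_intros)
    show "((- \<gamma>) * (1 + x\<^sup>2) - (- \<gamma> * x) * (2 * x)) / ((1 + x\<^sup>2) * (1 + x\<^sup>2)) = \<gamma> * (x\<^sup>2 - 1) / (1 + x\<^sup>2)\<^sup>2"
      unfolding power2_eq_square[of "1 + x\<^sup>2"]
      by (rule arg_cong[where f = "\<lambda>u. u / _"]) (simp add: power2_eq_square algebra_simps)
  qed
  from DERIV_mult[OF this weight_has_derivative]
  show ?thesis
    unfolding weight_D1_def[abs_def]
  proof (rule DERIV_cong)
    have "\<gamma> * (x\<^sup>2 - 1) / r\<^sup>2 * w + - \<gamma> * x / r * w * (- \<gamma> * x / r) = (\<gamma> * (x\<^sup>2 - 1) + \<gamma>\<^sup>2 * x\<^sup>2) / r\<^sup>2 * w"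
      if "r \<noteq> 0" for r w :: real
      using that by (simp add: field_simps power2_eq_square)
    from this[of "1 + x\<^sup>2"] x
    show "\<gamma> * (x\<^sup>2 - 1) / (1 + x\<^sup>2)\<^sup>2 * weight \<gamma> x
        + - \<gamma> * x / (1 + x\<^sup>2) * weight \<gamma> x * (- \<gamma> * x / (1 + x\<^sup>2)) = weight_D2 \<gamma> x"
      unfolding weight_D2_def by (metis less_irrefl)
  qed
qed

lemma abs_weight_D1_le:
  assumes "0 \<le> \<gamma>" "\<gamma> \<le> 1"
  shows "\<bar>weight_D1 \<gamma> x\<bar> \<le> weight \<gamma> x"
proof -
  have x: "1 + x\<^sup>2 > 0" by (simp add: add_pos_nonneg)
  have "\<bar>x\<bar> \<le> 1 + x\<^sup>2"
    using zero_le_power2[of "\<bar>x\<bar> - 1"] by (simp add: power2_diff)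
  then have "\<gamma> * \<bar>x\<bar> \<le> 1 * (1 + x\<^sup>2)" using assms by (intro mult_mono) auto
  then have "\<bar>- \<gamma> * x / (1 + x\<^sup>2)\<bar> \<le> 1"
    using x assms by (simp add: abs_mult divide_simps)
  from mult_right_mono[OF this, of "weight \<gamma> x"] show ?thesis
    unfolding weight_D1_def abs_mult by simp
qed

lemma abs_weight_D2_le:
  assumes "0 \<le> \<gamma>" "\<gamma> \<le> 1"
  shows "\<bar>weight_D2 \<gamma> x\<bar> \<le> 2 * weight \<gamma> x"
proof -
  define r where "r = 1 + x\<^sup>2"
  have r: "r \<ge> 1" "x\<^sup>2 = r - 1" by (simp_all add: r_def)
  have "\<bar>\<gamma> * (x\<^sup>2 - 1)\<bar> \<le> 1 * r"
    unfolding abs_mult using assms r by (intro mult_mono) auto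
  moreover have "\<bar>\<gamma>\<^sup>2 * x\<^sup>2\<bar> \<le> 1 * r"
    unfolding abs_mult using assms r by (intro mult_mono) (auto simp: power_le_one)
  ultimately have "\<bar>\<gamma> * (x\<^sup>2 - 1) + \<gamma>\<^sup>2 * x\<^sup>2\<bar> \<le> 2 * r" by linarith
  also have "\<dots> \<le> 2 * r\<^sup>2" using r by (simp add: power2_eq_square)
  finally have "\<bar>(\<gamma> * (x\<^sup>2 - 1) + \<gamma>\<^sup>2 * x\<^sup>2) / r\<^sup>2\<bar> \<le> 2"
    using r by (simp add: abs_divide divide_simps)
  from mult_right_mono[OF this, of "weight \<gamma> x"] show ?thesis
    unfolding weight_D2_def abs_mult r_def by simp
qed

lemma MVT_unordered:
  fixes f f' :: "real \<Rightarrow> real"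
  assumes "\<And>x. (f has_real_derivative f' x) (at x)"
  obtains \<xi> where "f x - f y = f' \<xi> * (x - y)" "\<bar>x - \<xi>\<bar> \<le> \<bar>x - y\<bar>"
proof -
  consider "x < y" | "x = y" | "y < x" by linarith
  then show ?thesis
  proof cases
    case 1
    then obtain z where "x < z" "z < y" "f y - f x = (y - x) * f' z"
      using MVT2[of x y f f', OF 1 assms] by blast
    then show ?thesis by (intro that[of z]) (auto simp: algebra_simps)
  next
    case 2
    then show ?thesis by (intro that[of x]) auto
  next
    case 3
    then obtain z where "y < z" "z < x" "f x - f y = (x - y) * f' z"
      using MVT2[of y x f f', OF 3 assms] by blast
    then show ?thesis by (intro that[of z]) (auto simp: algebra_simps)
  qed
qed

lemma Taylor_remainder_le:
  fixes h h' h'' :: "real \<Rightarrow> real"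
  assumes h: "\<And>x. (h has_real_derivative h' x) (at x)" and h': "\<And>x. (h' has_real_derivative h'' x) (at x)"
    and M: "\<And>z. \<bar>x - z\<bar> \<le> 1 \<Longrightarrow> \<bar>h'' z\<bar> \<le> M" and xy: "\<bar>x - y\<bar> \<le> 1"
  shows "\<bar>h x - h y - h' x * (x - y)\<bar> \<le> M * (x - y)\<^sup>2"
proof -
  obtain \<xi> where \<xi>: "h x - h y = h' \<xi> * (x - y)" "\<bar>x - \<xi>\<bar> \<le> \<bar>x - y\<bar>"
    using MVT_unordered[OF h] .
  obtain \<eta> where \<eta>: "h' x - h' \<xi> = h'' \<eta> * (x - \<xi>)" "\<bar>x - \<eta>\<bar> \<le> \<bar>x - \<xi>\<bar>"
    using MVT_unordered[OF h'] .
  have "\<bar>h'' \<eta>\<bar> \<le> M" using M \<xi>(2) \<eta>(2) xy by force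
  then have "\<bar>h'' \<eta> * (x - \<xi>)\<bar> \<le> M * \<bar>x - y\<bar>"
    unfolding abs_mult using \<xi>(2) by (intro mult_mono) auto
  then have "\<bar>h'' \<eta> * (x - \<xi>)\<bar> * \<bar>x - y\<bar> \<le> M * \<bar>x - y\<bar> * \<bar>x - y\<bar>"
    by (rule mult_right_mono) simp
  moreover have "h x - h y - h' x * (x - y) = - (h'' \<eta> * (x - \<xi>)) * (x - y)"
    unfolding \<xi>(1) \<eta>(1)[symmetric] by (simp add: algebra_simps)
  moreover have "(x - y)\<^sup>2 = \<bar>x - y\<bar> * \<bar>x - y\<bar>" by (simp add: power2_eq_square)
  ultimately show ?thesis
    by (simp only: abs_mult[of "- _"] abs_minus_cancel mult.assoc)
qed

lemma weight_Lipschitz_near: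
  assumes \<gamma>: "0 \<le> \<gamma>" "\<gamma> \<le> 1" and xy: "\<bar>x - y\<bar> \<le> 1"
  shows "\<bar>weight \<gamma> x - weight \<gamma> y\<bar> \<le> 2 * weight \<gamma> x * \<bar>x - y\<bar>"
proof -
  obtain \<xi> where \<xi>: "weight \<gamma> x - weight \<gamma> y = weight_D1 \<gamma> \<xi> * (x - y)" "\<bar>x - \<xi>\<bar> \<le> \<bar>x - y\<bar>"
    using MVT_unordered[OF weight_has_derivative] .
  have "\<bar>weight_D1 \<gamma> \<xi>\<bar> \<le> 2 * weight \<gamma> x"
    using abs_weight_D1_le[OF \<gamma>, of \<xi>] weight_le_near[OF \<gamma>, of x \<xi>] \<xi>(2) xy by linarith
  then show ?thesis unfolding \<xi>(1) abs_mult by (rule mult_right_mono) simp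
qed

lemma weight_Taylor_near:
  assumes \<gamma>: "0 \<le> \<gamma>" "\<gamma> \<le> 1" and xy: "\<bar>x - y\<bar> \<le> 1"
  shows "\<bar>weight \<gamma> x - weight \<gamma> y - weight_D1 \<gamma> x * (x - y)\<bar> \<le> 4 * weight \<gamma> x * (x - y)\<^sup>2"
proof (rule Taylor_remainder_le[OF weight_has_derivative weight_D1_has_derivative _ xy])
  show "\<bar>weight_D2 \<gamma> z\<bar> \<le> 4 * weight \<gamma> x" if "\<bar>x - z\<bar> \<le> 1" for z
    using abs_weight_D2_le[OF \<gamma>, of z] weight_le_near[OF \<gamma> that] by linarith
qed

section \<open>Integrability of powers\<close>

lemma nn_integral_even_le:
  fixes f :: "real \<Rightarrow> ennreal"
  assumes [measurable]: "f \<in> borel_measurable borel"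
  shows "(\<integral>\<^sup>+t. f \<bar>t\<bar> \<partial>lborel) \<le> 2 * (\<integral>\<^sup>+t. f t * indicator {0..} t \<partial>lborel)"
proof -
  have "(\<integral>\<^sup>+t. f \<bar>t\<bar> \<partial>lborel) \<le> (\<integral>\<^sup>+t. f t * indicator {0..} t + f (- t) * indicator {0..} (- t) \<partial>lborel)"
    by (intro nn_integral_mono) (auto simp: indicator_def abs_if)
  also have "\<dots> = (\<integral>\<^sup>+t. f t * indicator {0..} t \<partial>lborel) + (\<integral>\<^sup>+t. f (- t) * indicator {0..} (- t) \<partial>lborel)"
    by (rule nn_integral_add) auto
  also have "(\<integral>\<^sup>+t. f (- t) * indicator {0..} (- t) \<partial>lborel) = (\<integral>\<^sup>+t. f t * indicator {0..} t \<partial>lborel)"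
    using nn_integral_real_affine[of "\<lambda>t. f t * indicator {0..} t" "-1" 0] by simp
  finally show ?thesis by (simp add: mult_2)
qed

lemma nn_integral_abs_powr_near:
  assumes "s > -1"
  shows "(\<integral>\<^sup>+t. ennreal (if \<bar>t\<bar> \<le> 1 then \<bar>t\<bar> powr s else 0) \<partial>lborel) < \<infinity>"
proof -
  have "((\<lambda>t. t powr s) has_integral 1 powr (s + 1) / (s + 1)) {0..1::real}"
    using assms by (intro has_integral_powr_from_0) auto
  then have "(\<integral>\<^sup>+t. ennreal (t powr s) * indicator {0..1::real} t \<partial>lborel) = ennreal (1 powr (s + 1) / (s + 1))"
    by (intro nn_integral_has_integral_lebesgue') auto
  moreover have "(\<integral>\<^sup>+t. ennreal (if \<bar>t\<bar> \<le> 1 then \<bar>t\<bar> powr s else 0) \<partial>lborel)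
    \<le> 2 * (\<integral>\<^sup>+t. ennreal (if t \<le> 1 then t powr s else 0) * indicator {0..} t \<partial>lborel)"
    by (rule nn_integral_even_le) simp
  moreover have "(\<integral>\<^sup>+t. ennreal (if t \<le> 1 then t powr s else 0) * indicator {0..} t \<partial>lborel)
     = (\<integral>\<^sup>+t. ennreal (t powr s) * indicator {0..1::real} t \<partial>lborel)"
    by (intro nn_integral_cong) (auto simp: indicator_def)
  ultimately show ?thesis by (auto simp: ennreal_mult_less_top intro: le_less_trans)
qed

lemma nn_integral_abs_powr_far:
  assumes "s < -1"
  shows "(\<integral>\<^sup>+t. ennreal (if \<bar>t\<bar> > 1 then \<bar>t\<bar> powr s else 0) \<partial>lborel) < \<infinity>"
proof -
  have "((\<lambda>t. t powr s) has_integral - (1 powr (s + 1)) / (s + 1)) {1::real..}"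
    using assms by (intro has_integral_powr_to_inf) auto
  then have "(\<integral>\<^sup>+t. ennreal (t powr s) * indicator {1::real..} t \<partial>lborel) = ennreal (- (1 powr (s + 1)) / (s + 1))"
    by (intro nn_integral_has_integral_lebesgue') auto
  moreover have "(\<integral>\<^sup>+t. ennreal (if \<bar>t\<bar> > 1 then \<bar>t\<bar> powr s else 0) \<partial>lborel)
    \<le> 2 * (\<integral>\<^sup>+t. ennreal (if t > 1 then t powr s else 0) * indicator {0..} t \<partial>lborel)"
    by (rule nn_integral_even_le) simp
  moreover have "(\<integral>\<^sup>+t. ennreal (if t > 1 then t powr s else 0) * indicator {0..} t \<partial>lborel)
     \<le> (\<integral>\<^sup>+t. ennreal (t powr s) * indicator {1::real..} t \<partial>lborel)"
    by (intro nn_integral_mono) (auto simp: indicator_def)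
  ultimately have "(\<integral>\<^sup>+t. ennreal (if \<bar>t\<bar> > 1 then \<bar>t\<bar> powr s else 0) \<partial>lborel)
      \<le> 2 * ennreal (- (1 powr (s + 1)) / (s + 1))"
    by (elim order_trans) (rule mult_left_mono, simp_all)
  also have "\<dots> < \<infinity>" by (simp add: ennreal_mult_less_top)
  finally show ?thesis .
qed

text \<open>Packages finiteness as the real constant that \<open>schur_test\<close> asks for.\<close>

lemma nn_integral_finite_bound:
  assumes "(\<integral>\<^sup>+t. ennreal (f t) \<partial>M) < \<infinity>"
  obtains A :: real where "A > 0" "(\<integral>\<^sup>+t. ennreal (f t) \<partial>M) \<le> ennreal A"
proof -
  obtain r where r: "r \<ge> 0" "(\<integral>\<^sup>+t. ennreal (f t) \<partial>M) = ennreal r"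
    using assms by (cases "\<integral>\<^sup>+t. ennreal (f t) \<partial>M") auto
  show ?thesis by (rule that[of "r + 1"]) (use r in \<open>auto intro!: ennreal_leI\<close>)
qed

section \<open>The commutator of order one half\<close>

text \<open>The commutator \<open>[\<Lambda>\<^sup>\<alpha>, g]\<close> without its normalising constant, with the principal value truncated at \<open>\<epsilon>\<close>.\<close>

definition trunc_commutator :: "real \<Rightarrow> (real \<Rightarrow> real) \<Rightarrow> real \<Rightarrow> (real \<Rightarrow> real) \<Rightarrow> real \<Rightarrow> real" where
  "trunc_commutator \<alpha> g \<epsilon> f x =
     (LINT y|lborel. (if \<epsilon> < \<bar>x - y\<bar> then (g x - g y) * f y / \<bar>x - y\<bar> powr (1 + \<alpha>) else 0))"

lemma abs_LINT_le_nn_integral: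
  fixes h :: "'a \<Rightarrow> real"
  shows "ennreal \<bar>LINT y|M. h y\<bar> \<le> (\<integral>\<^sup>+y. ennreal \<bar>h y\<bar> \<partial>M)"
proof (cases "integrable M h")
  case True
  from integral_norm_bound_ennreal[OF this] show ?thesis by simp
qed (simp add: not_integrable_integral_eq)

text \<open>Near the diagonal \<open>w\<close> is Lipschitz relative to its size.  Far from
it, \<open>w y / w x\<close> is bounded if \<open>(x - y)\<^sup>2 \<le> 1 + y\<^sup>2\<close>; otherwise it is at most
\<open>2 \<bar>x - y\<bar>\<^sup>\<beta> (1 + y\<^sup>2)\<^bsup>-\<beta>/2\<^esup>\<close>, and since \<open>\<beta> < 3/2\<close> the power \<open>\<bar>x - y\<bar>\<^bsup>\<beta> - 3/2\<^esup>\<close> may be traded for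
\<open>(1 + y\<^sup>2)\<^bsup>\<beta>/2 - 3/4\<^esup>\<close>.  This leaves \<open>(1 + y\<^sup>2)\<^bsup>-3/4\<^esup>\<close>.  The
right-hand side is integrable in \<open>y\<close> with a bound that does not depend on \<open>x\<close>.\<close>

lemma half_kernel_bound:
  assumes \<beta>: "0 < \<beta>" "\<beta> < 1"
  shows "\<bar>weight \<beta> x - weight \<beta> y\<bar> / (weight \<beta> x * \<bar>x - y\<bar> powr (3/2))
    \<le> 2 * (if \<bar>x - y\<bar> \<le> 1 then \<bar>x - y\<bar> powr (-1/2) else 0)
       + 3 * (if \<bar>x - y\<bar> > 1 then \<bar>x - y\<bar> powr (-3/2) else 0) + 2 * weight (3/2) y"
proof -
  define T where "T = \<bar>x - y\<bar>"
  have wx: "weight \<beta> x > 0" by (rule weight_pos)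
  consider "T = 0" | "0 < T" "T \<le> 1" | "T > 1" unfolding T_def by linarith
  then have "\<bar>weight \<beta> x - weight \<beta> y\<bar> / (weight \<beta> x * T powr (3/2))
    \<le> 2 * (if T \<le> 1 then T powr (-1/2) else 0) + 3 * (if T > 1 then T powr (-3/2) else 0) + 2 * weight (3/2) y"
  proof cases
    case 1
    then show ?thesis by simp
  next
    case 2
    have "\<bar>weight \<beta> x - weight \<beta> y\<bar> \<le> 2 * weight \<beta> x * T"
      using weight_Lipschitz_near[of \<beta> x y] \<beta> 2 by (simp add: T_def)
    also have "T = T powr (-1/2) * T powr (3/2)" using 2 by (simp flip: powr_add)
    finally have "\<bar>weight \<beta> x - weight \<beta> y\<bar> \<le> 2 * T powr (-1/2) * (weight \<beta> x * T powr (3/2))"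
      by (simp add: mult_ac)
    then have "\<bar>weight \<beta> x - weight \<beta> y\<bar> / (weight \<beta> x * T powr (3/2)) \<le> 2 * T powr (-1/2)"
      using wx 2 by (simp add: pos_divide_le_eq)
    then show ?thesis using 2 by (simp add: add_increasing2)
  next
    case 3
    have pos: "1 + x\<^sup>2 > 0" "1 + y\<^sup>2 > 0" by (simp_all add: add_pos_nonneg)
    have T2: "T\<^sup>2 = (x - y)\<^sup>2" by (simp add: T_def)
    have "2 * (1 + y\<^sup>2) + 2 * T\<^sup>2 - (1 + x\<^sup>2) = 1 + (x - 2 * y)\<^sup>2"
      unfolding T2 by (simp add: power2_eq_square algebra_simps)
    then have x_le: "1 + x\<^sup>2 \<le> 2 * (1 + y\<^sup>2) + 2 * T\<^sup>2"
      using zero_le_power2[of "x - 2 * y"] by linarith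
    have inv: "T powr (-3/2) * T powr (3/2) = 1" using 3 by (simp flip: powr_add)
    have b2: "2 powr \<beta> \<le> (2 :: real)" using powr_mono[of \<beta> 1 "2 :: real"] \<beta> by simp
    have wy: "weight \<beta> y \<le> (2 * T powr (-3/2) + 2 * weight (3/2) y) * (weight \<beta> x * T powr (3/2))"
    proof (cases "T\<^sup>2 \<le> 1 + y\<^sup>2")
      case True
      then have "(1 + x\<^sup>2) / 2\<^sup>2 \<le> 1 + y\<^sup>2" using x_le by simp
      then have "(1 + y\<^sup>2) powr (- \<beta> / 2) \<le> ((1 + x\<^sup>2) / 2\<^sup>2) powr (- \<beta> / 2)"
        using pos \<beta> by (intro powr_mono2') auto
      also have "\<dots> = (2\<^sup>2) powr (\<beta> / 2) * weight \<beta> x"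
        using pos by (simp add: powr_divide powr_minus divide_simps weight_def)
      also have "(2\<^sup>2 :: real) powr (\<beta> / 2) = 2 powr \<beta>" by (rule power2_powr_half) simp
      also have "2 powr \<beta> * weight \<beta> x \<le> 2 * weight \<beta> x" using b2 by (rule mult_right_mono) simp
      also have "\<dots> = (2 * T powr (-3/2)) * (weight \<beta> x * T powr (3/2))"
        using inv by (simp add: mult_ac)
      also have "\<dots> \<le> (2 * T powr (-3/2) + 2 * weight (3/2) y) * (weight \<beta> x * T powr (3/2))"
        by (intro mult_right_mono) auto
      finally show ?thesis by (simp add: weight_def)
    next
      case False
      define u where "u = 1 + y\<^sup>2"
      have u: "u > 0" "u \<le> T\<^sup>2" using pos False by (auto simp: u_def)
      have "1 + x\<^sup>2 \<le> (2 * T)\<^sup>2" using x_le False by (simp add: power_mult_distrib)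
      then have "((2 * T)\<^sup>2) powr (- \<beta> / 2) \<le> weight \<beta> x"
        unfolding weight_def using pos \<beta> by (intro powr_mono2') auto
      also have "((2 * T)\<^sup>2) powr (- \<beta> / 2) = (2 * T) powr (- \<beta>)"
        using 3 by (intro power2_powr_half) simp
      finally have wx_ge: "(2 * T) powr (- \<beta>) \<le> weight \<beta> x" .
      have "u powr (3/4 - \<beta>/2) \<le> (T\<^sup>2) powr (3/4 - \<beta>/2)"
        using u \<beta> by (intro powr_mono2) auto
      also have "\<dots> = (T\<^sup>2) powr ((3/2 - \<beta>) / 2)"
        by (rule arg_cong[where f = "\<lambda>s. _ powr s"]) (simp add: field_simps)
      also have "\<dots> = T powr (3/2 - \<beta>)" using 3 by (intro power2_powr_half) simp
      also have "\<dots> = T powr (3/2) * T powr (- \<beta>)" by (simp flip: powr_add)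
      also have "\<dots> \<le> T powr (3/2) * (2 * (2 * T) powr (- \<beta>))"
      proof (rule mult_left_mono)
        have "T powr (- \<beta>) = 2 powr \<beta> * (2 * T) powr (- \<beta>)"
          by (simp add: powr_mult powr_minus)
        also have "\<dots> \<le> 2 * (2 * T) powr (- \<beta>)" using b2 by (rule mult_right_mono) simp
        finally show "T powr (- \<beta>) \<le> 2 * (2 * T) powr (- \<beta>)" .
      qed simp
      also have "\<dots> \<le> T powr (3/2) * (2 * weight \<beta> x)"
        using wx_ge by (intro mult_left_mono) auto
      finally have "u powr (- 3/4) * u powr (3/4 - \<beta>/2) \<le> u powr (- 3/4) * (T powr (3/2) * (2 * weight \<beta> x))"
        by (rule mult_left_mono) simp
      then have "weight \<beta> y \<le> (2 * weight (3/2) y) * (weight \<beta> x * T powr (3/2))"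
        using u by (simp add: weight_def u_def[symmetric] mult_ac flip: powr_add)
      also have "\<dots> \<le> (2 * T powr (-3/2) + 2 * weight (3/2) y) * (weight \<beta> x * T powr (3/2))"
        by (intro mult_right_mono) auto
      finally show ?thesis .
    qed
    have "\<bar>weight \<beta> x - weight \<beta> y\<bar> \<le> weight \<beta> x + weight \<beta> y"
      using weight_nonneg[of \<beta> x] weight_nonneg[of \<beta> y] by linarith
    also have "weight \<beta> x + weight \<beta> y
        \<le> T powr (-3/2) * (weight \<beta> x * T powr (3/2)) + (2 * T powr (-3/2) + 2 * weight (3/2) y) * (weight \<beta> x * T powr (3/2))"
    proof (rule add_mono[OF eq_refl wy])
      show "weight \<beta> x = T powr (-3/2) * (weight \<beta> x * T powr (3/2))"
        using inv by (simp add: mult_ac)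
    qed
    also have "\<dots> = (3 * T powr (-3/2) + 2 * weight (3/2) y) * (weight \<beta> x * T powr (3/2))"
      by (simp only: distrib_right[symmetric]) simp
    finally have "\<bar>weight \<beta> x - weight \<beta> y\<bar> / (weight \<beta> x * T powr (3/2)) \<le> 3 * T powr (-3/2) + 2 * weight (3/2) y"
      using wx 3 by (subst pos_divide_le_eq) auto
    then show ?thesis using 3 by simp
  qed
  then show ?thesis by (simp only: T_def)
qed

lemma nn_integral_weight_finite:
  assumes "\<gamma> > 1"
  shows "(\<integral>\<^sup>+y. ennreal (weight \<gamma> y) \<partial>lborel) < \<infinity>"
proof -
  have "(\<integral>\<^sup>+y. ennreal (weight \<gamma> y) \<partial>lborel)
      \<le> (\<integral>\<^sup>+y. indicator {-1..1} y + ennreal (if \<bar>y\<bar> > 1 then \<bar>y\<bar> powr (- \<gamma>) else 0) \<partial>lborel)"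
  proof (rule nn_integral_mono)
    fix y :: real
    show "ennreal (weight \<gamma> y) \<le> indicator {-1..1} y + ennreal (if \<bar>y\<bar> > 1 then \<bar>y\<bar> powr (- \<gamma>) else 0)"
    proof (cases "\<bar>y\<bar> > 1")
      case True
      then have y: "y \<noteq> 0" by auto
      have "weight \<gamma> y \<le> (\<bar>y\<bar>\<^sup>2) powr (- \<gamma> / 2)"
        unfolding weight_def using assms y by (intro powr_mono2') auto
      also have "\<dots> = \<bar>y\<bar> powr (- \<gamma>)" by (rule power2_powr_half) simp
      finally show ?thesis using True by (auto simp: indicator_def intro: ennreal_leI)
    next
      case False
      have "weight \<gamma> y \<le> 1 powr (- \<gamma> / 2)"
        unfolding weight_def using assms by (intro powr_mono2') auto
      then show ?thesis using False by (auto simp: indicator_def abs_le_iff)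
    qed
  qed
  also have "\<dots> = emeasure lborel {-1..1::real} + (\<integral>\<^sup>+y. ennreal (if \<bar>y\<bar> > 1 then \<bar>y\<bar> powr (- \<gamma>) else 0) \<partial>lborel)"
    by (subst nn_integral_add) auto
  also have "\<dots> < \<infinity>"
    using nn_integral_abs_powr_far[of "- \<gamma>"] assms by simp
  finally show ?thesis .
qed

text \<open>Schur's test with the absolute kernel \<open>K\<close>.  Because \<open>K x y * w x = w y * K y x\<close>, rows and columns satisfy the
same bound.\<close>

theorem half_commutator_truncations_bounded:
  assumes \<beta>: "0 < \<beta>" "\<beta> < 1" and p: "p > 1"
  shows "\<exists>C. \<forall>f \<epsilon>. f \<in> borel_measurable lborel \<longrightarrow>
    (\<integral>\<^sup>+x. ennreal (\<bar>1 / weight \<beta> x * trunc_commutator (1/2) (weight \<beta>) \<epsilon> f x\<bar> powr p * weight \<beta> x) \<partial>lborel)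
      \<le> ennreal C * (\<integral>\<^sup>+x. ennreal (\<bar>f x\<bar> powr p * weight \<beta> x) \<partial>lborel)"
proof -
  define K where "K x y = \<bar>weight \<beta> x - weight \<beta> y\<bar> / (weight \<beta> x * \<bar>x - y\<bar> powr (3/2))" for x y
  define near where "near t = (if \<bar>t\<bar> \<le> 1 then \<bar>t\<bar> powr (-1/2) else 0 :: real)" for t :: real
  define far where "far t = (if \<bar>t\<bar> > 1 then \<bar>t\<bar> powr (-3/2) else 0 :: real)" for t :: real
  have [measurable]: "near \<in> borel_measurable borel" "far \<in> borel_measurable borel"
    unfolding near_def[abs_def] far_def[abs_def] by measurable
  have nf0: "near t \<ge> 0" "far t \<ge> 0" for t by (simp_all add: near_def far_def)
  have fin_near: "(\<integral>\<^sup>+t. ennreal (near t) \<partial>lborel) < \<infinity>"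
    unfolding near_def by (rule nn_integral_abs_powr_near) simp
  obtain A1 where A1: "A1 > 0" "(\<integral>\<^sup>+t. ennreal (near t) \<partial>lborel) \<le> ennreal A1"
    using nn_integral_finite_bound[OF fin_near] .
  have fin_far: "(\<integral>\<^sup>+t. ennreal (far t) \<partial>lborel) < \<infinity>"
    unfolding far_def by (rule nn_integral_abs_powr_far) simp
  obtain A2 where A2: "A2 > 0" "(\<integral>\<^sup>+t. ennreal (far t) \<partial>lborel) \<le> ennreal A2"
    using nn_integral_finite_bound[OF fin_far] .
  obtain A3 where A3: "A3 > 0" "(\<integral>\<^sup>+t. ennreal (weight (3/2) t) \<partial>lborel) \<le> ennreal A3"
    using nn_integral_finite_bound[OF nn_integral_weight_finite[of "3/2"]] by auto
  define A where "A = 2 * A1 + 3 * A2 + 2 * A3"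
  have A: "A > 0" using A1 A2 A3 by (simp add: A_def)
  have [measurable]: "(\<lambda>(x, y). K x y) \<in> borel_measurable (lborel \<Otimes>\<^sub>M lborel)"
    unfolding K_def[abs_def] by measurable
  have row: "(\<integral>\<^sup>+y. ennreal (K x y) \<partial>lborel) \<le> ennreal A" for x
  proof -
    have "(\<integral>\<^sup>+y. ennreal (K x y) \<partial>lborel) \<le>
      (\<integral>\<^sup>+y. 2 * ennreal (near (x - y)) + 3 * ennreal (far (x - y)) + 2 * ennreal (weight (3/2) y) \<partial>lborel)"
    proof (rule nn_integral_mono)
      fix y
      have "K x y \<le> 2 * near (x - y) + 3 * far (x - y) + 2 * weight (3/2) y"
        using half_kernel_bound[OF \<beta>, of x y] by (simp add: K_def near_def far_def)
      then have "ennreal (K x y) \<le> ennreal (2 * near (x - y) + 3 * far (x - y) + 2 * weight (3/2) y)"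
        by (rule ennreal_leI)
      then show "ennreal (K x y) \<le> 2 * ennreal (near (x - y)) + 3 * ennreal (far (x - y)) + 2 * ennreal (weight (3/2) y)"
        using nf0 by (simp add: ennreal_mult)
    qed
    also have "\<dots> = 2 * (\<integral>\<^sup>+y. ennreal (near (x - y)) \<partial>lborel) + 3 * (\<integral>\<^sup>+y. ennreal (far (x - y)) \<partial>lborel)
        + 2 * (\<integral>\<^sup>+y. ennreal (weight (3/2) y) \<partial>lborel)"
      by (simp add: nn_integral_add nn_integral_cmult)
    also have "(\<integral>\<^sup>+y. ennreal (near (x - y)) \<partial>lborel) = (\<integral>\<^sup>+y. ennreal (near y) \<partial>lborel)"
      by (rule nn_integral_reflect_shift) simp
    also have "(\<integral>\<^sup>+y. ennreal (far (x - y)) \<partial>lborel) = (\<integral>\<^sup>+y. ennreal (far y) \<partial>lborel)"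
      by (rule nn_integral_reflect_shift) simp
    also have "2 * (\<integral>\<^sup>+y. ennreal (near y) \<partial>lborel) + 3 * (\<integral>\<^sup>+y. ennreal (far y) \<partial>lborel)
        + 2 * (\<integral>\<^sup>+y. ennreal (weight (3/2) y) \<partial>lborel) \<le> 2 * ennreal A1 + 3 * ennreal A2 + 2 * ennreal A3"
      by (intro add_mono mult_left_mono A1 A2 A3) auto
    also have "\<dots> = ennreal A"
      using A1 A2 A3 by (simp add: A_def ennreal_mult)
    finally show ?thesis .
  qed
  have sym: "K x y * weight \<beta> x = weight \<beta> y * K y x" for x y
    by (simp add: K_def abs_minus_commute)
  have col: "(\<integral>\<^sup>+x. ennreal (K x y * weight \<beta> x) \<partial>lborel) \<le> ennreal (A * weight \<beta> y)" for y
  proof -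
    have "(\<integral>\<^sup>+x. ennreal (K x y * weight \<beta> x) \<partial>lborel) = (\<integral>\<^sup>+x. ennreal (weight \<beta> y) * ennreal (K y x) \<partial>lborel)"
      unfolding sym by (intro nn_integral_cong ennreal_mult) (auto simp: K_def)
    also have "\<dots> = ennreal (weight \<beta> y) * (\<integral>\<^sup>+x. ennreal (K y x) \<partial>lborel)"
      by (rule nn_integral_cmult) (simp add: K_def)
    also have "\<dots> \<le> ennreal (weight \<beta> y) * ennreal A"
      by (rule mult_left_mono[OF row]) simp
    also have "\<dots> = ennreal (A * weight \<beta> y)"
      using A by (simp add: ennreal_mult mult.commute)
    finally show ?thesis .
  qed
  show ?thesis
  proof (intro exI allI impI)
    fix f :: "real \<Rightarrow> real" and \<epsilon> :: real
    assume [measurable]: "f \<in> borel_measurable lborel"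
    show "(\<integral>\<^sup>+x. ennreal (\<bar>1 / weight \<beta> x * trunc_commutator (1/2) (weight \<beta>) \<epsilon> f x\<bar> powr p * weight \<beta> x) \<partial>lborel)
      \<le> ennreal (A powr (p - 1) * A) * (\<integral>\<^sup>+x. ennreal (\<bar>f x\<bar> powr p * weight \<beta> x) \<partial>lborel)"
    proof (rule schur_test[OF _ _ _ p A _ _ _ row col])
      show "AE x in lborel. 0 \<le> \<bar>1 / weight \<beta> x * trunc_commutator (1/2) (weight \<beta>) \<epsilon> f x\<bar> \<and>
          ennreal \<bar>1 / weight \<beta> x * trunc_commutator (1/2) (weight \<beta>) \<epsilon> f x\<bar> \<le> (\<integral>\<^sup>+y. ennreal (K x y * \<bar>f y\<bar>) \<partial>lborel)"
      proof (intro AE_I2 conjI)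
        fix x
        have e: "1 / weight \<beta> x * trunc_commutator (1/2) (weight \<beta>) \<epsilon> f x =
            (LINT y|lborel. 1 / weight \<beta> x * (if \<epsilon> < \<bar>x - y\<bar> then (weight \<beta> x - weight \<beta> y) * f y / \<bar>x - y\<bar> powr (1 + 1/2) else 0))"
          unfolding trunc_commutator_def by simp
        show "ennreal \<bar>1 / weight \<beta> x * trunc_commutator (1/2) (weight \<beta>) \<epsilon> f x\<bar> \<le> (\<integral>\<^sup>+y. ennreal (K x y * \<bar>f y\<bar>) \<partial>lborel)"
          unfolding e
        proof (rule order_trans[OF abs_LINT_le_nn_integral nn_integral_mono[OF ennreal_leI]])
          fix y
          show "\<bar>1 / weight \<beta> x * (if \<epsilon> < \<bar>x - y\<bar> then (weight \<beta> x - weight \<beta> y) * f y / \<bar>x - y\<bar> powr (1 + 1/2) else 0)\<bar>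
              \<le> K x y * \<bar>f y\<bar>"
            by (cases "\<epsilon> < \<bar>x - y\<bar>") (simp_all add: K_def abs_mult)
        qed
      qed simp
      show "0 \<le> K x y" for x y by (simp add: K_def)
    qed (use A in simp_all)
  qed
qed

section \<open>The commutator of order one\<close>

lemma weight_square: "weight \<beta> x = (weight (\<beta> / 2) x)\<^sup>2"
  using weight_powr[of "\<beta> / 2" x 2] weight_nonneg[of "\<beta> / 2" x] by simp

text \<open>The kernel of \<open>(1/g) [\<Lambda>, g]\<close> with \<open>g = weight \<gamma>\<close> minus its singular part.  The singular part carries the factor
\<open>weight \<kappa> y / weight \<kappa> x\<close>, which later moves the weight of \<open>L\<^sup>p(w)\<close> into the function; since that factor is
\<open>1 + O(\<bar>x - y\<bar>)\<close>, inserting it costs only a bounded term.\<close>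

lemma sqrt_kernel_remainder_bound:
  fixes \<gamma> \<kappa> :: real
  assumes \<gamma>: "0 \<le> \<gamma>" "\<gamma> \<le> 1" and \<kappa>: "0 \<le> \<kappa>" "\<kappa> \<le> 1" and xy: "x \<noteq> y" "\<bar>x - y\<bar> \<le> 1"
  shows "\<bar>(weight \<gamma> x - weight \<gamma> y) / (weight \<gamma> x * (x - y)\<^sup>2)
           - weight_D1 \<gamma> x / weight \<gamma> x / (x - y) * (weight \<kappa> y / weight \<kappa> x)\<bar> \<le> 6"
proof -
  define s where "s = x - y"
  have s: "s \<noteq> 0" "\<bar>s\<bar> \<le> 1" using xy by (auto simp: s_def)
  define g where "g = weight \<gamma> x"
  define v where "v = weight \<kappa> x"
  have g: "g > 0" and v: "v > 0" by (simp_all add: g_def v_def weight_pos)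
  have e: "(g - weight \<gamma> y) / (g * s\<^sup>2) - weight_D1 \<gamma> x / g / s * (weight \<kappa> y / v)
      = (g - weight \<gamma> y - weight_D1 \<gamma> x * s) / (g * s\<^sup>2) + weight_D1 \<gamma> x / g * ((v - weight \<kappa> y) / (v * s))"
    using g v s by (simp add: field_simps power2_eq_square)
  have "\<bar>g - weight \<gamma> y - weight_D1 \<gamma> x * s\<bar> \<le> 4 * (g * s\<^sup>2)"
    using weight_Taylor_near[OF \<gamma> xy(2)] by (simp add: g_def s_def)
  then have 1: "\<bar>(g - weight \<gamma> y - weight_D1 \<gamma> x * s) / (g * s\<^sup>2)\<bar> \<le> 4"
    using g s by (simp add: abs_divide abs_mult pos_divide_le_eq)
  have "\<bar>v - weight \<kappa> y\<bar> \<le> 2 * (v * \<bar>s\<bar>)"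
    using weight_Lipschitz_near[OF \<kappa> xy(2)] by (simp add: v_def s_def)
  then have 2: "\<bar>(v - weight \<kappa> y) / (v * s)\<bar> \<le> 2"
    using v s by (simp add: abs_divide abs_mult pos_divide_le_eq)
  have 3: "\<bar>weight_D1 \<gamma> x / g\<bar> \<le> 1"
    using abs_weight_D1_le[OF \<gamma>, of x] g by (simp add: abs_divide g_def)
  have "\<bar>weight_D1 \<gamma> x / g * ((v - weight \<kappa> y) / (v * s))\<bar> \<le> 1 * 2"
    unfolding abs_mult[of "weight_D1 \<gamma> x / g"] using 2 3 by (intro mult_mono) auto
  with 1 have "\<bar>(g - weight \<gamma> y) / (g * s\<^sup>2) - weight_D1 \<gamma> x / g / s * (weight \<kappa> y / v)\<bar> \<le> 6"
    unfolding e by linarith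
  then show ?thesis by (simp only: g_def s_def v_def)
qed

text \<open>Dominates both parts of the kernel of \<open>(1/g) [\<Lambda>, g]\<close> that are estimated by absolute values: the remainder
near the diagonal and the whole kernel away from it.\<close>

definition sqrt_kernel :: "real \<Rightarrow> real \<Rightarrow> real \<Rightarrow> real" where
  "sqrt_kernel \<gamma> x y = (if \<bar>x - y\<bar> \<le> 1 then 6 else (1 + weight \<gamma> y / weight \<gamma> x) / (x - y)\<^sup>2)"

definition sqrt_majorant :: "real \<Rightarrow> real \<Rightarrow> real" where
  "sqrt_majorant \<beta> t = (if \<bar>t\<bar> \<le> 1 then 12 else 6 * \<bar>t\<bar> powr (\<beta> - 2))"

lemma sqrt_kernel_nonneg: "sqrt_kernel \<gamma> x y \<ge> 0"
  by (simp add: sqrt_kernel_def)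

lemma sqrt_kernel_measurable [measurable]:
  "(\<lambda>(x, y). sqrt_kernel \<gamma> x y) \<in> borel_measurable (lborel \<Otimes>\<^sub>M lborel)"
  unfolding sqrt_kernel_def by measurable

text \<open>One convolution kernel serves for rows and columns.  For the columns \<open>w = g\<^sup>2\<close> matters: after multiplication with
\<open>w x\<close>, the denominator \<open>g x\<close> disappears and only \<open>(g x)\<^sup>2\<close> and \<open>g x g y\<close> have to be compared with \<open>(g y)\<^sup>2\<close>, at
the cost of \<open>\<bar>x - y\<bar>\<^sup>\<beta>\<close>.\<close>

lemma sqrt_kernel_bounds:
  assumes \<beta>: "0 < \<beta>" "\<beta> < 1"
  shows "sqrt_kernel (\<beta> / 2) x y \<le> sqrt_majorant \<beta> (x - y)"
    and "sqrt_kernel (\<beta> / 2) x y * weight \<beta> x \<le> sqrt_majorant \<beta> (x - y) * weight \<beta> y"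
proof -
  define T where "T = \<bar>x - y\<bar>"
  define gx where "gx = weight (\<beta> / 2) x"
  define gy where "gy = weight (\<beta> / 2) y"
  have g: "gx > 0" "gy > 0" by (simp_all add: gx_def gy_def weight_pos)
  have w: "weight \<beta> x = gx\<^sup>2" "weight \<beta> y = gy\<^sup>2"
    unfolding gx_def gy_def by (rule weight_square)+
  have "sqrt_kernel (\<beta> / 2) x y \<le> sqrt_majorant \<beta> (x - y) \<and>
    sqrt_kernel (\<beta> / 2) x y * weight \<beta> x \<le> sqrt_majorant \<beta> (x - y) * weight \<beta> y"
  proof (cases "T \<le> 1")
    case True
    have "weight \<beta> x \<le> 2 * weight \<beta> y"
      using True \<beta> by (intro weight_le_near) (auto simp: T_def abs_minus_commute)
    then show ?thesis
      using True by (simp add: sqrt_kernel_def sqrt_majorant_def T_def)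
  next
    case False
    then have T: "T > 1" by simp
    have T2: "(x - y)\<^sup>2 = T powr 2" using T by (simp add: T_def)
    have Tpow: "T powr (\<beta> / 2) \<le> T powr \<beta>" "T powr \<beta> \<ge> 1" "T powr \<beta> = T powr (\<beta> / 2) * T powr (\<beta> / 2)"
      using T \<beta> by (auto intro!: powr_mono ge_one_powr_ge_zero simp flip: powr_add)
    have yx: "gy \<le> 2 * T powr (\<beta> / 2) * gx"
      unfolding T_def gx_def gy_def using T \<beta> by (intro weight_le_far) (auto simp: T_def)
    have xy: "gx \<le> 2 * T powr (\<beta> / 2) * gy"
      unfolding T_def gx_def gy_def using T \<beta> weight_le_far[of "\<beta> / 2" y x]
      by (auto simp: T_def abs_minus_commute)
    have K: "sqrt_kernel (\<beta> / 2) x y = (1 + gy / gx) / T powr 2"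
      using T by (simp add: sqrt_kernel_def T2 T_def[symmetric] gx_def gy_def)
    have M: "sqrt_majorant \<beta> (x - y) = 6 * T powr \<beta> / T powr 2"
      using T by (simp add: sqrt_majorant_def T_def[symmetric] powr_diff)
    have "gy / gx \<le> 2 * T powr (\<beta> / 2)" using yx g by (simp add: pos_divide_le_eq)
    then have "1 + gy / gx \<le> 6 * T powr \<beta>" using Tpow by linarith
    then have 1: "sqrt_kernel (\<beta> / 2) x y \<le> sqrt_majorant \<beta> (x - y)"
      unfolding K M by (rule divide_right_mono) simp
    have "gx * gx \<le> (2 * T powr (\<beta> / 2) * gy) * (2 * T powr (\<beta> / 2) * gy)"
      using xy g by (intro mult_mono) auto
    also have "\<dots> = 4 * T powr \<beta> * gy\<^sup>2" unfolding Tpow(3) by (simp add: power2_eq_square)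
    finally have a: "gx * gx \<le> 4 * T powr \<beta> * gy\<^sup>2" .
    have "gy * gx \<le> gy * (2 * T powr \<beta> * gy)"
    proof (rule mult_left_mono)
      have "2 * T powr (\<beta> / 2) * gy \<le> 2 * T powr \<beta> * gy" using Tpow(1) g by simp
      then show "gx \<le> 2 * T powr \<beta> * gy" using xy by linarith
    qed (use g in simp)
    also have "\<dots> = 2 * T powr \<beta> * gy\<^sup>2" by (simp add: power2_eq_square)
    finally have b: "gy * gx \<le> 2 * T powr \<beta> * gy\<^sup>2" .
    have "(1 + gy / gx) * gx\<^sup>2 = gx * gx + gy * gx" using g by (simp add: power2_eq_square field_simps)
    also have "\<dots> \<le> 6 * T powr \<beta> * gy\<^sup>2" using a b by linarith
    finally have "(1 + gy / gx) * gx\<^sup>2 / T powr 2 \<le> 6 * T powr \<beta> * gy\<^sup>2 / T powr 2"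
      by (rule divide_right_mono) simp
    then show ?thesis using 1 unfolding K M w by simp
  qed
  then show "sqrt_kernel (\<beta> / 2) x y \<le> sqrt_majorant \<beta> (x - y)"
    and "sqrt_kernel (\<beta> / 2) x y * weight \<beta> x \<le> sqrt_majorant \<beta> (x - y) * weight \<beta> y" by auto
qed

lemma sqrt_majorant_measurable [measurable]: "sqrt_majorant \<beta> \<in> borel_measurable borel"
  unfolding sqrt_majorant_def[abs_def] by measurable

lemma sqrt_majorant_integral_finite:
  assumes "\<beta> < 1"
  shows "(\<integral>\<^sup>+t. ennreal (sqrt_majorant \<beta> t) \<partial>lborel) < \<infinity>"
proof -
  have "(\<integral>\<^sup>+t. ennreal (sqrt_majorant \<beta> t) \<partial>lborel)
      = (\<integral>\<^sup>+t. 12 * indicator {-1..1} t + 6 * ennreal (if \<bar>t\<bar> > 1 then \<bar>t\<bar> powr (\<beta> - 2) else 0) \<partial>lborel)"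
  proof (rule nn_integral_cong)
    fix t :: real
    show "ennreal (sqrt_majorant \<beta> t) = 12 * indicator {-1..1} t + 6 * ennreal (if \<bar>t\<bar> > 1 then \<bar>t\<bar> powr (\<beta> - 2) else 0)"
      by (cases "\<bar>t\<bar> \<le> 1") (auto simp: sqrt_majorant_def indicator_def ennreal_mult abs_le_iff)
  qed
  also have "\<dots> = 12 * emeasure lborel {-1..1::real} + 6 * (\<integral>\<^sup>+t. ennreal (if \<bar>t\<bar> > 1 then \<bar>t\<bar> powr (\<beta> - 2) else 0) \<partial>lborel)"
    by (subst nn_integral_add) (auto simp: nn_integral_cmult)
  also have "\<dots> < \<infinity>"
    using nn_integral_abs_powr_far[of "\<beta> - 2"] assms by (simp add: ennreal_mult_less_top)
  finally show ?thesis .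
qed

lemma powr_sum2_le:
  fixes a b p :: real
  assumes "a \<ge> 0" "b \<ge> 0" "p > 0"
  shows "(a + b) powr p \<le> 2 powr p * (a powr p + b powr p)"
proof -
  define m where "m = max a b"
  have "(a + b) powr p \<le> (2 * m) powr p"
    using assms by (intro powr_mono2) (auto simp: m_def)
  also have "\<dots> = 2 powr p * m powr p" by (rule powr_mult)
  also have "\<dots> \<le> 2 powr p * (a powr p + b powr p)"
    by (intro mult_left_mono) (auto simp: m_def max_def)
  finally show ?thesis .
qed

lemma trunc_commutator_measurable [measurable]:
  assumes [measurable]: "g \<in> borel_measurable borel" "f \<in> borel_measurable borel"
  shows "trunc_commutator \<alpha> g \<epsilon> f \<in> borel_measurable borel"
  unfolding trunc_commutator_def[abs_def] by measurable

lemma hilbert_annulus_measurable [measurable]: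
  assumes [measurable]: "\<phi> \<in> borel_measurable borel"
  shows "hilbert_annulus \<epsilon> \<phi> \<in> borel_measurable borel"
  unfolding hilbert_annulus_def[abs_def] by measurable

text \<open>For \<open>\<epsilon> < \<bar>x - y\<bar> \<le> 1\<close> the subtracted Hilbert term is the integral over the singular part of the kernel, and
\<open>sqrt_kernel_remainder_bound\<close> applies to what is left; for \<open>\<bar>x - y\<bar> > 1\<close> the estimate
\<open>\<bar>g x - g y\<bar> \<le> g x + g y\<close> suffices.  The local integrability of \<open>w\<^bsup>1/p\<^esup> f\<close> is what allows the integral to be
split.\<close>

lemma sqrt_commutator_minus_hilbert_annulus:
  fixes f :: "real \<Rightarrow> real" and \<beta> p :: real
  assumes \<beta>: "0 < \<beta>" "\<beta> < 1" and p: "p \<ge> 2" and \<epsilon>: "0 < \<epsilon>"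
    and [measurable]: "f \<in> borel_measurable lborel"
    and int: "integrable lborel (\<lambda>y. if \<epsilon> < \<bar>x - y\<bar>
        then (weight (\<beta> / 2) x - weight (\<beta> / 2) y) * f y / \<bar>x - y\<bar> powr (1 + 1) else 0)"
    and loc: "integrable lborel (\<lambda>y. weight (\<beta> / p) y * f y * indicator {x - 1..x + 1} y)"
  shows "ennreal \<bar>1 / weight (\<beta> / 2) x * trunc_commutator 1 (weight (\<beta> / 2)) \<epsilon> f x
      - weight_D1 (\<beta> / 2) x / weight (\<beta> / 2) x / weight (\<beta> / p) x * hilbert_annulus \<epsilon> (\<lambda>y. weight (\<beta> / p) y * f y) x\<bar>
    \<le> (\<integral>\<^sup>+y. ennreal (sqrt_kernel (\<beta> / 2) x y * \<bar>f y\<bar>) \<partial>lborel)"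
proof -
  define g where "g = weight (\<beta> / 2)"
  define v where "v = weight (\<beta> / p)"
  define c where "c = weight_D1 (\<beta> / 2) x / g x / v x"
  define h where "h y = 1 / g x * (if \<epsilon> < \<bar>x - y\<bar> then (g x - g y) * f y / \<bar>x - y\<bar> powr (1 + 1) else 0)" for y
  define N where "N y = (if \<epsilon> < \<bar>x - y\<bar> \<and> \<bar>x - y\<bar> \<le> 1 then 1 / (x - y) else 0) * (v y * f y)" for y
  have g: "g y > 0" and v: "v y > 0" for y by (simp_all add: g_def v_def weight_pos)
  have inth: "integrable lborel h"
    unfolding h_def[abs_def] using int by (intro integrable_mult_right) (simp only: g_def)
  have intN: "integrable lborel N"
  proof -
    define k where "k y = (if \<epsilon> < \<bar>x - y\<bar> \<and> \<bar>x - y\<bar> \<le> 1 then 1 / (x - y) else 0)" for y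
    have [measurable]: "k \<in> borel_measurable borel" unfolding k_def[abs_def] by measurable
    have "\<bar>k y\<bar> \<le> 1 / \<epsilon>" for y
    proof (cases "\<epsilon> < \<bar>x - y\<bar>")
      case True
      then have "1 / \<bar>x - y\<bar> \<le> 1 / \<epsilon>" using \<epsilon> by (intro divide_left_mono) auto
      then show ?thesis using \<epsilon> by (simp add: k_def abs_divide)
    qed (use \<epsilon> in \<open>simp add: k_def\<close>)
    then have "integrable lborel (\<lambda>y. k y * (weight (\<beta> / p) y * f y * indicator {x - 1..x + 1} y))"
      using integrable_mult_bounded[OF loc, of k "1 / \<epsilon>"] by simp
    also have "(\<lambda>y. k y * (weight (\<beta> / p) y * f y * indicator {x - 1..x + 1} y)) = N"
    proof
      fix y
      have "y \<in> {x - 1..x + 1}" if "\<bar>x - y\<bar> \<le> 1" using that by (auto simp: abs_le_iff)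
      then show "k y * (weight (\<beta> / p) y * f y * indicator {x - 1..x + 1} y) = N y"
        by (simp add: N_def k_def v_def)
    qed
    finally show ?thesis .
  qed
  have e: "1 / g x * trunc_commutator 1 g \<epsilon> f x - c * hilbert_annulus \<epsilon> (\<lambda>y. v y * f y) x = (LINT y|lborel. h y - c * N y)"
  proof -
    have "1 / g x * trunc_commutator 1 g \<epsilon> f x = (LINT y|lborel. h y)"
      unfolding trunc_commutator_def h_def by simp
    moreover have "c * hilbert_annulus \<epsilon> (\<lambda>y. v y * f y) x = (LINT y|lborel. c * N y)"
      unfolding hilbert_annulus_def N_def by simp
    ultimately show ?thesis
      using inth intN by (simp add: Bochner_Integration.integral_diff)
  qed
  have pw: "\<bar>h y - c * N y\<bar> \<le> sqrt_kernel (\<beta> / 2) x y * \<bar>f y\<bar>" for y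
  proof -
    have T2: "\<bar>x - y\<bar> powr (1 + 1) = (x - y)\<^sup>2" by simp
    consider "\<bar>x - y\<bar> \<le> \<epsilon>" | "\<epsilon> < \<bar>x - y\<bar>" "\<bar>x - y\<bar> \<le> 1" | "\<epsilon> < \<bar>x - y\<bar>" "\<bar>x - y\<bar> > 1" by linarith
    then show ?thesis
    proof cases
      case 1
      then have "h y - c * N y = 0" by (simp add: h_def N_def)
      then show ?thesis using sqrt_kernel_nonneg[of "\<beta> / 2" x y] by simp
    next
      case 2
      have xy: "x \<noteq> y" using 2 \<epsilon> by auto
      have "h y = (g x - g y) / (g x * (x - y)\<^sup>2) * f y"
        using 2 unfolding h_def T2 by simp
      moreover have "c * N y = weight_D1 (\<beta> / 2) x / g x / (x - y) * (v y / v x) * f y"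
        using 2 unfolding N_def c_def by (simp add: mult_ac)
      ultimately have "h y - c * N y = ((g x - g y) / (g x * (x - y)\<^sup>2) - weight_D1 (\<beta> / 2) x / g x / (x - y) * (v y / v x)) * f y"
        by (simp only: left_diff_distrib)
      also have "\<bar>\<dots>\<bar> \<le> 6 * \<bar>f y\<bar>"
        unfolding abs_mult g_def v_def
        using \<beta> p 2 xy by (intro mult_right_mono sqrt_kernel_remainder_bound) (auto simp: divide_le_eq)
      finally show ?thesis using 2 by (simp add: sqrt_kernel_def)
    next
      case 3
      have "\<bar>g x - g y\<bar> \<le> g x + g y" using g[of x] g[of y] by linarith
      then have "\<bar>g x - g y\<bar> / g x \<le> 1 + g y / g x"
        using g[of x] by (simp add: divide_simps)
      then have "\<bar>g x - g y\<bar> / g x / (x - y)\<^sup>2 * \<bar>f y\<bar> \<le> (1 + g y / g x) / (x - y)\<^sup>2 * \<bar>f y\<bar>"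
        by (intro mult_right_mono divide_right_mono) auto
      moreover have "\<bar>h y - c * N y\<bar> = \<bar>g x - g y\<bar> / g x / (x - y)\<^sup>2 * \<bar>f y\<bar>"
        using 3 g[of x] unfolding h_def N_def T2 by (simp add: abs_mult)
      ultimately show ?thesis using 3 by (simp add: sqrt_kernel_def g_def)
    qed
  qed
  have "ennreal \<bar>LINT y|lborel. h y - c * N y\<bar> \<le> (\<integral>\<^sup>+y. ennreal (sqrt_kernel (\<beta> / 2) x y * \<bar>f y\<bar>) \<partial>lborel)"
    by (rule order_trans[OF abs_LINT_le_nn_integral nn_integral_mono[OF ennreal_leI[OF pw]]])
  then show ?thesis unfolding e[symmetric] by (simp only: c_def g_def v_def)
qed

text \<open>Schur's test bounds the first term of the decomposition.  The multiplier of the Hilbert term is at most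
\<open>w\<^bsup>-1/p\<^esup>\<close>, whose \<open>p\<close>-th power cancels the weight, so the bound of \<open>hilbert_annulus\<close> on \<open>L\<^sup>p(dx)\<close> applies.\<close>

theorem sqrt_commutator_truncations_bounded:
  assumes \<beta>: "0 < \<beta>" "\<beta> < 1" and p: "p \<ge> 2"
  shows "\<exists>C. \<forall>f \<epsilon>. f \<in> borel_measurable lborel \<longrightarrow> 0 < \<epsilon> \<longrightarrow> \<epsilon> \<le> 1 \<longrightarrow>
    (\<integral>\<^sup>+x. ennreal (\<bar>f x\<bar> powr p * weight \<beta> x) \<partial>lborel) < \<infinity> \<longrightarrow>
    (AE x in lborel. integrable lborel (\<lambda>y. if \<epsilon> < \<bar>x - y\<bar>
        then (weight (\<beta> / 2) x - weight (\<beta> / 2) y) * f y / \<bar>x - y\<bar> powr (1 + 1) else 0)) \<longrightarrow>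
    (\<integral>\<^sup>+x. ennreal (\<bar>1 / weight (\<beta> / 2) x * trunc_commutator 1 (weight (\<beta> / 2)) \<epsilon> f x\<bar> powr p * weight \<beta> x) \<partial>lborel)
      \<le> ennreal C * (\<integral>\<^sup>+x. ennreal (\<bar>f x\<bar> powr p * weight \<beta> x) \<partial>lborel)"
proof -
  obtain A where A: "A > 0" "(\<integral>\<^sup>+t. ennreal (sqrt_majorant \<beta> t) \<partial>lborel) \<le> ennreal A"
    using nn_integral_finite_bound[OF sqrt_majorant_integral_finite[OF \<beta>(2)]] .
  have row: "(\<integral>\<^sup>+y. ennreal (sqrt_kernel (\<beta> / 2) x y) \<partial>lborel) \<le> ennreal A" for x
  proof -
    have "(\<integral>\<^sup>+y. ennreal (sqrt_kernel (\<beta> / 2) x y) \<partial>lborel) \<le> (\<integral>\<^sup>+y. ennreal (sqrt_majorant \<beta> (x - y)) \<partial>lborel)"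
      by (intro nn_integral_mono ennreal_leI sqrt_kernel_bounds \<beta>)
    also have "\<dots> = (\<integral>\<^sup>+t. ennreal (sqrt_majorant \<beta> t) \<partial>lborel)"
      by (rule nn_integral_reflect_shift) simp
    finally show ?thesis using A by simp
  qed
  have maj0: "sqrt_majorant \<beta> t \<ge> 0" for t by (simp add: sqrt_majorant_def)
  have col: "(\<integral>\<^sup>+x. ennreal (sqrt_kernel (\<beta> / 2) x y * weight \<beta> x) \<partial>lborel) \<le> ennreal (A * weight \<beta> y)" for y
  proof -
    have "(\<integral>\<^sup>+x. ennreal (sqrt_kernel (\<beta> / 2) x y * weight \<beta> x) \<partial>lborel)
        \<le> (\<integral>\<^sup>+x. ennreal (sqrt_majorant \<beta> (x - y)) * ennreal (weight \<beta> y) \<partial>lborel)"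
      using sqrt_kernel_bounds(2)[OF \<beta>] maj0
      by (intro nn_integral_mono) (simp add: ennreal_leI flip: ennreal_mult)
    also have "\<dots> = (\<integral>\<^sup>+x. ennreal (sqrt_majorant \<beta> (x - y)) \<partial>lborel) * ennreal (weight \<beta> y)"
      by (rule nn_integral_multc) simp
    also have "(\<integral>\<^sup>+x. ennreal (sqrt_majorant \<beta> (x - y)) \<partial>lborel) = (\<integral>\<^sup>+t. ennreal (sqrt_majorant \<beta> t) \<partial>lborel)"
      by (rule nn_integral_reflect_shift) simp
    also have "\<dots> * ennreal (weight \<beta> y) \<le> ennreal A * ennreal (weight \<beta> y)"
      using A by (intro mult_right_mono) auto
    finally show ?thesis using A by (simp add: ennreal_mult)
  qed
  define CH where "CH = 4 powr p * (2 * (p * pi) powr p + 2 * pi powr p)"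
  have CH: "CH \<ge> 0" by (simp add: CH_def)
  define v where "v = weight (\<beta> / p)"
  have v: "v x > 0" "v x powr p = weight \<beta> x" for x
    using p by (simp_all add: v_def weight_pos weight_powr)
  show ?thesis
  proof (intro exI allI impI)
    fix f :: "real \<Rightarrow> real" and \<epsilon> :: real
    assume [measurable]: "f \<in> borel_measurable lborel" and \<epsilon>: "0 < \<epsilon>" "\<epsilon> \<le> 1"
    define X where "X = (\<integral>\<^sup>+x. ennreal (\<bar>f x\<bar> powr p * weight \<beta> x) \<partial>lborel)"
    assume "(\<integral>\<^sup>+x. ennreal (\<bar>f x\<bar> powr p * weight \<beta> x) \<partial>lborel) < \<infinity>"
      and ae: "AE x in lborel. integrable lborel (\<lambda>y. if \<epsilon> < \<bar>x - y\<bar>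
        then (weight (\<beta> / 2) x - weight (\<beta> / 2) y) * f y / \<bar>x - y\<bar> powr (1 + 1) else 0)"
    then have X: "X < \<infinity>" by (simp add: X_def)
    define \<phi> where "\<phi> y = v y * f y" for y
    have [measurable]: "\<phi> \<in> borel_measurable lborel" unfolding \<phi>_def[abs_def] v_def by measurable
    have \<phi>_pow: "\<bar>\<phi> y\<bar> powr p = \<bar>f y\<bar> powr p * weight \<beta> y" for y
      using v[of y] by (simp add: \<phi>_def abs_mult powr_mult)
    have \<phi>X: "(\<integral>\<^sup>+y. ennreal (\<bar>\<phi> y\<bar> powr p) \<partial>lborel) = X"
      unfolding \<phi>_pow X_def ..
    define J where "J x = 1 / weight (\<beta> / 2) x * trunc_commutator 1 (weight (\<beta> / 2)) \<epsilon> f x" for x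
    \<comment> \<open>\<open>\<bar>g'/g\<bar> \<le> 1\<close>, so \<open>c\<close> is dominated by \<open>1 / v\<close>.\<close>
    define c where "c x = weight_D1 (\<beta> / 2) x / weight (\<beta> / 2) x / v x" for x
    define H where "H x = hilbert_annulus \<epsilon> \<phi> x" for x
    have [measurable]: "J \<in> borel_measurable lborel" "H \<in> borel_measurable lborel" "c \<in> borel_measurable lborel"
      unfolding J_def[abs_def] H_def[abs_def] c_def[abs_def] v_def weight_D1_def by measurable
    have loc: "integrable lborel (\<lambda>y. \<phi> y * indicator {x - 1..x + 1} y)" for x
      using X p unfolding \<phi>X[symmetric] by (intro Lp_imp_integrable_on_interval) auto
    have near: "(\<integral>\<^sup>+x. ennreal (\<bar>J x - c x * H x\<bar> powr p * weight \<beta> x) \<partial>lborel) \<le> ennreal (A powr (p - 1) * A) * X"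
      unfolding X_def
    proof (rule schur_test[OF _ _ _ _ A(1) _ _ _ row col])
      show "AE x in lborel. 0 \<le> \<bar>J x - c x * H x\<bar> \<and>
        ennreal \<bar>J x - c x * H x\<bar> \<le> (\<integral>\<^sup>+y. ennreal (sqrt_kernel (\<beta> / 2) x y * \<bar>f y\<bar>) \<partial>lborel)"
        using ae
      proof eventually_elim
        case (elim x)
        from sqrt_commutator_minus_hilbert_annulus[OF \<beta> p \<epsilon>(1) _ elim] loc[of x]
        show ?case unfolding J_def c_def H_def \<phi>_def v_def by simp
      qed
    qed (use A p sqrt_kernel_nonneg in auto)
    have far: "(\<integral>\<^sup>+x. ennreal (\<bar>H x\<bar> powr p) \<partial>lborel) \<le> ennreal CH * X"
      unfolding H_def CH_def \<phi>X[symmetric] by (rule hilbert_annulus_Lp[OF p _ \<epsilon>]) simp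
    have "(\<integral>\<^sup>+x. ennreal (\<bar>J x\<bar> powr p * weight \<beta> x) \<partial>lborel)
      \<le> (\<integral>\<^sup>+x. ennreal (2 powr p) * (ennreal (\<bar>J x - c x * H x\<bar> powr p * weight \<beta> x) + ennreal (\<bar>H x\<bar> powr p)) \<partial>lborel)"
    proof (rule nn_integral_mono)
      fix x
      have "\<bar>c x * H x\<bar> \<le> \<bar>H x\<bar> / v x"
      proof -
        have "\<bar>weight_D1 (\<beta> / 2) x / weight (\<beta> / 2) x\<bar> \<le> 1"
          using abs_weight_D1_le[of "\<beta> / 2" x] \<beta> by (simp add: abs_divide weight_pos)
        then have "\<bar>c x\<bar> \<le> 1 / v x"
          unfolding c_def abs_divide[of _ "v x"] abs_of_pos[OF v(1)] using v(1)[of x]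
          by (intro divide_right_mono) auto
        then have "\<bar>c x\<bar> * \<bar>H x\<bar> \<le> 1 / v x * \<bar>H x\<bar>" by (rule mult_right_mono) simp
        then show ?thesis by (simp add: abs_mult)
      qed
      then have "\<bar>J x\<bar> powr p \<le> (\<bar>J x - c x * H x\<bar> + \<bar>H x\<bar> / v x) powr p"
        using p by (intro powr_mono2) auto
      also have "\<dots> \<le> 2 powr p * (\<bar>J x - c x * H x\<bar> powr p + (\<bar>H x\<bar> / v x) powr p)"
        using p v(1)[of x] by (intro powr_sum2_le) auto
      finally have "\<bar>J x\<bar> powr p * weight \<beta> x
          \<le> 2 powr p * (\<bar>J x - c x * H x\<bar> powr p + (\<bar>H x\<bar> / v x) powr p) * weight \<beta> x"
        by (rule mult_right_mono) simp
      also have "\<dots> = 2 powr p * (\<bar>J x - c x * H x\<bar> powr p * weight \<beta> x + (\<bar>H x\<bar> / v x) powr p * weight \<beta> x)"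
        by (simp add: algebra_simps)
      also have "(\<bar>H x\<bar> / v x) powr p * weight \<beta> x = \<bar>H x\<bar> powr p"
        using v[of x] by (simp add: powr_divide)
      finally have "ennreal (\<bar>J x\<bar> powr p * weight \<beta> x) \<le> ennreal (2 powr p * (\<bar>J x - c x * H x\<bar> powr p * weight \<beta> x + \<bar>H x\<bar> powr p))"
        by (rule ennreal_leI)
      then show "ennreal (\<bar>J x\<bar> powr p * weight \<beta> x)
          \<le> ennreal (2 powr p) * (ennreal (\<bar>J x - c x * H x\<bar> powr p * weight \<beta> x) + ennreal (\<bar>H x\<bar> powr p))"
        by (simp add: ennreal_mult)
    qed
    also have "\<dots> = ennreal (2 powr p) * ((\<integral>\<^sup>+x. ennreal (\<bar>J x - c x * H x\<bar> powr p * weight \<beta> x) \<partial>lborel)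
          + (\<integral>\<^sup>+x. ennreal (\<bar>H x\<bar> powr p) \<partial>lborel))"
      by (simp add: nn_integral_cmult nn_integral_add)
    also have "\<dots> \<le> ennreal (2 powr p) * (ennreal (A powr (p - 1) * A) * X + ennreal CH * X)"
      by (intro mult_left_mono add_mono near far) auto
    also have "\<dots> = ennreal (2 powr p * (A powr (p - 1) * A + CH)) * X"
      using A CH by (simp add: ennreal_mult ennreal_plus distrib_right mult.assoc)
    finally show "(\<integral>\<^sup>+x. ennreal (\<bar>1 / weight (\<beta> / 2) x * trunc_commutator 1 (weight (\<beta> / 2)) \<epsilon> f x\<bar> powr p * weight \<beta> x) \<partial>lborel)
      \<le> ennreal (2 powr p * (A powr (p - 1) * A + CH)) * (\<integral>\<^sup>+x. ennreal (\<bar>f x\<bar> powr p * weight \<beta> x) \<partial>lborel)"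
      unfolding J_def X_def .
  qed
qed

section \<open>Test functions lie in the domain\<close>

lemma integrable_shifted_majorant:
  fixes k f :: "real \<Rightarrow> real"
  assumes [measurable]: "f \<in> borel_measurable lborel" "k \<in> borel_measurable borel"
    and fin: "(\<integral>\<^sup>+t. ennreal (k t) \<partial>lborel) < \<infinity>" and le: "\<And>y. \<bar>f y\<bar> \<le> k (x - y)"
  shows "integrable lborel f"
proof (rule integrableI_bounded)
  have "(\<integral>\<^sup>+y. ennreal (norm (f y)) \<partial>lborel) \<le> (\<integral>\<^sup>+y. ennreal (k (x - y)) \<partial>lborel)"
    using le by (intro nn_integral_mono ennreal_leI) simp
  also have "\<dots> = (\<integral>\<^sup>+t. ennreal (k t) \<partial>lborel)" by (rule nn_integral_reflect_shift) simp
  finally show "(\<integral>\<^sup>+y. ennreal (norm (f y)) \<partial>lborel) < \<infinity>" using fin by simp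
qed simp

lemma abs_powr_tail_integral_finite:
  assumes "s < -1" "\<epsilon> > 0"
  shows "(\<integral>\<^sup>+t. ennreal (if \<epsilon> < \<bar>t\<bar> then \<bar>t\<bar> powr s else 0) \<partial>lborel) < \<infinity>"
proof -
  have "(\<integral>\<^sup>+t. ennreal (if \<epsilon> < \<bar>t\<bar> then \<bar>t\<bar> powr s else 0) \<partial>lborel)
    \<le> (\<integral>\<^sup>+t. ennreal (\<epsilon> powr s) * indicator {-1..1} t + ennreal (if \<bar>t\<bar> > 1 then \<bar>t\<bar> powr s else 0) \<partial>lborel)"
  proof (rule nn_integral_mono)
    fix t :: real
    show "ennreal (if \<epsilon> < \<bar>t\<bar> then \<bar>t\<bar> powr s else 0)
        \<le> ennreal (\<epsilon> powr s) * indicator {-1..1} t + ennreal (if \<bar>t\<bar> > 1 then \<bar>t\<bar> powr s else 0)"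
    proof (cases "\<bar>t\<bar> > 1")
      case False
      have "\<bar>t\<bar> powr s \<le> \<epsilon> powr s" if "\<epsilon> < \<bar>t\<bar>"
        using that assms by (intro powr_mono2') auto
      then show ?thesis using False by (auto simp: indicator_def abs_le_iff intro: ennreal_leI)
    qed (auto simp: indicator_def)
  qed
  also have "\<dots> = ennreal (\<epsilon> powr s) * emeasure lborel {-1..1::real} + (\<integral>\<^sup>+t. ennreal (if \<bar>t\<bar> > 1 then \<bar>t\<bar> powr s else 0) \<partial>lborel)"
    by (subst nn_integral_add) (auto simp: nn_integral_cmult)
  also have "\<dots> < \<infinity>"
    using nn_integral_abs_powr_far[OF assms(1)] by (simp add: ennreal_mult_less_top)
  finally show ?thesis .
qed

text \<open>Subtracting \<open>h' x (x - y)\<close> for \<open>\<bar>x - y\<bar> \<le> 1\<close> from the numerator does not change any truncated integral, since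
this term is odd about \<open>x\<close>.  By Taylor's formula the difference is \<open>O(\<bar>x - y\<bar>\<^bsup>1 - \<alpha>\<^esup>)\<close> near \<open>x\<close>, hence integrable over
the whole line, and the limit exists by dominated convergence.\<close>

theorem frac_laplacian_exists_C2:
  fixes h h' h'' :: "real \<Rightarrow> real"
  assumes h: "\<And>x. (h has_real_derivative h' x) (at x)" and h': "\<And>x. (h' has_real_derivative h'' x) (at x)"
    and h'': "continuous_on UNIV h''" and B: "\<And>x. \<bar>h x\<bar> \<le> B" and \<alpha>: "0 < \<alpha>" "\<alpha> < 2"
  shows "frac_laplacian_exists \<alpha> h x"
proof -
  have "continuous_on UNIV h" using h by (meson DERIV_isCont continuous_at_imp_continuous_on)
  then have [measurable]: "h \<in> borel_measurable borel" by (rule borel_measurable_continuous_onI)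
  obtain M where M: "\<And>z. \<bar>x - z\<bar> \<le> 1 \<Longrightarrow> \<bar>h'' z\<bar> \<le> M"
  proof -
    have "compact (h'' ` {x - 1..x + 1})"
      by (intro compact_continuous_image continuous_on_subset[OF h'']) auto
    then obtain M where "\<forall>u \<in> h'' ` {x - 1..x + 1}. norm u \<le> M"
      using compact_imp_bounded bounded_iff by blast
    then show ?thesis by (intro that[of M]) (auto simp: abs_le_iff)
  qed
  have B0: "B \<ge> 0" using B[of 0] abs_ge_zero[of "h 0"] by linarith
  have M0: "M \<ge> 0" using M[of x] abs_ge_zero[of "h'' x"] by simp
  define F where "F = frac_integrand \<alpha> h x"
  define E where "E y = (if \<bar>x - y\<bar> \<le> 1 then h' x * (x - y) / \<bar>x - y\<bar> powr (1 + \<alpha>) else 0)" for y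
  define G where "G y = F y - E y" for y
  define ind :: "real \<Rightarrow> real \<Rightarrow> real" where "ind \<epsilon> y = indicator {y. \<epsilon> < \<bar>x - y\<bar>} y" for \<epsilon> y
  have [measurable]: "F \<in> borel_measurable borel" "E \<in> borel_measurable borel" "ind \<epsilon> \<in> borel_measurable borel" for \<epsilon>
    unfolding F_def frac_integrand_def[abs_def] E_def[abs_def] ind_def[abs_def] by measurable
  have [measurable]: "G \<in> borel_measurable borel" unfolding G_def[abs_def] by measurable
  have F_bound: "\<bar>F y\<bar> \<le> 2 * B * \<bar>x - y\<bar> powr (- 1 - \<alpha>)" for y
  proof -
    have "\<bar>h x - h y\<bar> \<le> 2 * B" using B[of x] B[of y] by linarith
    then have "\<bar>h x - h y\<bar> * \<bar>x - y\<bar> powr (- 1 - \<alpha>) \<le> 2 * B * \<bar>x - y\<bar> powr (- 1 - \<alpha>)"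
      by (rule mult_right_mono) simp
    moreover have "\<bar>x - y\<bar> powr (- 1 - \<alpha>) = 1 / \<bar>x - y\<bar> powr (1 + \<alpha>)"
      using powr_minus_divide[of "\<bar>x - y\<bar>" "1 + \<alpha>"] by simp
    ultimately show ?thesis by (simp add: F_def frac_integrand_def abs_divide)
  qed
  have intF: "integrable lborel (\<lambda>y. ind \<epsilon> y * F y)" if \<epsilon>: "\<epsilon> > 0" for \<epsilon>
  proof (rule integrable_shifted_majorant)
    have "(\<integral>\<^sup>+t. ennreal (2 * B * (if \<epsilon> < \<bar>t\<bar> then \<bar>t\<bar> powr (- 1 - \<alpha>) else 0)) \<partial>lborel)
        = ennreal (2 * B) * (\<integral>\<^sup>+t. ennreal (if \<epsilon> < \<bar>t\<bar> then \<bar>t\<bar> powr (- 1 - \<alpha>) else 0) \<partial>lborel)"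
      using B0 by (subst nn_integral_cmult[symmetric]) (auto intro!: nn_integral_cong simp flip: ennreal_mult)
    also have "\<dots> < \<infinity>"
      using abs_powr_tail_integral_finite[of "- 1 - \<alpha>" \<epsilon>] \<alpha> \<epsilon> by (simp add: ennreal_mult_less_top)
    finally show "(\<integral>\<^sup>+t. ennreal (2 * B * (if \<epsilon> < \<bar>t\<bar> then \<bar>t\<bar> powr (- 1 - \<alpha>) else 0)) \<partial>lborel) < \<infinity>" .
    show "\<bar>ind \<epsilon> y * F y\<bar> \<le> 2 * B * (if \<epsilon> < \<bar>x - y\<bar> then \<bar>x - y\<bar> powr (- 1 - \<alpha>) else 0)" for y
      using F_bound[of y] by (simp add: ind_def indicator_def)
  qed simp_all
  have intE: "integrable lborel (\<lambda>y. ind \<epsilon> y * E y)" if \<epsilon>: "\<epsilon> > 0" for \<epsilon>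
  proof (rule integrable_shifted_majorant)
    show "(\<integral>\<^sup>+t. ennreal (\<bar>h' x\<bar> * \<epsilon> powr (- 1 - \<alpha>) * indicator {-1..1::real} t) \<partial>lborel) < \<infinity>"
    proof -
      have "(\<integral>\<^sup>+t. ennreal (\<bar>h' x\<bar> * \<epsilon> powr (- 1 - \<alpha>) * indicator {-1..1::real} t) \<partial>lborel)
        = (\<integral>\<^sup>+t. ennreal (\<bar>h' x\<bar> * \<epsilon> powr (- 1 - \<alpha>)) * indicator {-1..1::real} t \<partial>lborel)"
        by (intro nn_integral_cong) (auto simp: indicator_def)
      also have "\<dots> < \<infinity>" by (simp add: nn_integral_cmult ennreal_mult_less_top)
      finally show ?thesis .
    qed
    fix y
    show "\<bar>ind \<epsilon> y * E y\<bar> \<le> \<bar>h' x\<bar> * \<epsilon> powr (- 1 - \<alpha>) * indicator {-1..1} (x - y)"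
    proof (cases "\<epsilon> < \<bar>x - y\<bar> \<and> \<bar>x - y\<bar> \<le> 1")
      case True
      have "\<bar>x - y\<bar> powr (- 1 - \<alpha>) \<le> \<epsilon> powr (- 1 - \<alpha>)"
        using True \<epsilon> \<alpha> by (intro powr_mono2') auto
      then have "\<bar>x - y\<bar> * \<bar>x - y\<bar> powr (- 1 - \<alpha>) \<le> 1 * \<epsilon> powr (- 1 - \<alpha>)"
        using True by (intro mult_mono) auto
      then have "\<bar>h' x\<bar> * (\<bar>x - y\<bar> * \<bar>x - y\<bar> powr (- 1 - \<alpha>)) \<le> \<bar>h' x\<bar> * (1 * \<epsilon> powr (- 1 - \<alpha>))"
        by (rule mult_left_mono) simp
      moreover have "\<bar>x - y\<bar> powr (- 1 - \<alpha>) = 1 / \<bar>x - y\<bar> powr (1 + \<alpha>)"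
        using powr_minus_divide[of "\<bar>x - y\<bar>" "1 + \<alpha>"] by simp
      moreover have "x - y \<in> {-1..1}" using True by (auto simp: abs_le_iff)
      ultimately show ?thesis using True by (simp add: E_def ind_def abs_mult abs_divide)
    qed (auto simp: E_def ind_def indicator_def)
  qed simp_all
  have intG: "integrable lborel G"
  proof (rule integrable_shifted_majorant)
    define k where "k t = M * (if \<bar>t\<bar> \<le> 1 then \<bar>t\<bar> powr (1 - \<alpha>) else 0) + 2 * B * (if \<bar>t\<bar> > 1 then \<bar>t\<bar> powr (- 1 - \<alpha>) else 0)" for t :: real
    show "k \<in> borel_measurable borel" unfolding k_def[abs_def] by measurable
    have "(\<integral>\<^sup>+t. ennreal (k t) \<partial>lborel) =
      (\<integral>\<^sup>+t. ennreal M * ennreal (if \<bar>t\<bar> \<le> 1 then \<bar>t\<bar> powr (1 - \<alpha>) else 0) + ennreal (2 * B) * ennreal (if \<bar>t\<bar> > 1 then \<bar>t\<bar> powr (- 1 - \<alpha>) else 0) \<partial>lborel)"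
      using M0 B0 by (intro nn_integral_cong) (simp add: k_def flip: ennreal_mult ennreal_plus)
    also have "\<dots> = ennreal M * (\<integral>\<^sup>+t. ennreal (if \<bar>t\<bar> \<le> 1 then \<bar>t\<bar> powr (1 - \<alpha>) else 0) \<partial>lborel)
        + ennreal (2 * B) * (\<integral>\<^sup>+t. ennreal (if \<bar>t\<bar> > 1 then \<bar>t\<bar> powr (- 1 - \<alpha>) else 0) \<partial>lborel)"
      by (subst nn_integral_add) (auto simp: nn_integral_cmult)
    also have "\<dots> < \<infinity>"
      using nn_integral_abs_powr_near[of "1 - \<alpha>"] nn_integral_abs_powr_far[of "- 1 - \<alpha>"] \<alpha>
      by (simp add: ennreal_mult_less_top)
    finally show "(\<integral>\<^sup>+t. ennreal (k t) \<partial>lborel) < \<infinity>" .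
    fix y
    show "\<bar>G y\<bar> \<le> k (x - y)"
    proof (cases "\<bar>x - y\<bar> \<le> 1")
      case True
      define T where "T = \<bar>x - y\<bar>"
      have GT: "G y = (h x - h y - h' x * (x - y)) / T powr (1 + \<alpha>)"
        using True by (simp add: G_def F_def E_def frac_integrand_def T_def diff_divide_distrib)
      have "\<bar>h x - h y - h' x * (x - y)\<bar> \<le> M * T\<^sup>2"
        using Taylor_remainder_le[OF h h' M True] by (simp add: T_def)
      then have "\<bar>G y\<bar> \<le> M * T\<^sup>2 / T powr (1 + \<alpha>)"
        unfolding GT abs_divide by (simp add: divide_right_mono)
      also have "\<dots> = M * T powr (1 - \<alpha>)"
      proof (cases "T = 0")
        case False
        then have "T > 0" by (simp add: T_def)
        then have "T\<^sup>2 = T powr (1 - \<alpha>) * T powr (1 + \<alpha>)" by (simp flip: powr_add)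
        then show ?thesis using \<open>T > 0\<close> by simp
      qed simp
      finally show ?thesis using True by (simp add: k_def T_def)
    next
      case False
      then show ?thesis using F_bound[of y] by (simp add: G_def E_def k_def)
    qed
  qed simp
  \<comment> \<open>Reflection at \<open>x\<close> changes the sign of the integrand.\<close>
  have E_zero: "(LINT y|lborel. ind \<epsilon> y * E y) = 0" for \<epsilon>
  proof -
    have "(LINT y|lborel. ind \<epsilon> y * E y) = (LINT y|lborel. ind \<epsilon> (2 * x + (-1) * y) * E (2 * x + (-1) * y))"
      using lborel_integral_real_affine[of "-1" "\<lambda>y. ind \<epsilon> y * E y" "2 * x"] by simp
    also have "\<dots> = (LINT y|lborel. - (ind \<epsilon> y * E y))"
    proof (rule Bochner_Integration.integral_cong[OF refl])
      fix y
      have r: "x - (2 * x + (-1) * y) = - (x - y)" by simp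
      show "ind \<epsilon> (2 * x + (-1) * y) * E (2 * x + (-1) * y) = - (ind \<epsilon> y * E y)"
        unfolding ind_def E_def indicator_def mem_Collect_eq r abs_minus_cancel mult_minus_right minus_divide_left[symmetric]
        by simp
    qed
    also have "\<dots> = - (LINT y|lborel. ind \<epsilon> y * E y)" by simp
    finally show ?thesis by simp
  qed
  have trunc: "frac_trunc \<alpha> h x \<epsilon> = frac_const \<alpha> * (LINT y|lborel. ind \<epsilon> y * G y)" if \<epsilon>: "\<epsilon> > 0" for \<epsilon>
  proof -
    have "(LINT y:{y. \<epsilon> < \<bar>x - y\<bar>}|lebesgue. frac_integrand \<alpha> h x y) = (LINT y|lebesgue. ind \<epsilon> y * F y)"
      by (simp add: set_lebesgue_integral_def ind_def F_def)
    also have "\<dots> = (LINT y|lborel. ind \<epsilon> y * F y)" by (rule integral_completion) simp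
    also have "\<dots> = (LINT y|lborel. ind \<epsilon> y * F y) - (LINT y|lborel. ind \<epsilon> y * E y)"
      by (simp add: E_zero)
    also have "\<dots> = (LINT y|lborel. ind \<epsilon> y * F y - ind \<epsilon> y * E y)"
      using intF[OF \<epsilon>] intE[OF \<epsilon>] by (rule Bochner_Integration.integral_diff[symmetric])
    also have "\<dots> = (LINT y|lborel. ind \<epsilon> y * G y)" by (simp add: G_def right_diff_distrib)
    finally show ?thesis by (simp add: frac_trunc_def)
  qed
  have "(frac_trunc \<alpha> h x \<longlongrightarrow> frac_const \<alpha> * (LINT y|lborel. G y)) (at_right 0)"
  proof (rule tendsto_at_right_sequentially[of 0 1])
    fix S :: "nat \<Rightarrow> real"
    assume S: "\<And>n. 0 < S n" "S \<longlonglongrightarrow> 0"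
    have "(\<lambda>n. LINT y|lborel. ind (S n) y * G y) \<longlonglongrightarrow> (LINT y|lborel. G y)"
    proof (rule integral_dominated_convergence)
      show "integrable lborel (\<lambda>y. \<bar>G y\<bar>)" using intG by simp
      show "AE y in lborel. norm (ind (S n) y * G y) \<le> \<bar>G y\<bar>" for n
        by (auto simp: ind_def indicator_def)
      show "AE y in lborel. (\<lambda>n. ind (S n) y * G y) \<longlonglongrightarrow> G y"
      proof (rule AE_I2)
        fix y
        show "(\<lambda>n. ind (S n) y * G y) \<longlonglongrightarrow> G y"
        proof (cases "y = x")
          case True
          then have "G y = 0" by (simp add: G_def F_def E_def frac_integrand_def)
          then show ?thesis by simp
        next
          case False
          then have "\<forall>\<^sub>F n in sequentially. S n < \<bar>x - y\<bar>"
            using S(2) by (intro order_tendstoD) auto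
          then have "\<forall>\<^sub>F n in sequentially. ind (S n) y * G y = G y"
            by eventually_elim (simp add: ind_def)
          then show ?thesis by (rule tendsto_eventually)
        qed
      qed
    qed simp_all
    then show "(\<lambda>n. frac_trunc \<alpha> h x (S n)) \<longlonglongrightarrow> frac_const \<alpha> * (LINT y|lborel. G y)"
      unfolding trunc[OF S(1)] by (intro tendsto_intros)
  qed simp
  moreover have "set_integrable lebesgue {y. \<epsilon> < \<bar>x - y\<bar>} (frac_integrand \<alpha> h x)" if "\<epsilon> > 0" for \<epsilon>
  proof -
    have "integrable lebesgue (\<lambda>y. ind \<epsilon> y * F y)"
      using intF[OF that] by (subst integrable_completion) simp_all
    then show ?thesis by (simp add: set_integrable_def ind_def F_def)
  qed
  ultimately show ?thesis unfolding frac_laplacian_exists_def by blast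
qed

lemma test_functions_subset_commutator_domain:
  fixes g g' g'' :: "real \<Rightarrow> real"
  assumes g: "\<And>x. (g has_real_derivative g' x) (at x)" and g': "\<And>x. (g' has_real_derivative g'' x) (at x)"
    and g'': "continuous_on UNIV g''" and \<alpha>: "0 < \<alpha>" "\<alpha> < 2"
  shows "test_functions \<subseteq> commutator_domain \<alpha> g"
proof
  fix f assume "f \<in> test_functions"
  then obtain R where diff: "\<And>n x. (deriv ^^ n) f differentiable (at x)" and R: "\<And>x. R < \<bar>x\<bar> \<Longrightarrow> f x = 0"
    by (auto simp: test_functions_def)
  have d: "((deriv ^^ n) f has_real_derivative (deriv ^^ Suc n) f x) (at x)" for n x
    using diff[of n x] by (simp add: DERIV_deriv_iff_real_differentiable)
  have f: "\<And>x. (f has_real_derivative deriv f x) (at x)"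
    and f': "\<And>x. (deriv f has_real_derivative deriv (deriv f) x) (at x)"
    and f'': "continuous_on UNIV (deriv (deriv f))"
    using d[of 0] d[of 1] d[of 2]
    by (auto simp: numeral_2_eq_2 intro!: continuous_at_imp_continuous_on DERIV_isCont)
  have supp_bounded: "\<exists>B. \<forall>x. \<bar>k x\<bar> \<le> B" if "continuous_on UNIV k" "\<And>x. R < \<bar>x\<bar> \<Longrightarrow> k x = 0" for k :: "real \<Rightarrow> real"
  proof -
    have "compact (k ` {- R..R})"
      by (intro compact_continuous_image continuous_on_subset[OF that(1)]) auto
    then obtain B where B: "\<forall>u \<in> k ` {- R..R}. norm u \<le> B"
      using compact_imp_bounded bounded_iff by blast
    have "\<bar>k x\<bar> \<le> max B 0" for x
      using B that(2)[of x] by (cases "R < \<bar>x\<bar>") (auto simp: abs_le_iff not_less le_max_iff_disj)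
    then show ?thesis by blast
  qed
  have cf: "continuous_on UNIV f" using f by (meson DERIV_isCont continuous_at_imp_continuous_on)
  have cg: "continuous_on UNIV g" using g by (meson DERIV_isCont continuous_at_imp_continuous_on)
  have cf': "continuous_on UNIV (deriv f)" using f' by (meson DERIV_isCont continuous_at_imp_continuous_on)
  have cg': "continuous_on UNIV g'" using g' by (meson DERIV_isCont continuous_at_imp_continuous_on)
  obtain B1 where B1: "\<And>x. \<bar>f x\<bar> \<le> B1" using supp_bounded[OF cf R] by blast
  obtain B2 where B2: "\<And>x. \<bar>g x * f x\<bar> \<le> B2"
    using supp_bounded[of "\<lambda>x. g x * f x"] R cf cg by (auto intro: continuous_on_mult)
  have "frac_laplacian_exists \<alpha> f x" for x
    by (rule frac_laplacian_exists_C2[OF f f' f'' B1 \<alpha>])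
  moreover have "frac_laplacian_exists \<alpha> (\<lambda>y. g y * f y) x" for x
  proof (rule frac_laplacian_exists_C2[OF _ _ _ B2 \<alpha>])
    show "((\<lambda>y. g y * f y) has_real_derivative g' x * f x + g x * deriv f x) (at x)" for x
      using DERIV_mult[OF g f] by (simp add: mult.commute)
    show "((\<lambda>x. g' x * f x + g x * deriv f x) has_real_derivative
        (g'' x * f x + g' x * deriv f x) + (g' x * deriv f x + g x * deriv (deriv f) x)) (at x)" for x
      using DERIV_add[OF DERIV_mult[OF g' f] DERIV_mult[OF g f']] by (simp add: mult.commute)
    show "continuous_on UNIV (\<lambda>x. (g'' x * f x + g' x * deriv f x) + (g' x * deriv f x + g x * deriv (deriv f) x))"
      by (intro continuous_intros cf cg cf' cg' f'' g'')
  qed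
  ultimately show "f \<in> commutator_domain \<alpha> g" by (simp add: commutator_domain_def)
qed

lemma continuous_weight_D2: "continuous_on UNIV (weight_D2 \<gamma>)"
proof -
  have ne: "1 + x\<^sup>2 \<noteq> 0" for x :: real using zero_le_power2[of x] by linarith
  show ?thesis
    unfolding weight_D2_def[abs_def] weight_def using ne by (intro continuous_intros) auto
qed

section \<open>From truncations to principal values\<close>

lemma borel_measurable_lebesgue_AE_eq:
  fixes f u :: "real \<Rightarrow> real"
  assumes u: "u \<in> borel_measurable lborel" and ae: "AE x in lborel. f x = u x"
  shows "f \<in> borel_measurable lebesgue"
proof (rule measurableI)
  fix S :: "real set" assume S: "S \<in> sets borel"
  show "f -` S \<inter> space lebesgue \<in> sets lebesgue"
  proof (rule completion.in_sets_AE)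
    show "AE x in lebesgue. x \<in> u -` S \<longleftrightarrow> x \<in> f -` S \<inter> space lebesgue"
      using AE_completion[OF ae] by eventually_elim simp
    show "u -` S \<in> sets lebesgue"
      using measurable_sets[OF measurable_completion[OF u] S] by simp
  qed simp
qed simp

text \<open>Where both principal values are meaningful, the terms with \<open>g x f x\<close> cancel.  The function \<open>f\<close> then occurs only under
the integral, so it may be replaced by a Borel function \<open>f'\<close> that agrees with it almost everywhere.  This makes the
truncated commutator a Borel function of \<open>x\<close>.\<close>

lemma trunc_difference_eq:
  fixes f f' g :: "real \<Rightarrow> real"
  assumes [measurable]: "f' \<in> borel_measurable lborel" "g \<in> borel_measurable borel" "f \<in> borel_measurable lebesgue"
    and ae: "AE y in lborel. f y = f' y"
    and i1: "set_integrable lebesgue {y. \<epsilon> < \<bar>x - y\<bar>} (frac_integrand \<alpha> (\<lambda>y. g y * f y) x)"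
    and i2: "set_integrable lebesgue {y. \<epsilon> < \<bar>x - y\<bar>} (frac_integrand \<alpha> f x)"
  shows "integrable lborel (\<lambda>y. if \<epsilon> < \<bar>x - y\<bar> then (g x - g y) * f' y / \<bar>x - y\<bar> powr (1 + \<alpha>) else 0)"
    and "frac_trunc \<alpha> (\<lambda>y. g y * f y) x \<epsilon> - g x * frac_trunc \<alpha> f x \<epsilon>
           = frac_const \<alpha> * trunc_commutator \<alpha> g \<epsilon> f' x"
proof -
  define A where "A = {y. \<epsilon> < \<bar>x - y\<bar>}"
  define k where "k u y = (if \<epsilon> < \<bar>x - y\<bar> then (g x - g y) * u y / \<bar>x - y\<bar> powr (1 + \<alpha>) else 0)" for u :: "real \<Rightarrow> real" and y
  have eq: "indicator A y * frac_integrand \<alpha> (\<lambda>y. g y * f y) x y - g x * (indicator A y * frac_integrand \<alpha> f x y) = k f y" for y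
  proof -
    have "(u * a - v * b) / d - u * ((a - b) / d) = (u - v) * b / d" for u v a b d :: real
      by (cases "d = 0") (simp_all add: field_simps)
    then show ?thesis by (simp add: A_def k_def frac_integrand_def indicator_def)
  qed
  have j1: "integrable lebesgue (\<lambda>y. indicator A y * frac_integrand \<alpha> (\<lambda>y. g y * f y) x y)"
    and j2: "integrable lebesgue (\<lambda>y. indicator A y * frac_integrand \<alpha> f x y)"
    using i1 i2 by (simp_all add: set_integrable_def A_def)
  have ik: "integrable lebesgue (k f)"
    using Bochner_Integration.integrable_diff[OF j1 integrable_mult_right[OF j2, of "g x"]] by (simp add: eq)
  have [measurable]: "k f' \<in> borel_measurable lborel" unfolding k_def[abs_def] by measurable
  have kf': "k f' \<in> borel_measurable lebesgue" by (rule measurable_completion) simp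
  have ae': "AE y in lebesgue. k f y = k f' y"
    using AE_completion[OF ae] by eventually_elim (simp add: k_def)
  have "integrable lebesgue (k f')"
    using ik integrable_cong_AE[OF borel_measurable_integrable[OF ik] kf' ae'] by simp
  then have "integrable lborel (k f')" by (simp add: integrable_completion)
  then show "integrable lborel (\<lambda>y. if \<epsilon> < \<bar>x - y\<bar> then (g x - g y) * f' y / \<bar>x - y\<bar> powr (1 + \<alpha>) else 0)"
    by (simp only: k_def[abs_def])
  have "frac_trunc \<alpha> (\<lambda>y. g y * f y) x \<epsilon> - g x * frac_trunc \<alpha> f x \<epsilon> =
     frac_const \<alpha> * ((LINT y|lebesgue. indicator A y * frac_integrand \<alpha> (\<lambda>y. g y * f y) x y)
       - g x * (LINT y|lebesgue. indicator A y * frac_integrand \<alpha> f x y))"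
    by (simp add: frac_trunc_def set_lebesgue_integral_def A_def algebra_simps)
  also have "(LINT y|lebesgue. indicator A y * frac_integrand \<alpha> (\<lambda>y. g y * f y) x y)
       - g x * (LINT y|lebesgue. indicator A y * frac_integrand \<alpha> f x y) = (LINT y|lebesgue. k f y)"
    using j1 j2 by (simp flip: eq)
  also have "\<dots> = (LINT y|lebesgue. k f' y)"
    by (rule integral_cong_AE[OF borel_measurable_integrable[OF ik] kf' ae'])
  also have "\<dots> = (LINT y|lborel. k f' y)" by (rule integral_completion) simp
  also have "\<dots> = trunc_commutator \<alpha> g \<epsilon> f' x" by (simp add: trunc_commutator_def k_def)
  finally show "frac_trunc \<alpha> (\<lambda>y. g y * f y) x \<epsilon> - g x * frac_trunc \<alpha> f x \<epsilon>
           = frac_const \<alpha> * trunc_commutator \<alpha> g \<epsilon> f' x" .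
qed

text \<open>Almost everywhere the commutator is the limit of its truncations at \<open>\<epsilon> = 1/(n+1)\<close>, so Fatou's lemma transfers a uniform
bound.  The limit of the truncations is a Borel function, which provides the measurability of the commutator.\<close>

theorem bounded_on_Lp_if_truncations_bounded:
  fixes g w :: "real \<Rightarrow> real"
  assumes p: "p \<ge> 1" and [measurable]: "g \<in> borel_measurable borel" "w \<in> borel_measurable borel"
    and w: "\<And>x. w x \<ge> 0"
    and test: "test_functions \<subseteq> commutator_domain \<alpha> g"
    and bound: "\<And>f \<epsilon>. f \<in> borel_measurable lborel \<Longrightarrow> 0 < \<epsilon> \<Longrightarrow> \<epsilon> \<le> 1 \<Longrightarrow>
      (\<integral>\<^sup>+x. ennreal (\<bar>f x\<bar> powr p * w x) \<partial>lborel) < \<infinity> \<Longrightarrow>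
      (AE x in lborel. integrable lborel (\<lambda>y. if \<epsilon> < \<bar>x - y\<bar> then (g x - g y) * f y / \<bar>x - y\<bar> powr (1 + \<alpha>) else 0)) \<Longrightarrow>
      (\<integral>\<^sup>+x. ennreal (\<bar>1 / g x * trunc_commutator \<alpha> g \<epsilon> f x\<bar> powr p * w x) \<partial>lborel)
        \<le> ennreal C * (\<integral>\<^sup>+x. ennreal (\<bar>f x\<bar> powr p * w x) \<partial>lborel)"
  shows "bounded_on_Lp (commutator_domain \<alpha> g) (\<lambda>f x. 1 / g x * commutator \<alpha> g f x) p w"
proof -
  \<comment> \<open>\<open>C\<close> may be negative, in which case \<open>ennreal C = 0\<close>.\<close>
  define D where "D = \<bar>frac_const \<alpha>\<bar> powr p * max C 0"
  have D: "D \<ge> 0" by (simp add: D_def)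
  have main: "(\<lambda>x. 1 / g x * commutator \<alpha> g f x) \<in> weighted_Lp p w \<and>
      Lp_norm p w (\<lambda>x. 1 / g x * commutator \<alpha> g f x) \<le> D powr (1 / p) * Lp_norm p w f"
    if f: "f \<in> commutator_domain \<alpha> g \<inter> weighted_Lp p w" for f
  proof -
    have fm [measurable]: "f \<in> borel_measurable lebesgue" and fint: "integrable lebesgue (\<lambda>x. \<bar>f x\<bar> powr p * w x)"
      using f by (auto simp: weighted_Lp_def)
    obtain f' where f'm [measurable]: "f' \<in> borel_measurable lborel" and ff': "AE x in lborel. f x = f' x"
      using completion_ex_borel_measurable_real[OF fm] by blast
    define X where "X = (\<integral>\<^sup>+x. ennreal (\<bar>f' x\<bar> powr p * w x) \<partial>lborel)"
    have X: "X = ennreal (LINT x|lebesgue. \<bar>f x\<bar> powr p * w x)"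
    proof -
      have "ennreal (LINT x|lebesgue. \<bar>f x\<bar> powr p * w x) = (\<integral>\<^sup>+x. ennreal (\<bar>f x\<bar> powr p * w x) \<partial>lebesgue)"
        using w by (intro nn_integral_eq_integral[symmetric] fint) auto
      also have "\<dots> = (\<integral>\<^sup>+x. ennreal (\<bar>f x\<bar> powr p * w x) \<partial>lborel)"
        by (rule nn_integral_completion)
      also have "\<dots> = X"
        unfolding X_def
      proof (rule nn_integral_cong_AE)
        show "AE x in lborel. ennreal (\<bar>f x\<bar> powr p * w x) = ennreal (\<bar>f' x\<bar> powr p * w x)"
          using ff' by eventually_elim simp
      qed
      finally show ?thesis ..
    qed
    define good where "good x \<longleftrightarrow> frac_laplacian_exists \<alpha> (\<lambda>y. g y * f y) x \<and> frac_laplacian_exists \<alpha> f x" for x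
    have good: "AE x in lborel. good x"
      using f unfolding commutator_domain_def good_def by (simp add: AE_completion_iff)
    note diff = trunc_difference_eq[OF f'm _ fm ff']
    have int: "integrable lborel (\<lambda>y. if \<epsilon> < \<bar>x - y\<bar> then (g x - g y) * f' y / \<bar>x - y\<bar> powr (1 + \<alpha>) else 0)"
      and tr: "frac_trunc \<alpha> (\<lambda>y. g y * f y) x \<epsilon> - g x * frac_trunc \<alpha> f x \<epsilon> = frac_const \<alpha> * trunc_commutator \<alpha> g \<epsilon> f' x"
      if "good x" "\<epsilon> > 0" for x \<epsilon>
      using that unfolding good_def frac_laplacian_exists_def by (auto intro!: diff)
    define T where "T n x = frac_const \<alpha> * (1 / g x * trunc_commutator \<alpha> g (1 / real (Suc n)) f' x)" for n x
    have [measurable]: "T n \<in> borel_measurable lborel" for n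
      unfolding T_def[abs_def] by measurable
    have T_lim: "(\<lambda>n. T n x) \<longlonglongrightarrow> 1 / g x * commutator \<alpha> g f x" if x: "good x" for x
    proof -
      obtain L1 L2 where L: "(frac_trunc \<alpha> (\<lambda>y. g y * f y) x \<longlongrightarrow> L1) (at_right 0)" "(frac_trunc \<alpha> f x \<longlongrightarrow> L2) (at_right 0)"
        using x by (auto simp: good_def frac_laplacian_exists_def)
      have "frac_laplacian \<alpha> (\<lambda>y. g y * f y) x = L1" "frac_laplacian \<alpha> f x = L2"
        using L by (auto simp: frac_laplacian_def intro!: tendsto_Lim)
      then have c: "commutator \<alpha> g f x = L1 - g x * L2" by (simp add: commutator_def)
      have lim: "filterlim (\<lambda>n. 1 / real (Suc n)) (at_right 0) sequentially"
        unfolding filterlim_at using LIMSEQ_Suc[OF lim_1_over_n[where 'a = real]] by (auto intro!: always_eventually)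
      have "(\<lambda>n. 1 / g x * (frac_trunc \<alpha> (\<lambda>y. g y * f y) x (1 / real (Suc n)) - g x * frac_trunc \<alpha> f x (1 / real (Suc n))))
          \<longlonglongrightarrow> 1 / g x * (L1 - g x * L2)"
        by (intro tendsto_mult tendsto_diff tendsto_const filterlim_compose[OF L(1) lim] filterlim_compose[OF L(2) lim])
      moreover have "1 / g x * (frac_trunc \<alpha> (\<lambda>y. g y * f y) x (1 / real (Suc n)) - g x * frac_trunc \<alpha> f x (1 / real (Suc n))) = T n x" for n
        by (subst tr[OF x]) (simp_all add: T_def)
      ultimately show ?thesis unfolding c by simp
    qed
    define U where "U x = lim (\<lambda>n. T n x)" for x
    have [measurable]: "U \<in> borel_measurable lborel" unfolding U_def[abs_def] by measurable
    have TU: "AE x in lborel. 1 / g x * commutator \<alpha> g f x = U x"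
      using good by eventually_elim (simp add: U_def limI[OF T_lim])
    have Tm: "(\<lambda>x. 1 / g x * commutator \<alpha> g f x) \<in> borel_measurable lebesgue"
      by (rule borel_measurable_lebesgue_AE_eq[OF _ TU]) simp
    define Z where "Z x = \<bar>1 / g x * commutator \<alpha> g f x\<bar> powr p * w x" for x
    have Zm: "Z \<in> borel_measurable lebesgue"
    proof -
      have "w \<in> borel_measurable lebesgue" by (rule measurable_completion) simp
      then show ?thesis
        unfolding Z_def[abs_def] using Tm by measurable
    qed
    have T_bound: "(\<integral>\<^sup>+x. ennreal (\<bar>T n x\<bar> powr p * w x) \<partial>lborel) \<le> ennreal D * X" for n
    proof -
      have "(\<integral>\<^sup>+x. ennreal (\<bar>T n x\<bar> powr p * w x) \<partial>lborel) =
        (\<integral>\<^sup>+x. ennreal (\<bar>frac_const \<alpha>\<bar> powr p) * ennreal (\<bar>1 / g x * trunc_commutator \<alpha> g (1 / real (Suc n)) f' x\<bar> powr p * w x) \<partial>lborel)"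
      proof (rule nn_integral_cong)
        fix x
        have "\<bar>frac_const \<alpha> * Y\<bar> powr p * w x = \<bar>frac_const \<alpha>\<bar> powr p * (\<bar>Y\<bar> powr p * w x)" for Y
          by (simp only: abs_mult powr_mult mult.assoc)
        then show "ennreal (\<bar>T n x\<bar> powr p * w x) =
            ennreal (\<bar>frac_const \<alpha>\<bar> powr p) * ennreal (\<bar>1 / g x * trunc_commutator \<alpha> g (1 / real (Suc n)) f' x\<bar> powr p * w x)"
          using w[of x] by (simp only: T_def ennreal_mult powr_ge_zero mult_nonneg_nonneg)
      qed
      also have "\<dots> = ennreal (\<bar>frac_const \<alpha>\<bar> powr p) *
          (\<integral>\<^sup>+x. ennreal (\<bar>1 / g x * trunc_commutator \<alpha> g (1 / real (Suc n)) f' x\<bar> powr p * w x) \<partial>lborel)"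
        by (rule nn_integral_cmult) simp
      also have "\<dots> \<le> ennreal (\<bar>frac_const \<alpha>\<bar> powr p) * (ennreal C * X)"
      proof (rule mult_left_mono)
        show "(\<integral>\<^sup>+x. ennreal (\<bar>1 / g x * trunc_commutator \<alpha> g (1 / real (Suc n)) f' x\<bar> powr p * w x) \<partial>lborel) \<le> ennreal C * X"
          unfolding X_def
        proof (rule bound)
          show "(\<integral>\<^sup>+x. ennreal (\<bar>f' x\<bar> powr p * w x) \<partial>lborel) < \<infinity>"
            using X by (simp add: X_def)
          show "AE x in lborel. integrable lborel
            (\<lambda>y. if 1 / real (Suc n) < \<bar>x - y\<bar> then (g x - g y) * f' y / \<bar>x - y\<bar> powr (1 + \<alpha>) else 0)"
            using good by eventually_elim (rule int, simp_all)
        qed simp_all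
      qed simp
      also have "\<dots> \<le> ennreal (\<bar>frac_const \<alpha>\<bar> powr p) * (ennreal (max C 0) * X)"
        by (intro mult_left_mono mult_right_mono ennreal_leI) auto
      also have "\<dots> = ennreal D * X" by (simp add: D_def ennreal_mult mult.assoc)
      finally show ?thesis .
    qed
    have "(\<integral>\<^sup>+x. ennreal (Z x) \<partial>lebesgue) = (\<integral>\<^sup>+x. ennreal (Z x) \<partial>lborel)"
      by (rule nn_integral_completion)
    also have "\<dots> = (\<integral>\<^sup>+x. liminf (\<lambda>n. ennreal (\<bar>T n x\<bar> powr p * w x)) \<partial>lborel)"
    proof (rule nn_integral_cong_AE, use good in eventually_elim)
      fix x assume x: "good x"
      have "(\<lambda>n. ennreal (\<bar>T n x\<bar> powr p * w x)) \<longlonglongrightarrow> ennreal (Z x)"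
        unfolding Z_def using p
        by (intro tendsto_ennrealI tendsto_mult tendsto_const tendsto_powr' tendsto_rabs T_lim x) auto
      then show "ennreal (Z x) = liminf (\<lambda>n. ennreal (\<bar>T n x\<bar> powr p * w x))"
        by (intro lim_imp_Liminf[symmetric]) simp_all
    qed
    also have "\<dots> \<le> liminf (\<lambda>n. \<integral>\<^sup>+x. ennreal (\<bar>T n x\<bar> powr p * w x) \<partial>lborel)"
      by (rule nn_integral_liminf) simp
    also have "\<dots> \<le> ennreal D * X"
      using T_bound by (intro Liminf_le) auto
    finally have Z_le: "(\<integral>\<^sup>+x. ennreal (Z x) \<partial>lebesgue) \<le> ennreal D * X" .
    have Z0: "Z x \<ge> 0" for x using w by (simp add: Z_def)
    have Zint: "integrable lebesgue Z"
    proof (rule integrableI_bounded)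
      have "(\<integral>\<^sup>+x. ennreal (norm (Z x)) \<partial>lebesgue) \<le> ennreal D * X" using Z_le Z0 by simp
      also have "\<dots> < \<infinity>" unfolding X by (simp add: ennreal_mult_less_top)
      finally show "(\<integral>\<^sup>+x. ennreal (norm (Z x)) \<partial>lebesgue) < \<infinity>" .
    qed (rule Zm)
    have I0: "(LINT x|lebesgue. \<bar>f x\<bar> powr p * w x) \<ge> 0" using w by simp
    have "ennreal (LINT x|lebesgue. Z x) \<le> ennreal (D * (LINT x|lebesgue. \<bar>f x\<bar> powr p * w x))"
      using Z_le Z0 D I0 unfolding X by (simp add: nn_integral_eq_integral[OF Zint] ennreal_mult)
    then have "(LINT x|lebesgue. Z x) \<le> D * (LINT x|lebesgue. \<bar>f x\<bar> powr p * w x)"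
      using D I0 by (subst (asm) ennreal_le_iff) auto
    then have "(LINT x|lebesgue. Z x) powr (1 / p) \<le> (D * (LINT x|lebesgue. \<bar>f x\<bar> powr p * w x)) powr (1 / p)"
      using p Z0 by (intro powr_mono2) auto
    then have "Lp_norm p w (\<lambda>x. 1 / g x * commutator \<alpha> g f x) \<le> D powr (1 / p) * Lp_norm p w f"
      by (simp add: Lp_norm_def Z_def powr_mult)
    moreover have "(\<lambda>x. 1 / g x * commutator \<alpha> g f x) \<in> weighted_Lp p w"
      using Tm Zint by (simp add: weighted_Lp_def Z_def[abs_def])
    ultimately show ?thesis by blast
  qed
  show ?thesis
    unfolding bounded_on_Lp_def using test main by blast
qed

theorem lemma3p2:
  fixes \<beta> :: real
  assumes "0 < \<beta>" and "\<beta> < 1"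
  shows "(\<forall>p::real. 2 \<le> p \<longrightarrow> 3 / 2 - \<beta> * (1 - 1 / p) > 1 \<longrightarrow>
            bounded_on_Lp (commutator_domain (1 / 2) (weight \<beta>))
              (\<lambda>f x. 1 / weight \<beta> x * commutator (1 / 2) (weight \<beta>) f x)
              p (weight \<beta>)) \<and>
         (\<forall>p::real. 2 \<le> p \<longrightarrow>
            bounded_on_Lp (commutator_domain 1 (\<lambda>x. sqrt (weight \<beta> x)))
              (\<lambda>f x. 1 / sqrt (weight \<beta> x) * commutator 1 (\<lambda>x. sqrt (weight \<beta> x)) f x)
              p (weight \<beta>))"
proof (intro conjI allI impI)
  fix p :: real assume p: "2 \<le> p"
  obtain C where C: "\<And>f \<epsilon>. f \<in> borel_measurable lborel \<Longrightarrow>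
    (\<integral>\<^sup>+x. ennreal (\<bar>1 / weight \<beta> x * trunc_commutator (1/2) (weight \<beta>) \<epsilon> f x\<bar> powr p * weight \<beta> x) \<partial>lborel)
      \<le> ennreal C * (\<integral>\<^sup>+x. ennreal (\<bar>f x\<bar> powr p * weight \<beta> x) \<partial>lborel)"
    using half_commutator_truncations_bounded[OF assms, of p] p by auto
  show "bounded_on_Lp (commutator_domain (1 / 2) (weight \<beta>))
          (\<lambda>f x. 1 / weight \<beta> x * commutator (1 / 2) (weight \<beta>) f x) p (weight \<beta>)"
  proof (rule bounded_on_Lp_if_truncations_bounded)
    show "test_functions \<subseteq> commutator_domain (1 / 2) (weight \<beta>)"
      by (rule test_functions_subset_commutator_domain[OF weight_has_derivative weight_D1_has_derivative continuous_weight_D2]) simp_all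
  qed (use p C in simp_all)
next
  fix p :: real assume p: "2 \<le> p"
  obtain C where C: "\<And>f \<epsilon>. f \<in> borel_measurable lborel \<Longrightarrow> 0 < \<epsilon> \<Longrightarrow> \<epsilon> \<le> 1 \<Longrightarrow>
    (\<integral>\<^sup>+x. ennreal (\<bar>f x\<bar> powr p * weight \<beta> x) \<partial>lborel) < \<infinity> \<Longrightarrow>
    (AE x in lborel. integrable lborel (\<lambda>y. if \<epsilon> < \<bar>x - y\<bar>
        then (weight (\<beta> / 2) x - weight (\<beta> / 2) y) * f y / \<bar>x - y\<bar> powr (1 + 1) else 0)) \<Longrightarrow>
    (\<integral>\<^sup>+x. ennreal (\<bar>1 / weight (\<beta> / 2) x * trunc_commutator 1 (weight (\<beta> / 2)) \<epsilon> f x\<bar> powr p * weight \<beta> x) \<partial>lborel)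
      \<le> ennreal C * (\<integral>\<^sup>+x. ennreal (\<bar>f x\<bar> powr p * weight \<beta> x) \<partial>lborel)"
    using sqrt_commutator_truncations_bounded[OF assms p] by blast
  have "bounded_on_Lp (commutator_domain 1 (weight (\<beta> / 2)))
          (\<lambda>f x. 1 / weight (\<beta> / 2) x * commutator 1 (weight (\<beta> / 2)) f x) p (weight \<beta>)"
  proof (rule bounded_on_Lp_if_truncations_bounded[OF _ _ _ _ _ C])
    show "test_functions \<subseteq> commutator_domain 1 (weight (\<beta> / 2))"
      by (rule test_functions_subset_commutator_domain[OF weight_has_derivative weight_D1_has_derivative continuous_weight_D2]) simp_all
  qed (use p in simp_all)
  then show "bounded_on_Lp (commutator_domain 1 (\<lambda>x. sqrt (weight \<beta> x)))
          (\<lambda>f x. 1 / sqrt (weight \<beta> x) * commutator 1 (\<lambda>x. sqrt (weight \<beta> x)) f x) p (weight \<beta>)"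
    by (simp only: sqrt_weight)
qed

end
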